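(* Let $\Omega\subset\mathbb C^n$ be a bounded domain and, unless indicated otherwise, $1<p<\infty$. Let $P_p$ be the $p$-Bergman projection on $\Omega$. (1) If $f\in L^p(\Omega)$ is a function such that $\bar\partial f$ is well-defined, then $Q_p(f):=f-P_p(f)$ is the $L^p$-minimal solution of $\bar\partial u=\bar\partial f$. (2) For any $f\in L^p(\Omega)$ and $F\in\mathrm{Aut}(\Omega)$ we have $$P_p(f)\circ F\cdot J_F^{2/p}=P_p\left(f\circ F\cdot J_F^{2/p}\right)$$ whenever $\Omega$ is simply-connected; in particular, if $f\in P_p^{-1}(0)$, then $f\circ F\cdot J_F^{2/p}\in P_p^{-1}(0)$. (3) There exists a constant $C_p>0$ such that for all $f,g\in L^p(\Omega)$ $$\|P_p(f)-P_p(g)\|_p\le\begin{cases}C_p(\|f\|_p+\|f-g\|_p)^{1-1/p}\,\|f-g\|_p^{1/p}&\text{for }2<p<\infty,\\ C_p(\|f\|_p+\|f-g\|_p)^{1/2}\,\|f-g\|_p^{1/2}&\text{for }1<p\le2.\end{cases}$$ (4) For any $f\in L^\infty(\Omega)$, there exists a sequence $p_j\uparrow\infty$ such that $P_{p_j}(f)$ converges locally uniformly to some $h_\infty\in A^\infty(\Omega)$ which is an element of best approximation of $f$ in $L^\infty(\Omega)$, i.e. $\|f-h_\infty\|_\infty=\inf_{h\in A^\infty(\Omega)}\|f-h\|_\infty$. (5) Let $d_p(f)$ denote the distance of $f\in L^p(\Omega)$ to $A^p(\Omega)$ for $0<p\le\infty$. Then $$d_\infty(f)=\lim_{p\to\infty}d_p(f),\qquad\forall\,f\in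 L^\infty(\Omega).$$
   Context: $A^p(\Omega)$ is the space of holomorphic functions in $L^p(\Omega)$ (Lebesgue measure), with norm $\|\cdot\|_p$; $A^\infty(\Omega)$ is the space of bounded holomorphic functions with the sup norm. For $1<p<\infty$ every $f\in L^p(\Omega)$ has a unique element $P_p(f)\in A^p(\Omega)$ with $\|f-P_p(f)\|_p=\inf_{h\in A^p(\Omega)}\|f-h\|_p$; the (in general nonlinear) map $P_p:L^p(\Omega)\to A^p(\Omega)$ is the $p$-Bergman projection. $P_p^{-1}(0)=\{f\in L^p(\Omega):P_p(f)=0\}$. The $L^p$-minimal solution of $\bar\partial u=\bar\partial f$ (in the sense of distributions) is the solution with smallest $L^p$-norm. $\mathrm{Aut}(\Omega)$ is the group of holomorphic automorphisms of $\Omega$, $J_F$ is the complex Jacobian determinant of $F$, and $J_F^{2/p}$ is a (fixed) holomorphic branch of the power, which exists when $\Omega$ is simply-connected. *)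

theory Defs
  imports "HOL-Analysis.Analysis" "HOL-Probability.Essential_Supremum"
begin

section \<open>Holomorphic functions and automorphisms\<close>

definition holo_on :: "(complex^'n::finite) set \<Rightarrow> (complex^'n \<Rightarrow> complex) \<Rightarrow> bool" where
  "holo_on \<Omega> f \<longleftrightarrow>
     (\<forall>z\<in>\<Omega>. \<exists>D. (f has_derivative D) (at z) \<and> (\<forall>c v. D (c *s v) = c * D v))"

definition holo_map_on :: "(complex^'n::finite) set \<Rightarrow> (complex^'n \<Rightarrow> complex^'n) \<Rightarrow> bool" where
  "holo_map_on \<Omega> F \<longleftrightarrow> (\<forall>i. holo_on \<Omega> (\<lambda>z. F z $ i))"

definition Aut :: "(complex^'n::finite) set \<Rightarrow> (complex^'n \<Rightarrow> complex^'n) set" where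
  "Aut \<Omega> = {F. bij_betw F \<Omega> \<Omega> \<and> holo_map_on \<Omega> F \<and> holo_map_on \<Omega> (inv_into \<Omega> F)}"

text \<open>For holomorphic F the real Frechet derivative is complex linear, and its matrix is
  the complex Jacobian matrix.\<close>

definition jac :: "(complex^'n::finite \<Rightarrow> complex^'n) \<Rightarrow> complex^'n \<Rightarrow> complex" where
  "jac F z = det (matrix (frechet_derivative F (at z)))"

text \<open>G is a holomorphic branch of the power J to the a on \<open>\<Omega>\<close>,
  given by a holomorphic logarithm of J.\<close>

definition holo_power_branch ::
  "(complex^'n::finite) set \<Rightarrow> (complex^'n \<Rightarrow> complex) \<Rightarrow> real \<Rightarrow> (complex^'n \<Rightarrow> complex) \<Rightarrow> bool" where
  "holo_power_branch \<Omega> J a G \<longleftrightarrow>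
     (\<exists>L. holo_on \<Omega> L \<and> (\<forall>z\<in>\<Omega>. exp (L z) = J z \<and> G z = exp (of_real a * L z)))"

section \<open>Lebesgue and Bergman spaces\<close>

text \<open>Elements of the Lebesgue spaces are represented by functions rather than by classes
  modulo null sets; values outside \<open>\<Omega>\<close> are irrelevant. The exponent infinity gets
  separate constants.\<close>

definition Lp :: "(complex^'n::finite) set \<Rightarrow> real \<Rightarrow> (complex^'n \<Rightarrow> complex) set" where
  "Lp \<Omega> p = {f \<in> borel_measurable (lebesgue_on \<Omega>).
               integrable (lebesgue_on \<Omega>) (\<lambda>z. norm (f z) powr p)}"

definition Lp_norm :: "(complex^'n::finite) set \<Rightarrow> real \<Rightarrow> (complex^'n \<Rightarrow> complex) \<Rightarrow> real" where
  "Lp_norm \<Omega> p f = (integral\<^sup>L (lebesgue_on \<Omega>) (\<lambda>z. norm (f z) powr p)) powr (1 / p)"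

definition Linf :: "(complex^'n::finite) set \<Rightarrow> (complex^'n \<Rightarrow> complex) set" where
  "Linf \<Omega> = {f \<in> borel_measurable (lebesgue_on \<Omega>).
               esssup (lebesgue_on \<Omega>) (\<lambda>z. ereal (norm (f z))) < \<infinity>}"

definition Linf_norm :: "(complex^'n::finite) set \<Rightarrow> (complex^'n \<Rightarrow> complex) \<Rightarrow> real" where
  "Linf_norm \<Omega> f = real_of_ereal (esssup (lebesgue_on \<Omega>) (\<lambda>z. ereal (norm (f z))))"

definition Ap :: "(complex^'n::finite) set \<Rightarrow> real \<Rightarrow> (complex^'n \<Rightarrow> complex) set" where
  "Ap \<Omega> p = {h \<in> Lp \<Omega> p. holo_on \<Omega> h}"

definition Ainf :: "(complex^'n::finite) set \<Rightarrow> (complex^'n \<Rightarrow> complex) set" where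
  "Ainf \<Omega> = {h. holo_on \<Omega> h \<and> bounded (h ` \<Omega>)}"

definition Ap_dist :: "(complex^'n::finite) set \<Rightarrow> real \<Rightarrow> (complex^'n \<Rightarrow> complex) \<Rightarrow> real" where
  "Ap_dist \<Omega> p f = (INF h\<in>Ap \<Omega> p. Lp_norm \<Omega> p (\<lambda>z. f z - h z))"

definition Ainf_dist :: "(complex^'n::finite) set \<Rightarrow> (complex^'n \<Rightarrow> complex) \<Rightarrow> real" where
  "Ainf_dist \<Omega> f = (INF h\<in>Ainf \<Omega>. Linf_norm \<Omega> (\<lambda>z. f z - h z))"

text \<open>The value 0 outside \<open>\<Omega>\<close> is a normalization that turns uniqueness of the best
  approximation on \<open>\<Omega>\<close> into uniqueness as a HOL function.\<close>

definition bergman_proj ::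
  "(complex^'n::finite) set \<Rightarrow> real \<Rightarrow> (complex^'n \<Rightarrow> complex) \<Rightarrow> (complex^'n \<Rightarrow> complex)" where
  "bergman_proj \<Omega> p f =
     (THE h. h \<in> Ap \<Omega> p \<and> (\<forall>z. z \<notin> \<Omega> \<longrightarrow> h z = 0) \<and>
             Lp_norm \<Omega> p (\<lambda>z. f z - h z) = Ap_dist \<Omega> p f)"

definition bergman_null :: "(complex^'n::finite) set \<Rightarrow> real \<Rightarrow> (complex^'n \<Rightarrow> complex) set" where
  "bergman_null \<Omega> p = {f \<in> Lp \<Omega> p. \<forall>z\<in>\<Omega>. bergman_proj \<Omega> p f z = 0}"

section \<open>The Cauchy-Riemann operator in the sense of distributions\<close>

primrec C_k :: "nat \<Rightarrow> ('a::real_normed_vector \<Rightarrow> 'b::real_normed_vector) \<Rightarrow> bool" where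
  "C_k 0 f \<longleftrightarrow> continuous_on UNIV f"
| "C_k (Suc k) f \<longleftrightarrow> (\<forall>x. f differentiable (at x)) \<and>
                     (\<forall>v. C_k k (\<lambda>x. frechet_derivative f (at x) v))"

definition test_functions :: "(complex^'n::finite) set \<Rightarrow> (complex^'n \<Rightarrow> complex) set" where
  "test_functions \<Omega> =
     {\<phi>. (\<forall>k. C_k k \<phi>) \<and> compact (closure {z. \<phi> z \<noteq> 0}) \<and> closure {z. \<phi> z \<noteq> 0} \<subseteq> \<Omega>}"

text \<open>\<open>wirtinger_bar j \<phi>\<close> is the derivative of \<open>\<phi>\<close> with respect to the conjugate of the
  j-th coordinate, that is, half of the x-derivative plus \<open>\<i>\<close> times the y-derivative.\<close>

definition wirtinger_bar :: "'n::finite \<Rightarrow> (complex^'n \<Rightarrow> complex) \<Rightarrow> complex^'n \<Rightarrow> complex" where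
  "wirtinger_bar j \<phi> z =
     (frechet_derivative \<phi> (at z) (axis j 1) + \<i> * frechet_derivative \<phi> (at z) (axis j \<i>)) / 2"

text \<open>A function has a dbar-derivative in the sense of distributions as soon as it defines a
  distribution, i.e. is locally integrable.\<close>

definition dbar_well_defined :: "(complex^'n::finite) set \<Rightarrow> (complex^'n \<Rightarrow> complex) \<Rightarrow> bool" where
  "dbar_well_defined \<Omega> f \<longleftrightarrow> f \<in> borel_measurable (lebesgue_on \<Omega>) \<and>
     (\<forall>K. compact K \<and> K \<subseteq> \<Omega> \<longrightarrow> integrable (lebesgue_on K) f)"

text \<open>The coefficient of \<open>d\<close> of the conjugate of the j-th coordinate in \<open>dbar u\<close>, as a
  functional on test functions.\<close>

definition dbar ::
  "(complex^'n::finite) set \<Rightarrow> (complex^'n \<Rightarrow> complex) \<Rightarrow> 'n \<Rightarrow> (complex^'n \<Rightarrow> complex) \<Rightarrow> complex" where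
  "dbar \<Omega> u j \<phi> = - integral\<^sup>L (lebesgue_on \<Omega>) (\<lambda>z. u z * wirtinger_bar j \<phi> z)"

definition dbar_eq :: 
  "(complex^'n::finite) set \<Rightarrow> (complex^'n \<Rightarrow> complex) \<Rightarrow> (complex^'n \<Rightarrow> complex) \<Rightarrow> bool" where
  "dbar_eq \<Omega> u f \<longleftrightarrow> (\<forall>j. \<forall>\<phi>\<in>test_functions \<Omega>. dbar \<Omega> u j \<phi> = dbar \<Omega> f j \<phi>)"

text \<open>The minimal solution, characterized as the unique one (up to null sets) of smallest norm.\<close>

definition Lp_minimal_solution ::
  "(complex^'n::finite) set \<Rightarrow> real \<Rightarrow> (complex^'n \<Rightarrow> complex) \<Rightarrow> (complex^'n \<Rightarrow> complex) \<Rightarrow> bool" where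
  "Lp_minimal_solution \<Omega> p f u \<longleftrightarrow>
     u \<in> Lp \<Omega> p \<and> dbar_eq \<Omega> u f \<and>
     (\<forall>v\<in>Lp \<Omega> p. dbar_eq \<Omega> v f \<longrightarrow>
        Lp_norm \<Omega> p u \<le> Lp_norm \<Omega> p v \<and>
        (Lp_norm \<Omega> p v = Lp_norm \<Omega> p u \<longrightarrow> (AE z in lebesgue_on \<Omega>. v z = u z)))"

section \<open>Locally uniform convergence\<close>

definition locally_uniform_limit ::
  "(complex^'n::finite) set \<Rightarrow> (nat \<Rightarrow> complex^'n \<Rightarrow> complex) \<Rightarrow> (complex^'n \<Rightarrow> complex) \<Rightarrow> bool" where
  "locally_uniform_limit \<Omega> f h \<longleftrightarrow>
     (\<forall>z\<in>\<Omega>. \<exists>r>0. ball z r \<subseteq> \<Omega> \<and> uniform_limit (ball z r) f h sequentially)"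

end

theory Submission
  imports Defs "HOL-Complex_Analysis.Great_Picard"
begin

text \<open>
  The spaces \<open>A^p\<close> have two properties which give existence, uniqueness and stability of best
  approximations: bounded sequences in them are compact, and \<open>L^p\<close> is uniformly convex.

  For compactness, the value of a holomorphic function at \<open>z\<close> is bounded by the mean of its modulus
  over a ball around \<open>z\<close> (\<open>sub_mean_value\<close>). A sequence of holomorphic functions which is bounded in
  \<open>L^1\<close> is therefore locally bounded and has a locally uniformly convergent subsequence (\<open>Montel_L1\<close>).
  Applied to a minimizing sequence, together with Fatou's lemma, this yields a best approximation
  (\<open>best_approximation_exists\<close>). Applied to the projections for exponents tending to infinity, it
  yields a limit \<open>h\<close>. The distances to \<open>A^p\<close>, normalized by the volume of \<open>\<Omega>\<close>, increase with \<open>p\<close> and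
  are bounded by the distance to \<open>A^\<infinity>\<close>. If \<open>S\<close> is their limit, then the normalized \<open>L^q\<close> norm of
  \<open>f - h\<close> is at most \<open>S\<close> for every \<open>q\<close>, so \<open>f - h\<close> is bounded by \<open>S\<close> almost everywhere. Hence \<open>h\<close> is a
  best approximation in \<open>L^\<infinity>\<close> and \<open>S\<close> is the distance to \<open>A^\<infinity>\<close> (\<open>bergman_proj_large_exponents\<close>,
  \<open>Ap_dist_tendsto_Ainf_dist\<close>).

  For convexity, let \<open>d\<close> be the distance of \<open>f\<close> to \<open>A^p\<close> and \<open>\<delta>\<close> the norm of \<open>f - g\<close>. The functions
  \<open>f - P f\<close> and \<open>f - P g\<close> have norm at most \<open>d + 2\<delta>\<close>, while their midpoint has norm at least \<open>d\<close>
  because it again differs from \<open>f\<close> by an element of \<open>A^p\<close>. Quantitative forms of strict convexity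
  (\<open>Lp_midpoint_gap_ge_2\<close>, \<open>Lp_midpoint_gap_less_2\<close>) turn this into the bound for \<open>P f - P g\<close>, and for
  \<open>\<delta> = 0\<close> into uniqueness.

  The real Jacobian of an automorphism \<open>F\<close> is the squared modulus of its complex Jacobian
  (\<open>det_square_invertible\<close>). So \<open>f \<mapsto> f \<circ> F \<cdot> J_F powr (2/p)\<close> is an isometry of \<open>L^p\<close>; it maps \<open>A^p\<close> onto
  itself and commutes with best approximation (\<open>bergman_proj_pull\<close>).

  Finally, the solutions in \<open>L^p\<close> of \<open>dbar u = dbar f\<close> are, up to null sets, the functions \<open>f - h\<close> with
  \<open>h\<close> in \<open>A^p\<close>: a holomorphic function is annihilated by \<open>dbar\<close> in the sense of distributions
  (\<open>integral_holo_wirtinger_bar\<close>), and conversely by Weyl's lemma (\<open>Weyl_dbar\<close>). The solution of smallest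
  norm is then \<open>f - P f\<close> by definition of \<open>P\<close>.
\<close>

section \<open>Inequalities for $L^p$ norms\<close>

lemma convex_on_powr_nonneg:
  assumes "(p::real) \<ge> 1"
  shows "convex_on {0..} (\<lambda>x::real. x powr p)"
proof (rule convex_onI)
  fix t x y :: real
  assume t: "0 < t" "t < 1" and xy: "x \<in> {0..}" "y \<in> {0..}"
  have shrink: "c powr p \<le> c" if "0 < c" "c < 1" for c :: real
    using powr_mono'[of 1 p c] that assms by simp
  consider "x > 0" "y > 0" | "x = 0" | "y = 0" using xy by fastforce
  then show "((1 - t) *\<^sub>R x + t *\<^sub>R y) powr p \<le> (1 - t) * x powr p + t * y powr p"
  proof cases
    case 1
    then show ?thesis
      using convex_onD[OF powr_convex[OF assms], of t x y] t by simp
  next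
    case 2
    then show ?thesis using t xy shrink[of t] by (simp add: powr_mult mult_right_mono)
  next
    case 3
    then show ?thesis using t xy shrink[of "1 - t"] by (simp add: powr_mult mult_right_mono)
  qed
qed auto

lemma powr_sum_le:
  assumes "p > 0" "(a::real) \<ge> 0" "b \<ge> 0"
  shows "(a + b) powr p \<le> 2 powr p * (a powr p + b powr p)"
proof -
  have "(a + b) powr p \<le> (2 * max a b) powr p"
    using assms by (intro powr_mono2) auto
  also have "\<dots> = 2 powr p * max a b powr p"
    using assms by (simp add: powr_mult)
  also have "max a b powr p \<le> a powr p + b powr p"
    by (auto simp: max_def)
  finally show ?thesis by (simp add: mult_left_mono)
qed

lemma powr_diff_le:
  assumes "p \<ge> 1" "0 \<le> a" "a \<le> (b::real)"
  shows "b powr p - a powr p \<le> p * b powr (p - 1) * (b - a)"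
proof (cases "a = 0 \<or> a = b")
  case True
  have "b powr p = b powr (p - 1) * b" if "b > 0"
    using that powr_mult_base[of b "p-1"] by (simp add: mult.commute)
  moreover have "b powr (p - 1) * b \<le> p * (b powr (p - 1) * b)" if "b > 0"
    using that assms mult_right_mono[of 1 p "b powr (p-1) * b"] by simp
  ultimately show ?thesis using True assms by (cases "b = 0") (auto simp: mult.assoc)
next
  case False
  then have ab: "0 < a" "a < b" using assms by auto
  have "\<exists>z>a. z < b \<and> b powr p - a powr p = (b - a) * (p * z powr (p - 1))"
    by (rule MVT2) (use ab in \<open>auto intro!: derivative_eq_intros\<close>)
  then obtain z where z: "a < z" "z < b" "b powr p - a powr p = (b - a) * (p * z powr (p - 1))"
    by blast
  have "z powr (p - 1) \<le> b powr (p - 1)" using z ab assms by (intro powr_mono2) auto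
  then show ?thesis using z ab assms by (simp add: mult.commute mult_left_mono)
qed

lemma Young_weighted:
  assumes "0 < \<theta>" "\<theta> < 1" "a \<ge> 0" "(b::real) \<ge> 0"
  shows "a powr \<theta> * b powr (1 - \<theta>) \<le> \<theta> * a + (1 - \<theta>) * b"
  using Youngs_inequality_0[of \<theta> "1-\<theta>" a b] assms by (cases "a = 0 \<or> b = 0") auto

text \<open>After dividing by the integrals of \<open>u\<close> and \<open>v\<close>, this is Young's inequality integrated.\<close>

lemma Hoelder_interpolation:
  fixes u v w :: "'a \<Rightarrow> real"
  assumes \<theta>: "0 < \<theta>" "\<theta> < 1"
    and u: "integrable M u" "\<And>x. u x \<ge> 0" and v: "integrable M v" "\<And>x. v x \<ge> 0"
    and w: "integrable M w" "\<And>x. w x \<le> u x powr \<theta> * v x powr (1 - \<theta>)"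
  shows "integral\<^sup>L M w \<le> (integral\<^sup>L M u) powr \<theta> * (integral\<^sup>L M v) powr (1 - \<theta>)"
proof -
  define U V where "U = integral\<^sup>L M u" and "V = integral\<^sup>L M v"
  have UV: "U \<ge> 0" "V \<ge> 0" unfolding U_def V_def using u v by auto
  have triv: "integral\<^sup>L M w \<le> 0" if "AE x in M. u x = 0 \<or> v x = 0"
  proof -
    have "AE x in M. w x \<le> 0"
      using that
    proof (rule eventually_mono)
      fix x assume "u x = 0 \<or> v x = 0"
      then show "w x \<le> 0" using w(2)[of x] by auto
    qed
    then have "integral\<^sup>L M w \<le> integral\<^sup>L M (\<lambda>x. 0)"
      using w(1) by (intro integral_mono_AE) auto
    then show ?thesis by simp
  qed
  show ?thesis
  proof (cases "U = 0 \<or> V = 0")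
    case True
    then have "AE x in M. u x = 0 \<or> v x = 0"
      unfolding U_def V_def
      using integral_nonneg_eq_0_iff_AE[OF u(1)] integral_nonneg_eq_0_iff_AE[OF v(1)] u(2) v(2)
      by (auto elim: eventually_mono)
    from triv[OF this] show ?thesis unfolding U_def V_def using True U_def V_def by auto
  next
    case False
    then have UV: "U > 0" "V > 0" using UV by auto
    define c where "c = U powr \<theta> * V powr (1 - \<theta>)"
    have c: "c > 0" unfolding c_def using UV by simp
    have "w x \<le> c * (\<theta> * (u x / U) + (1 - \<theta>) * (v x / V))" for x
    proof -
      have "w x \<le> u x powr \<theta> * v x powr (1 - \<theta>)" by (rule w)
      also have "\<dots> = c * ((u x / U) powr \<theta> * (v x / V) powr (1 - \<theta>))"
        unfolding c_def using UV u(2)[of x] v(2)[of x] by (simp add: powr_divide)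
      also have "\<dots> \<le> c * (\<theta> * (u x / U) + (1 - \<theta>) * (v x / V))"
        using c UV u(2)[of x] v(2)[of x] Young_weighted[OF \<theta>, of "u x / U" "v x / V"] by simp
      finally show ?thesis .
    qed
    then have "integral\<^sup>L M w \<le> integral\<^sup>L M (\<lambda>x. c * (\<theta> * (u x / U) + (1 - \<theta>) * (v x / V)))"
      using u v w by (intro integral_mono) auto
    also have "\<dots> = c * (\<theta> * (U / U) + (1 - \<theta>) * (V / V))"
      using u(1) v(1) by (simp add: U_def V_def)
    also have "\<dots> = c" using UV by simp
    finally show ?thesis unfolding c_def U_def V_def .
  qed
qed

subsection \<open>The spaces $L^p$\<close>

abbreviation Lp_int :: "(complex^'n::finite) set \<Rightarrow> real \<Rightarrow> (complex^'n \<Rightarrow> complex) \<Rightarrow> real" where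
  "Lp_int \<Omega> p f \<equiv> integral\<^sup>L (lebesgue_on \<Omega>) (\<lambda>z. norm (f z) powr p)"

lemma Lp_norm_nonneg [simp]: "Lp_norm \<Omega> p f \<ge> 0"
  by (simp add: Lp_norm_def)

lemma Lp_norm_powr:
  assumes "p > 0" shows "Lp_norm \<Omega> p f powr p = Lp_int \<Omega> p f"
  using assms by (simp add: Lp_norm_def powr_powr)

lemma Lp_measurable [dest]: "f \<in> Lp \<Omega> p \<Longrightarrow> f \<in> borel_measurable (lebesgue_on \<Omega>)"
  and Lp_integrable: "f \<in> Lp \<Omega> p \<Longrightarrow> integrable (lebesgue_on \<Omega>) (\<lambda>z. norm (f z) powr p)"
  by (auto simp: Lp_def)

lemma Lp_zero [simp]: "(\<lambda>z. 0) \<in> Lp \<Omega> p"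
  by (simp add: Lp_def)

lemma Lp_cmult:
  assumes "f \<in> Lp \<Omega> p" shows "(\<lambda>z. c * f z) \<in> Lp \<Omega> p"
  using assms by (auto simp: Lp_def norm_mult powr_mult)

lemma Lp_norm_cmult:
  assumes "p > 0" shows "Lp_norm \<Omega> p (\<lambda>z. c * f z) = norm c * Lp_norm \<Omega> p f"
  using assms by (simp add: Lp_norm_def norm_mult powr_mult powr_powr)

lemma Lp_add:
  assumes p: "p > 0" and f: "f \<in> Lp \<Omega> p" and g: "g \<in> Lp \<Omega> p"
  shows "(\<lambda>z. f z + g z) \<in> Lp \<Omega> p"
proof -
  have [measurable]: "f \<in> borel_measurable (lebesgue_on \<Omega>)" "g \<in> borel_measurable (lebesgue_on \<Omega>)"
    using f g by auto
  have "integrable (lebesgue_on \<Omega>) (\<lambda>z. norm (f z + g z) powr p)"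
  proof (rule Bochner_Integration.integrable_bound)
    show "integrable (lebesgue_on \<Omega>) (\<lambda>z. 2 powr p * (norm (f z) powr p + norm (g z) powr p))"
      using f g by (auto simp: Lp_def)
    have "norm (f z + g z) powr p \<le> 2 powr p * (norm (f z) powr p + norm (g z) powr p)" for z
      by (rule order.trans[OF powr_mono2[OF _ _ norm_triangle_ineq] powr_sum_le]) (use p in auto)
    then show "AE z in lebesgue_on \<Omega>. norm (norm (f z + g z) powr p)
        \<le> norm (2 powr p * (norm (f z) powr p + norm (g z) powr p))"
      by (intro AE_I2) (simp add: abs_mult)
  qed measurable
  then show ?thesis unfolding Lp_def by simp
qed

lemma Lp_diff:
  assumes "p > 0" "f \<in> Lp \<Omega> p" "g \<in> Lp \<Omega> p"
  shows "(\<lambda>z. f z - g z) \<in> Lp \<Omega> p"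
  using Lp_add[OF assms(1,2) Lp_cmult[OF assms(3), of "-1"]] by simp

lemma Lp_norm_minus_commute: "Lp_norm \<Omega> p (\<lambda>z. f z - g z) = Lp_norm \<Omega> p (\<lambda>z. g z - f z)"
  by (simp add: Lp_norm_def norm_minus_commute)

lemma Lp_norm_cong_AE:
  assumes "f \<in> borel_measurable (lebesgue_on \<Omega>)" "g \<in> borel_measurable (lebesgue_on \<Omega>)"
    and "AE z in lebesgue_on \<Omega>. f z = g z"
  shows "Lp_norm \<Omega> p f = Lp_norm \<Omega> p g"
proof -
  have [measurable]: "f \<in> borel_measurable (lebesgue_on \<Omega>)" "g \<in> borel_measurable (lebesgue_on \<Omega>)"
    using assms by auto
  have "Lp_int \<Omega> p f = Lp_int \<Omega> p g"
    by (rule integral_cong_AE) (use assms(3) in \<open>auto elim: eventually_mono\<close>)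
  then show ?thesis by (simp add: Lp_norm_def)
qed

lemma Lp_cong_AE:
  assumes "f \<in> Lp \<Omega> p" "g \<in> borel_measurable (lebesgue_on \<Omega>)"
    and "AE z in lebesgue_on \<Omega>. f z = g z"
  shows "g \<in> Lp \<Omega> p"
proof -
  have [measurable]: "f \<in> borel_measurable (lebesgue_on \<Omega>)" "g \<in> borel_measurable (lebesgue_on \<Omega>)"
    using assms by auto
  have "integrable (lebesgue_on \<Omega>) (\<lambda>z. norm (g z) powr p)"
    by (rule integrable_cong_AE_imp[OF Lp_integrable[OF assms(1)]])
      (use assms(3) in \<open>auto elim: eventually_mono\<close>)
  then show ?thesis unfolding Lp_def by simp
qed

lemma Lp_cong:
  assumes "\<And>z. z \<in> \<Omega> \<Longrightarrow> f z = g z"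
  shows "f \<in> Lp \<Omega> p \<longleftrightarrow> g \<in> Lp \<Omega> p" "Lp_norm \<Omega> p f = Lp_norm \<Omega> p g"
proof -
  have m: "f \<in> borel_measurable (lebesgue_on \<Omega>) \<longleftrightarrow> g \<in> borel_measurable (lebesgue_on \<Omega>)"
    by (rule measurable_cong) (use assms in auto)
  have i: "integrable (lebesgue_on \<Omega>) (\<lambda>z. norm (f z) powr p) \<longleftrightarrow>
           integrable (lebesgue_on \<Omega>) (\<lambda>z. norm (g z) powr p)"
    by (rule Bochner_Integration.integrable_cong) (use assms in auto)
  show "f \<in> Lp \<Omega> p \<longleftrightarrow> g \<in> Lp \<Omega> p" unfolding Lp_def using m i by simp
  show "Lp_norm \<Omega> p f = Lp_norm \<Omega> p g" unfolding Lp_norm_def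
    by (subst Bochner_Integration.integral_cong[OF refl]) (use assms in auto)
qed

lemma Lp_norm_eq_0_AE:
  assumes "f \<in> Lp \<Omega> p" "Lp_norm \<Omega> p f = 0"
  shows "AE z in lebesgue_on \<Omega>. f z = 0"
proof -
  have "Lp_int \<Omega> p f = 0" using assms(2) by (simp add: Lp_norm_def)
  then have "AE z in lebesgue_on \<Omega>. norm (f z) powr p = 0"
    using integral_nonneg_eq_0_iff_AE[OF Lp_integrable[OF assms(1)]] by simp
  then show ?thesis by (auto elim: eventually_mono)
qed

text \<open>The triangle inequality is convexity of \<open>t powr p\<close>, applied to \<open>f\<close> and \<open>g\<close> divided by
  upper bounds of their norms. The bounds are taken positive, which covers the degenerate cases
  by letting \<open>e\<close> tend to 0.\<close>

lemma Minkowski: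
  assumes p: "p \<ge> 1" and f: "f \<in> Lp \<Omega> p" and g: "g \<in> Lp \<Omega> p"
  shows "Lp_norm \<Omega> p (\<lambda>z. f z + g z) \<le> Lp_norm \<Omega> p f + Lp_norm \<Omega> p g"
proof (rule field_le_epsilon)
  fix e :: real assume e: "e > 0"
  define a where "a = Lp_norm \<Omega> p f + e/2"
  define b where "b = Lp_norm \<Omega> p g + e/2"
  have ab: "a > 0" "b > 0" unfolding a_def b_def using e by (simp_all add: add_nonneg_pos)
  have le: "Lp_int \<Omega> p f \<le> a powr p" "Lp_int \<Omega> p g \<le> b powr p"
    using p e Lp_norm_powr[of p \<Omega> f] Lp_norm_powr[of p \<Omega> g]
    by (auto simp: a_def b_def powr_mono2 simp flip: Lp_norm_powr)
  define t where "t = b / (a + b)"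
  have t: "0 \<le> t" "t \<le> 1" "1 - t = a / (a + b)" unfolding t_def using ab by (auto simp: field_simps)
  have pt: "norm (f z + g z) powr p \<le>
      (a + b) powr p * ((1 - t) * (norm (f z) powr p / a powr p) + t * (norm (g z) powr p / b powr p))" for z
  proof -
    have "norm (f z + g z) powr p \<le> (norm (f z) + norm (g z)) powr p"
      using p by (intro powr_mono2) (auto intro: norm_triangle_ineq)
    also have "norm (f z) + norm (g z) = (a + b) * ((1 - t) *\<^sub>R (norm (f z) / a) + t *\<^sub>R (norm (g z) / b))"
    proof -
      have "(a + b) * (1 - t) = a" "(a + b) * t = b" unfolding t(3) using ab by (auto simp: t_def)
      then have "(a + b) * ((1 - t) * (norm (f z) / a) + t * (norm (g z) / b))
          = a * (norm (f z) / a) + b * (norm (g z) / b)"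
        unfolding distrib_left mult.assoc[symmetric] by simp
      then show ?thesis using ab by simp
    qed
    also have "\<dots> powr p = (a + b) powr p * ((1 - t) *\<^sub>R (norm (f z) / a) + t *\<^sub>R (norm (g z) / b)) powr p"
      using ab t by (simp add: powr_mult)
    also have "\<dots> \<le> (a + b) powr p * ((1 - t) * (norm (f z) / a) powr p + t * (norm (g z) / b) powr p)"
      by (intro mult_left_mono convex_onD[OF convex_on_powr_nonneg[OF p]]) (use ab t in auto)
    finally show ?thesis using ab by (simp add: powr_divide)
  qed
  have "Lp_int \<Omega> p (\<lambda>z. f z + g z) \<le> integral\<^sup>L (lebesgue_on \<Omega>) (\<lambda>z. (a + b) powr p *
     ((1 - t) * (norm (f z) powr p / a powr p) + t * (norm (g z) powr p / b powr p)))"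
    using p Lp_integrable[OF Lp_add[OF _ f g]] Lp_integrable[OF f] Lp_integrable[OF g] pt
    by (intro integral_mono) auto
  also have "\<dots> = (a + b) powr p * ((1 - t) * (Lp_int \<Omega> p f / a powr p) + t * (Lp_int \<Omega> p g / b powr p))"
    using Lp_integrable[OF f] Lp_integrable[OF g] by simp
  also have "\<dots> \<le> (a + b) powr p * ((1 - t) * 1 + t * 1)"
    using le ab t by (intro mult_left_mono add_mono) auto
  also have "\<dots> = (a + b) powr p" by simp
  finally have "Lp_norm \<Omega> p (\<lambda>z. f z + g z) \<le> ((a + b) powr p) powr (1 / p)"
    unfolding Lp_norm_def using p by (intro powr_mono2) auto
  also have "\<dots> = a + b" using p ab by (simp add: powr_powr)
  finally show "Lp_norm \<Omega> p (\<lambda>z. f z + g z) \<le> Lp_norm \<Omega> p f + Lp_norm \<Omega> p g + e"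
    by (simp add: a_def b_def)
qed

lemma Lp_norm_triangle:
  assumes "p \<ge> 1" "f \<in> Lp \<Omega> p" "g \<in> Lp \<Omega> p"
  shows "Lp_norm \<Omega> p f \<le> Lp_norm \<Omega> p (\<lambda>z. f z - g z) + Lp_norm \<Omega> p g"
proof -
  have "p > 0" using assms by simp
  from Minkowski[OF assms(1) Lp_diff[OF this assms(2,3)] assms(3)] show ?thesis by simp
qed

text \<open>The bound may depend on \<open>k\<close>: a minimizing sequence only satisfies bounds that tend to the
  infimum.\<close>

lemma Lp_Fatou:
  assumes p: "p > 0" and u: "\<And>k. u k \<in> Lp \<Omega> p" and lim: "\<And>z. z \<in> \<Omega> \<Longrightarrow> (\<lambda>k. u k z) \<longlonglongrightarrow> v z"
    and bd: "\<And>k. Lp_norm \<Omega> p (u k) \<le> B k" and B: "B \<longlonglongrightarrow> b"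
  shows "v \<in> Lp \<Omega> p" "Lp_norm \<Omega> p v \<le> b"
proof -
  have [measurable]: "u k \<in> borel_measurable (lebesgue_on \<Omega>)" for k using u by auto
  have v[measurable]: "v \<in> borel_measurable (lebesgue_on \<Omega>)"
    by (rule borel_measurable_LIMSEQ_metric[where f=u]) (use lim in auto)
  have B0: "B k \<ge> 0" for k
    using bd[of k] Lp_norm_nonneg[of \<Omega> p "u k"] by linarith
  then have b0: "b \<ge> 0"
    using LIMSEQ_le_const[OF B, of 0] by blast
  have "(\<integral>\<^sup>+z. ennreal (norm (v z) powr p) \<partial>lebesgue_on \<Omega>) =
        (\<integral>\<^sup>+z. liminf (\<lambda>k. ennreal (norm (u k z) powr p)) \<partial>lebesgue_on \<Omega>)"
  proof (rule nn_integral_cong)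
    fix z assume "z \<in> space (lebesgue_on \<Omega>)"
    then have "(\<lambda>k. norm (u k z) powr p) \<longlonglongrightarrow> norm (v z) powr p"
      using p by (intro tendsto_powr2 tendsto_intros lim) auto
    then have "(\<lambda>k. ennreal (norm (u k z) powr p)) \<longlonglongrightarrow> ennreal (norm (v z) powr p)"
      by (rule tendsto_ennrealI)
    from lim_imp_Liminf[OF _ this]
    show "ennreal (norm (v z) powr p) = liminf (\<lambda>k. ennreal (norm (u k z) powr p))" by simp
  qed
  also have "\<dots> \<le> liminf (\<lambda>k. \<integral>\<^sup>+z. ennreal (norm (u k z) powr p) \<partial>lebesgue_on \<Omega>)"
    by (rule nn_integral_liminf) measurable
  also have "\<dots> \<le> liminf (\<lambda>k. ennreal (B k powr p))"
  proof (intro Liminf_mono eventuallyI)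
    fix k
    have "(\<integral>\<^sup>+z. ennreal (norm (u k z) powr p) \<partial>lebesgue_on \<Omega>) = ennreal (Lp_int \<Omega> p (u k))"
      by (rule nn_integral_eq_integral[OF Lp_integrable[OF u]]) simp
    also have "\<dots> \<le> ennreal (B k powr p)"
      using p bd by (auto simp flip: Lp_norm_powr[OF p] intro!: ennreal_leI powr_mono2)
    finally show "(\<integral>\<^sup>+z. ennreal (norm (u k z) powr p) \<partial>lebesgue_on \<Omega>) \<le> ennreal (B k powr p)" .
  qed
  also have "\<dots> = ennreal (b powr p)"
  proof (rule lim_imp_Liminf)
    show "(\<lambda>k. ennreal (B k powr p)) \<longlonglongrightarrow> ennreal (b powr p)"
      using p B B0 by (intro tendsto_ennrealI tendsto_powr2 tendsto_intros) auto
  qed simp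
  finally have fin: "(\<integral>\<^sup>+z. ennreal (norm (v z) powr p) \<partial>lebesgue_on \<Omega>) \<le> ennreal (b powr p)" .
  have int: "integrable (lebesgue_on \<Omega>) (\<lambda>z. norm (v z) powr p)"
  proof (rule integrableI_nonneg)
    show "(\<integral>\<^sup>+z. ennreal (norm (v z) powr p) \<partial>lebesgue_on \<Omega>) < \<infinity>"
      by (rule le_less_trans[OF fin]) simp
  qed auto
  then show "v \<in> Lp \<Omega> p" unfolding Lp_def by simp
  have "ennreal (Lp_int \<Omega> p v) \<le> ennreal (b powr p)"
    using fin nn_integral_eq_integral[OF int] by simp
  then have "Lp_int \<Omega> p v \<le> b powr p" by simp
  then have "Lp_norm \<Omega> p v \<le> (b powr p) powr (1/p)"
    unfolding Lp_norm_def using p by (intro powr_mono2) auto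
  then show "Lp_norm \<Omega> p v \<le> b" using p b0 by (simp add: powr_powr)
qed

text \<open>Integrating the tangent line of \<open>t powr (p/q)\<close> at the mean of \<open>norm f powr q\<close> gives the
  comparison of power means.\<close>

lemma Lp_power_mean:
  assumes \<Omega>: "\<Omega> \<in> lmeasurable" "measure lebesgue \<Omega> > 0"
    and q: "0 < q" "q \<le> p" and f: "f \<in> Lp \<Omega> p"
  shows "f \<in> Lp \<Omega> q"
    "measure lebesgue \<Omega> powr (- (1/q)) * Lp_norm \<Omega> q f
       \<le> measure lebesgue \<Omega> powr (- (1/p)) * Lp_norm \<Omega> p f"
proof -
  define V where "V = measure lebesgue \<Omega>"
  have V: "V > 0" using \<Omega> V_def by simp
  have [measurable]: "f \<in> borel_measurable (lebesgue_on \<Omega>)" using f by auto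
  have one: "integrable (lebesgue_on \<Omega>) (\<lambda>z. c)" "integral\<^sup>L (lebesgue_on \<Omega>) (\<lambda>z. c) = c * V" for c :: real
  proof -
    have "emeasure (lebesgue_on \<Omega>) (space (lebesgue_on \<Omega>)) < \<infinity>"
      using \<Omega>(1) by (simp add: emeasure_restrict_space fmeasurableD fmeasurableD2 less_top[symmetric]
          del: emeasure_completion)
    then show "integrable (lebesgue_on \<Omega>) (\<lambda>z. c)"
      by (intro integrable_const finite_measure.integrable_const finite_measureI) auto
    show "integral\<^sup>L (lebesgue_on \<Omega>) (\<lambda>z. c) = c * V"
      using \<Omega>(1) by (simp add: V_def measure_restrict_space fmeasurableD)
  qed
  have "integrable (lebesgue_on \<Omega>) (\<lambda>z. norm (f z) powr q)"
  proof (rule Bochner_Integration.integrable_bound)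
    show "integrable (lebesgue_on \<Omega>) (\<lambda>z. 1 + norm (f z) powr p)"
      using one Lp_integrable[OF f] by auto
    have "norm (f z) powr q \<le> 1 + norm (f z) powr p" for z
    proof (cases "norm (f z) \<le> 1")
      case True
      then have "norm (f z) powr q \<le> 1 powr q" using q by (intro powr_mono2) auto
      then show ?thesis by (simp add: add_increasing2)
    next
      case False
      then have "norm (f z) powr q \<le> norm (f z) powr p" using q by (intro powr_mono) auto
      then show ?thesis by simp
    qed
    then show "AE z in lebesgue_on \<Omega>. norm (norm (f z) powr q) \<le> norm (1 + norm (f z) powr p)"
      by (intro AE_I2) simp
  qed measurable
  then show fq: "f \<in> Lp \<Omega> q" unfolding Lp_def by simp
  define A where "A = Lp_int \<Omega> q f / V"
  define s where "s = p / q"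
  have s: "s \<ge> 1" using q s_def by simp
  have A0: "A \<ge> 0" using V A_def by simp
  have main: "A powr s \<le> Lp_int \<Omega> p f / V"
  proof (cases "A = 0")
    case True
    then show ?thesis using V by simp
  next
    case False
    then have A: "A > 0" using A0 by simp
    have tang: "A powr s + s * A powr (s - 1) * (t - A) \<le> t powr s" if "t \<ge> 0" for t
    proof (cases "t = 0")
      case True
      have "A powr s = A powr (s - 1) * A" using A powr_mult_base[of A "s-1"] by (simp add: mult.commute)
      moreover have "A powr (s - 1) * A \<le> s * (A powr (s - 1) * A)"
        using A s mult_right_mono[of 1 s "A powr (s-1) * A"] by simp
      ultimately show ?thesis using True by (simp add: algebra_simps)
    next
      case False
      have "s * A powr (s - 1) * (t - A) \<le> t powr s - A powr s"
        by (rule convex_on_imp_above_tangent[OF powr_convex[OF s], of A])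
          (use A False that in \<open>auto intro!: derivative_eq_intros simp: interior_open\<close>)
      then show ?thesis by simp
    qed
    have "integral\<^sup>L (lebesgue_on \<Omega>) (\<lambda>z. A powr s + s * A powr (s - 1) * (norm (f z) powr q - A))
        \<le> Lp_int \<Omega> p f"
    proof (rule integral_mono)
      fix z
      show "A powr s + s * A powr (s - 1) * (norm (f z) powr q - A) \<le> norm (f z) powr p"
        using tang[of "norm (f z) powr q"] q by (simp add: powr_powr s_def)
    qed (use one Lp_integrable[OF fq] Lp_integrable[OF f] in auto)
    also have "integral\<^sup>L (lebesgue_on \<Omega>) (\<lambda>z. A powr s + s * A powr (s - 1) * (norm (f z) powr q - A))
        = A powr s * V + s * A powr (s - 1) * (Lp_int \<Omega> q f - A * V)"
      using one(1) one(2)[of 1] Lp_integrable[OF fq] by simp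
    also have "\<dots> = A powr s * V" using V by (simp add: A_def)
    finally show ?thesis using V by (simp add: field_simps)
  qed
  have "A powr (1/q) = (A powr s) powr (1/p)" using q by (simp add: powr_powr s_def)
  also have "\<dots> \<le> (Lp_int \<Omega> p f / V) powr (1/p)" using main q by (intro powr_mono2) auto
  finally have "(Lp_int \<Omega> q f / V) powr (1/q) \<le> (Lp_int \<Omega> p f / V) powr (1/p)" by (simp add: A_def)
  then show "measure lebesgue \<Omega> powr (- (1/q)) * Lp_norm \<Omega> q f
       \<le> measure lebesgue \<Omega> powr (- (1/p)) * Lp_norm \<Omega> p f"
    using V by (simp add: V_def[symmetric] Lp_norm_def powr_divide powr_minus_divide field_simps)
qed


subsection \<open>Uniform convexity\<close>

lemma parallelogram_midpoint:
  fixes a b :: "'a::real_inner"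
  shows "(norm ((1/2) *\<^sub>R (a + b)))\<^sup>2 + (norm ((1/2) *\<^sub>R (a - b)))\<^sup>2 = ((norm a)\<^sup>2 + (norm b)\<^sup>2) / 2"
proof -
  have "(norm (a + b))\<^sup>2 + (norm (a - b))\<^sup>2 = 2 * ((norm a)\<^sup>2 + (norm b)\<^sup>2)"
    by (simp add: power2_norm_eq_inner algebra_simps inner_commute)
  then show ?thesis unfolding norm_scaleR power_mult_distrib by (simp add: power2_eq_square)
qed

text \<open>By the parallelogram law this combines superadditivity of \<open>t powr (p/2)\<close>, for \<open>(a + b)/2\<close> and
  \<open>(a - b)/2\<close>, with its convexity.\<close>

lemma powr_midpoint_gap_ge_2:
  fixes a b :: "'a::real_inner"
  assumes p: "p \<ge> 2"
  shows "norm ((1/2) *\<^sub>R (a - b)) powr p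
    \<le> (norm a powr p + norm b powr p) / 2 - norm ((1/2) *\<^sub>R (a + b)) powr p"
proof -
  define X Y where "X = (norm ((1/2) *\<^sub>R (a + b)))\<^sup>2" and "Y = (norm ((1/2) *\<^sub>R (a - b)))\<^sup>2"
  have XY: "X \<ge> 0" "Y \<ge> 0" "X + Y = ((norm a)\<^sup>2 + (norm b)\<^sup>2) / 2"
    unfolding X_def Y_def using parallelogram_midpoint[of a b] by auto
  have pw: "norm c powr p = ((norm c)\<^sup>2) powr (p / 2)" for c :: 'a
    by (cases "c = 0") (auto simp: powr_powr simp flip: powr_numeral)
  define s where "s = p / 2"
  have s: "s \<ge> 1" using p s_def by simp
  have super: "X powr s + Y powr s \<le> (X + Y) powr s"
  proof (cases "X + Y = 0")
    case True
    then show ?thesis using XY by (simp add: add_nonneg_eq_0_iff)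
  next
    case False
    then have pos: "X + Y > 0" using XY(1,2) by linarith
    have "(t / (X + Y)) powr s \<le> t / (X + Y)" if "0 \<le> t" "t \<le> X + Y" for t
      using powr_mono'[of 1 s "t / (X + Y)"] that s pos by (cases "t = 0") (auto simp del: XY(3))
    then have "(X / (X + Y)) powr s + (Y / (X + Y)) powr s \<le> X / (X + Y) + Y / (X + Y)"
      using XY(1,2) by (intro add_mono) simp_all
    also have "\<dots> = 1" using pos by (simp add: add_divide_distrib[symmetric])
    finally show ?thesis using XY(1,2) pos by (simp add: powr_divide add_divide_distrib[symmetric])
  qed
  have "(X + Y) powr s \<le> 1/2 * ((norm a)\<^sup>2) powr s + 1/2 * ((norm b)\<^sup>2) powr s"
    using convex_onD[OF convex_on_powr_nonneg[OF s], of "1/2" "(norm a)\<^sup>2" "(norm b)\<^sup>2"]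
    by (simp add: XY(3) add_divide_distrib)
  with super show ?thesis unfolding pw X_def Y_def s_def by (simp add: field_simps)
qed

text \<open>Along the segment \<open>t \<mapsto> x + t y\<close> the regularized power
  \<open>(norm (x + t y)\<^sup>2 + e) powr (p/2)\<close> is smooth, and for \<open>1 < p \<le> 2\<close> its second derivative is at
  least \<open>p (p - 1) norm y\<^sup>2 ((norm x + norm y)\<^sup>2 + e) powr (p/2 - 1)\<close>.\<close>

lemma powr_midpoint_gap_regularized:
  fixes x y :: "'a::real_inner"
  assumes p: "1 < p" "p \<le> 2" and e: "e > 0"
  shows "p * (p - 1) / 2 * (norm y)\<^sup>2 * ((norm x + norm y)\<^sup>2 + e) powr (p/2 - 1)
    \<le> (((norm (x + y))\<^sup>2 + e) powr (p/2) + ((norm (x - y))\<^sup>2 + e) powr (p/2)) / 2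
       - ((norm x)\<^sup>2 + e) powr (p/2)"
proof -
  define w where "w = (\<lambda>t::real. (norm x)\<^sup>2 + 2 * t * (x \<bullet> y) + t\<^sup>2 * (norm y)\<^sup>2 + e)"
  have w_eq: "w t = (norm (x + t *\<^sub>R y))\<^sup>2 + e" for t
    unfolding w_def power2_norm_eq_inner by (simp add: algebra_simps inner_commute power2_eq_square)
  have w_pos: "w t > 0" for t unfolding w_eq using e by (simp add: add_nonneg_pos)
  define w' where "w' = (\<lambda>t::real. 2 * (x \<bullet> y) + 2 * t * (norm y)\<^sup>2)"
  define M where "M = (norm x + norm y)\<^sup>2 + e"
  define K where "K = p * (p - 1) * (norm y)\<^sup>2 * M powr (p/2 - 1)"
  have M: "M > 0" unfolding M_def using e by (simp add: add_nonneg_pos)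
  \<comment> \<open>Subtracting the parabola leaves a convex function; the claim is its midpoint convexity on \<open>[-1, 1]\<close>.\<close>
  define g g' g'' where "g = (\<lambda>t. w t powr (p/2) - K / 2 * t\<^sup>2)"
    and "g' = (\<lambda>t. (p/2) * w t powr (p/2 - 1) * w' t - K * t)"
    and "g'' = (\<lambda>t. (p/2) * ((p/2 - 1) * w t powr (p/2 - 2) * w' t * w' t + w t powr (p/2 - 1) * (2 * (norm y)\<^sup>2)) - K)"
  have dw: "(w has_real_derivative w' t) (at t)" for t
    unfolding w_def w'_def by (auto intro!: derivative_eq_intros simp: power2_eq_square)
  have dw': "(w' has_real_derivative 2 * (norm y)\<^sup>2) (at t)" for t
    unfolding w'_def by (auto intro!: derivative_eq_intros)
  have dg: "(g has_real_derivative g' t) (at t)" for t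
    unfolding g_def g'_def using w_pos[of t]
    by (auto intro!: derivative_eq_intros dw)
  have dg': "(g' has_real_derivative g'' t) (at t)" for t
    unfolding g'_def g''_def using w_pos[of t]
    by (auto intro!: derivative_eq_intros dw dw' simp: field_simps)
  have g''_nonneg: "g'' t \<ge> 0" if t: "t \<in> {-1..1}" for t
  proof -
    have w2: "(w' t)\<^sup>2 \<le> 4 * (norm y)\<^sup>2 * w t"
    proof -
      have "w' t = 2 * ((x + t *\<^sub>R y) \<bullet> y)"
        unfolding w'_def power2_norm_eq_inner by (simp add: algebra_simps inner_commute)
      then have "(w' t)\<^sup>2 = 4 * ((x + t *\<^sub>R y) \<bullet> y)\<^sup>2" by simp
      also have "\<dots> \<le> 4 * ((norm (x + t *\<^sub>R y))\<^sup>2 * (norm y)\<^sup>2)"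
        using Cauchy_Schwarz_ineq[of "x + t *\<^sub>R y" y] by (simp add: power2_norm_eq_inner)
      also have "\<dots> \<le> 4 * (w t * (norm y)\<^sup>2)"
        unfolding w_eq using e by (intro mult_left_mono mult_right_mono) auto
      finally show ?thesis by (simp add: mult_ac)
    qed
    have pw: "w t powr (p/2 - 2) = w t powr (p/2 - 1) / w t"
      using w_pos[of t] powr_diff[of "w t" "p/2 - 1" 1] by simp
    have wM: "w t \<le> M"
    proof -
      have "norm (x + t *\<^sub>R y) \<le> norm x + \<bar>t\<bar> * norm y"
        using norm_triangle_ineq[of x "t *\<^sub>R y"] by simp
      also have "\<dots> \<le> norm x + 1 * norm y"
        using t by (intro add_mono mult_right_mono) auto
      finally show ?thesis unfolding w_eq M_def by (simp add: power_mono)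
    qed
    have "(p/2 - 1) * ((w' t)\<^sup>2 / w t) \<ge> (p/2 - 1) * (4 * (norm y)\<^sup>2)"
      using w2 w_pos[of t] p by (intro mult_left_mono_neg) (auto simp: divide_le_eq)
    then have "(p/2) * (w t powr (p/2 - 1) * ((p/2 - 1) * ((w' t)\<^sup>2 / w t) + 2 * (norm y)\<^sup>2))
        \<ge> (p/2) * (w t powr (p/2 - 1) * ((p/2 - 1) * (4 * (norm y)\<^sup>2) + 2 * (norm y)\<^sup>2))"
      using p by (intro mult_left_mono) auto
    also have "(p/2) * (w t powr (p/2 - 1) * ((p/2 - 1) * (4 * (norm y)\<^sup>2) + 2 * (norm y)\<^sup>2))
        = p * (p - 1) * (norm y)\<^sup>2 * w t powr (p/2 - 1)"
      by (simp add: field_simps)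
    also have "\<dots> \<ge> K"
      unfolding K_def using p wM w_pos[of t] by (intro mult_left_mono powr_mono2') auto
    finally have "K \<le> (p/2) * (w t powr (p/2 - 1) * ((p/2 - 1) * ((w' t)\<^sup>2 / w t) + 2 * (norm y)\<^sup>2))" .
    also have "\<dots> = g'' t + K"
      unfolding g''_def pw by (simp add: field_simps power2_eq_square)
    finally show ?thesis by simp
  qed
  have "convex_on {-1..1} g"
    by (rule f''_ge0_imp_convex[where f'=g' and f''=g'']) (use dg dg' g''_nonneg in auto)
  from convex_onD[OF this, of "1/2" "-1" 1] have "g 0 \<le> (g (-1) + g 1) / 2" by simp
  then show ?thesis unfolding g_def w_eq by (simp add: K_def M_def field_simps)
qed

text \<open>The limit of the regularized inequality for \<open>e\<close> tending to 0. It only has to be taken when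
  \<open>x\<close> and \<open>y\<close> are not both zero, where the negative power of \<open>norm x + norm y\<close> is continuous.\<close>

lemma powr_midpoint_gap_le_2:
  fixes x y :: "'a::real_inner"
  assumes p: "1 < p" "p \<le> 2"
  shows "p * (p - 1) / 2 * (norm y)\<^sup>2 * (norm x + norm y) powr (p - 2)
    \<le> (norm (x + y) powr p + norm (x - y) powr p) / 2 - norm x powr p"
proof (cases "norm x + norm y = 0")
  case True
  then have "x = 0" "y = 0" by (simp_all add: add_nonneg_eq_0_iff)
  then show ?thesis by simp
next
  case False
  then have M: "norm x + norm y > 0" by (smt (verit) norm_ge_zero)
  have pw: "c powr (2 * s) = (c\<^sup>2) powr s" if "c \<ge> 0" for c s :: real
    using that by (cases "c = 0") (auto simp: powr_powr simp flip: powr_numeral)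
  have lim: "((\<lambda>e. (c\<^sup>2 + e) powr (p/2)) \<longlongrightarrow> c powr p) (at_right 0)" if "c \<ge> 0" for c :: real
  proof -
    have "((\<lambda>e. (c\<^sup>2 + e) powr (p/2)) \<longlongrightarrow> (c\<^sup>2 + 0) powr (p/2)) (at_right 0)"
      using p by (intro tendsto_powr2 tendsto_intros) (auto intro!: eventually_at_rightI[of 0 1] add_nonneg_nonneg)
    then show ?thesis using pw[OF that, of "p/2"] by simp
  qed
  have lim2: "((\<lambda>e. ((norm x + norm y)\<^sup>2 + e) powr (p/2 - 1)) \<longlongrightarrow> (norm x + norm y) powr (p - 2)) (at_right 0)"
  proof -
    have "((\<lambda>e. ((norm x + norm y)\<^sup>2 + e) powr (p/2 - 1)) \<longlongrightarrow> ((norm x + norm y)\<^sup>2 + 0) powr (p/2 - 1)) (at_right 0)"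
      using M by (intro tendsto_powr tendsto_intros) auto
    then show ?thesis using pw[of "norm x + norm y" "p/2 - 1"] M by (simp add: algebra_simps)
  qed
  show ?thesis
  proof (rule tendsto_le[OF trivial_limit_at_right_real])
    show "\<forall>\<^sub>F e in at_right 0. p * (p - 1) / 2 * (norm y)\<^sup>2 * ((norm x + norm y)\<^sup>2 + e) powr (p/2 - 1)
    \<le> (((norm (x + y))\<^sup>2 + e) powr (p/2) + ((norm (x - y))\<^sup>2 + e) powr (p/2)) / 2
       - ((norm x)\<^sup>2 + e) powr (p/2)"
      by (rule eventually_at_rightI[of 0 1]) (use powr_midpoint_gap_regularized[OF p] in auto)
  qed (intro lim lim2 norm_ge_zero tendsto_mult tendsto_diff tendsto_divide tendsto_add tendsto_const; simp)+
qed

text \<open>If two functions of norm at most \<open>d + 2\<delta>\<close> have a midpoint of norm at least \<open>d\<close>, then they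
  are close. The case \<open>\<delta> = 0\<close> is strict convexity.\<close>

lemma Lp_midpoint_gap_ge_2:
  assumes p: "p \<ge> 2" and u: "u \<in> Lp \<Omega> p" and v: "v \<in> Lp \<Omega> p"
    and d: "d \<ge> 0" "\<delta> \<ge> 0" and ud: "Lp_norm \<Omega> p u \<le> d + 2 * \<delta>" and vd: "Lp_norm \<Omega> p v \<le> d + 2 * \<delta>"
    and mid: "d \<le> Lp_norm \<Omega> p (\<lambda>z. (1/2) *\<^sub>R (u z + v z))"
  shows "Lp_norm \<Omega> p (\<lambda>z. u z - v z) \<le> 2 * (2 * p) powr (1/p) * (d + 2 * \<delta>) powr (1 - 1/p) * \<delta> powr (1/p)"
proof -
  define M where "M = d + 2 * \<delta>"
  have p0: "p > 0" using p by simp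
  have half: "(\<lambda>z. (1/2) *\<^sub>R f z) = (\<lambda>z. (1/2) * f z)" for f :: "complex^'n \<Rightarrow> complex"
    by (simp add: scaleR_conv_of_real)
  have mid_in: "(\<lambda>z. (1/2) *\<^sub>R (u z + v z)) \<in> Lp \<Omega> p" and diff_in: "(\<lambda>z. (1/2) *\<^sub>R (u z - v z)) \<in> Lp \<Omega> p"
    unfolding half using Lp_cmult[OF Lp_add[OF p0 u v], of "1/2"] Lp_cmult[OF Lp_diff[OF p0 u v], of "1/2"] by auto
  have "Lp_norm \<Omega> p (\<lambda>z. (1/2) *\<^sub>R (u z - v z)) powr p =
    Lp_int \<Omega> p (\<lambda>z. (1/2) *\<^sub>R (u z - v z))"
    by (rule Lp_norm_powr[OF p0])
  also have "\<dots> \<le> integral\<^sup>L (lebesgue_on \<Omega>) (\<lambda>z. (norm (u z) powr p + norm (v z) powr p) / 2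
      - norm ((1/2) *\<^sub>R (u z + v z)) powr p)"
    using Lp_integrable[OF u] Lp_integrable[OF v] Lp_integrable[OF mid_in] Lp_integrable[OF diff_in]
      powr_midpoint_gap_ge_2[OF p]
    by (intro integral_mono) auto
  also have "\<dots> = (Lp_norm \<Omega> p u powr p + Lp_norm \<Omega> p v powr p) / 2
      - Lp_norm \<Omega> p (\<lambda>z. (1/2) *\<^sub>R (u z + v z)) powr p"
    unfolding Lp_norm_powr[OF p0]
    using Lp_integrable[OF u] Lp_integrable[OF v] Lp_integrable[OF mid_in] by simp
  also have "\<dots> \<le> (M powr p + M powr p) / 2 - d powr p"
    using p0 ud vd mid d unfolding M_def
    by (intro diff_mono divide_right_mono add_mono powr_mono2) auto
  also have "\<dots> \<le> p * M powr (p - 1) * (2 * \<delta>)"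
    using powr_diff_le[of p d M] p d by (simp add: M_def)
  finally have "Lp_norm \<Omega> p (\<lambda>z. (1/2) *\<^sub>R (u z - v z)) powr p \<le> (2 * p) * (M powr (p - 1) * \<delta>)"
    by (simp add: mult_ac)
  then have "(Lp_norm \<Omega> p (\<lambda>z. (1/2) *\<^sub>R (u z - v z)) powr p) powr (1/p)
      \<le> ((2 * p) * (M powr (p - 1) * \<delta>)) powr (1/p)"
    using p0 by (intro powr_mono2) auto
  also have "\<dots> = (2 * p) powr (1/p) * (M powr ((p - 1) / p) * \<delta> powr (1/p))"
    using p0 d by (simp add: powr_mult powr_powr)
  also have "(Lp_norm \<Omega> p (\<lambda>z. (1/2) *\<^sub>R (u z - v z)) powr p) powr (1/p) =
      Lp_norm \<Omega> p (\<lambda>z. (1/2) *\<^sub>R (u z - v z))"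
    using p0 by (simp add: powr_powr)
  also have "\<dots> = 1/2 * Lp_norm \<Omega> p (\<lambda>z. u z - v z)"
    unfolding half Lp_norm_cmult[OF p0] by simp
  also have "(p - 1) / p = 1 - 1/p" using p0 by (simp add: field_simps)
  finally show ?thesis unfolding M_def by (simp add: mult_ac)
qed

text \<open>With \<open>x\<close> and \<open>y\<close> half the sum and half the difference and \<open>s = norm x + norm y\<close>, the power
  \<open>norm y powr p\<close> is the product of \<open>((norm y)\<^sup>2 * s powr (p - 2)) powr (p/2)\<close> and
  \<open>(s powr p) powr (1 - p/2)\<close>. The first factor is controlled by the pointwise gap, the second by the
  norms of \<open>u\<close> and \<open>v\<close>, and Hoelder's inequality combines them.\<close>

lemma Lp_midpoint_gap_less_2:
  assumes p: "1 < p" "p < 2" and u: "u \<in> Lp \<Omega> p" and v: "v \<in> Lp \<Omega> p"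
    and d: "d \<ge> 0" "\<delta> \<ge> 0" and ud: "Lp_norm \<Omega> p u \<le> d + 2 * \<delta>" and vd: "Lp_norm \<Omega> p v \<le> d + 2 * \<delta>"
    and mid: "d \<le> Lp_norm \<Omega> p (\<lambda>z. (1/2) *\<^sub>R (u z + v z))"
  shows "Lp_norm \<Omega> p (\<lambda>z. u z - v z)
    \<le> 2 * (4 / (p - 1)) powr (1/2) * 2 powr (1 - p/2) * (d + 2 * \<delta>) powr (1/2) * \<delta> powr (1/2)"
proof -
  define M where "M = d + 2 * \<delta>"
  define \<kappa> where "\<kappa> = p * (p - 1) / 2"
  have p0: "p > 0" and \<kappa>: "\<kappa> > 0" using p by (simp_all add: \<kappa>_def)
  have M: "M \<ge> 0" using d by (simp add: M_def)
  have half: "(\<lambda>z. (1/2) *\<^sub>R f z) = (\<lambda>z. (1/2) * f z)" for f :: "complex^'n \<Rightarrow> complex"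
    by (simp add: scaleR_conv_of_real)
  define x y where "x = (\<lambda>z. (1/2) *\<^sub>R (u z + v z))" and "y = (\<lambda>z. (1/2) *\<^sub>R (u z - v z))"
  have xin: "x \<in> Lp \<Omega> p" and yin: "y \<in> Lp \<Omega> p"
    unfolding half x_def y_def
    using Lp_cmult[OF Lp_add[OF p0 u v], of "1/2"] Lp_cmult[OF Lp_diff[OF p0 u v], of "1/2"] by auto
  have xy: "x z + y z = u z" "x z - y z = v z" for z
    unfolding x_def y_def by (simp_all add: scaleR_conv_of_real field_simps)
  define D where "D = (\<lambda>z. ((norm (u z) powr p + norm (v z) powr p) / 2 - norm (x z) powr p) / \<kappa>)"
  define S where "S = (\<lambda>z. (norm (x z) + norm (y z)) powr p)"
  have gap: "(norm (y z))\<^sup>2 * (norm (x z) + norm (y z)) powr (p - 2) \<le> D z" for z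
    unfolding D_def using powr_midpoint_gap_le_2[of p "y z" "x z"] p \<kappa>
    by (simp add: xy \<kappa>_def[symmetric] pos_le_divide_eq mult_ac)
  have D0: "D z \<ge> 0" for z by (rule order.trans[OF _ gap]) simp
  have D_int: "integrable (lebesgue_on \<Omega>) D"
    unfolding D_def using Lp_integrable[OF u] Lp_integrable[OF v] Lp_integrable[OF xin] by auto
  have S_eq: "S = (\<lambda>z. norm (complex_of_real (norm (x z)) + complex_of_real (norm (y z))) powr p)"
    unfolding S_def by (simp flip: of_real_add)
  have nx: "(\<lambda>z. complex_of_real (norm (x z))) \<in> Lp \<Omega> p" and ny: "(\<lambda>z. complex_of_real (norm (y z))) \<in> Lp \<Omega> p"
    using xin yin unfolding Lp_def by auto
  have S_int: "integrable (lebesgue_on \<Omega>) S"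
    unfolding S_eq using Lp_integrable[OF Lp_add[OF p0 nx ny]] .
  have main: "Lp_int \<Omega> p y \<le> (integral\<^sup>L (lebesgue_on \<Omega>) D) powr (p/2) * (integral\<^sup>L (lebesgue_on \<Omega>) S) powr (1 - p/2)"
  proof (rule Hoelder_interpolation)
    fix z
    show "norm (y z) powr p \<le> D z powr (p/2) * S z powr (1 - p/2)"
    proof (cases "norm (x z) + norm (y z) = 0")
      case True
      then have "y z = 0" by (simp add: add_nonneg_eq_0_iff)
      then show ?thesis by simp
    next
      case False
      define s where "s = norm (x z) + norm (y z)"
      have s: "s > 0" using False unfolding s_def by (smt (verit) norm_ge_zero)
      have "((norm (y z))\<^sup>2 * s powr (p - 2)) powr (p/2) * (s powr p) powr (1 - p/2)
          = ((norm (y z))\<^sup>2) powr (p/2) * (s powr ((p - 2) * (p/2)) * s powr (p * (1 - p/2)))"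
        using s by (simp add: powr_mult powr_powr)
      also have "s powr ((p - 2) * (p/2)) * s powr (p * (1 - p/2)) = 1"
        using s by (simp add: powr_add[symmetric] field_simps)
      also have "((norm (y z))\<^sup>2) powr (p/2) = norm (y z) powr p"
        by (cases "y z = 0") (auto simp: powr_powr simp flip: powr_numeral)
      finally have "norm (y z) powr p = ((norm (y z))\<^sup>2 * s powr (p - 2)) powr (p/2) * (s powr p) powr (1 - p/2)"
        by simp
      also have "\<dots> \<le> D z powr (p/2) * (s powr p) powr (1 - p/2)"
        using gap[of z] p0 unfolding s_def by (intro mult_right_mono powr_mono2) auto
      finally show ?thesis by (simp add: S_def s_def)
    qed
  qed (use p D_int S_int D0 Lp_integrable[OF yin] in \<open>auto simp: S_def\<close>)
  have D_le: "integral\<^sup>L (lebesgue_on \<Omega>) D \<le> (4 / (p - 1)) * (M powr (p - 1) * \<delta>)"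
  proof -
    have "integral\<^sup>L (lebesgue_on \<Omega>) D
        = ((Lp_norm \<Omega> p u powr p + Lp_norm \<Omega> p v powr p) / 2 - Lp_norm \<Omega> p x powr p) / \<kappa>"
      unfolding Lp_norm_powr[OF p0] D_def
      using Lp_integrable[OF u] Lp_integrable[OF v] Lp_integrable[OF xin] by simp
    also have "\<dots> \<le> ((M powr p + M powr p) / 2 - d powr p) / \<kappa>"
      using p0 \<kappa> ud vd mid d unfolding M_def x_def
      by (intro diff_mono divide_right_mono add_mono powr_mono2) auto
    also have "\<dots> \<le> (p * M powr (p - 1) * (2 * \<delta>)) / \<kappa>"
      using powr_diff_le[of p d M] p d \<kappa> by (intro divide_right_mono) (auto simp: M_def)
    also have "\<dots> = (4 / (p - 1)) * (M powr (p - 1) * \<delta>)"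
      using p by (simp add: \<kappa>_def field_simps)
    finally show ?thesis .
  qed
  have S_le: "integral\<^sup>L (lebesgue_on \<Omega>) S \<le> (2 * M) powr p"
  proof -
    have *: "norm (x z) + norm (y z) \<le> norm (u z) + norm (v z)" for z
    proof -
      have "norm (x z) \<le> (norm (u z) + norm (v z)) / 2" "norm (y z) \<le> (norm (u z) + norm (v z)) / 2"
        unfolding x_def y_def using norm_triangle_ineq[of "u z" "v z"] norm_triangle_ineq4[of "u z" "v z"] by auto
      then show ?thesis by simp
    qed
    have nu: "(\<lambda>z. complex_of_real (norm (u z))) \<in> Lp \<Omega> p" and nv: "(\<lambda>z. complex_of_real (norm (v z))) \<in> Lp \<Omega> p"
      using u v unfolding Lp_def by auto
    have "integral\<^sup>L (lebesgue_on \<Omega>) S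
        \<le> Lp_int \<Omega> p (\<lambda>z. complex_of_real (norm (u z)) + complex_of_real (norm (v z)))"
      using S_int Lp_integrable[OF Lp_add[OF p0 nu nv]] p0 *
      by (intro integral_mono) (auto simp: S_def simp flip: of_real_add intro!: powr_mono2)
    also have "\<dots> = Lp_norm \<Omega> p (\<lambda>z. complex_of_real (norm (u z)) + complex_of_real (norm (v z))) powr p"
      by (simp add: Lp_norm_powr[OF p0])
    also have "\<dots> \<le> (2 * M) powr p"
    proof (rule powr_mono2)
      have "Lp_norm \<Omega> p (\<lambda>z. complex_of_real (norm (u z)) + complex_of_real (norm (v z)))
        \<le> Lp_norm \<Omega> p u + Lp_norm \<Omega> p v"
        using Minkowski[OF _ nu nv] p by (simp add: Lp_norm_def)
      then show "Lp_norm \<Omega> p (\<lambda>z. complex_of_real (norm (u z)) + complex_of_real (norm (v z))) \<le> 2 * M"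
        using ud vd by (simp add: M_def)
    qed (use p0 in auto)
    finally show ?thesis .
  qed
  have "(integral\<^sup>L (lebesgue_on \<Omega>) D) powr (p/2) * (integral\<^sup>L (lebesgue_on \<Omega>) S) powr (1 - p/2)
      \<le> ((4 / (p - 1)) * (M powr (p - 1) * \<delta>)) powr (p/2) * ((2 * M) powr p) powr (1 - p/2)"
    using p D_le S_le D0 by (intro mult_mono powr_mono2) (auto simp: S_def intro!: Bochner_Integration.integral_nonneg)
  with main have "Lp_int \<Omega> p y
      \<le> ((4 / (p - 1)) * (M powr (p - 1) * \<delta>)) powr (p/2) * ((2 * M) powr p) powr (1 - p/2)"
    by (rule order.trans)
  then have "Lp_int \<Omega> p y powr (1/p)
      \<le> (((4 / (p - 1)) * (M powr (p - 1) * \<delta>)) powr (p/2) * ((2 * M) powr p) powr (1 - p/2)) powr (1/p)"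
    using p0 by (intro powr_mono2) auto
  also have "\<dots> = (4 / (p - 1)) powr (1/2) * 2 powr (1 - p/2) * (M powr ((p - 1)/2) * M powr (1 - p/2)) * \<delta> powr (1/2)"
  proof -
    have "((A * (M powr (p - 1) * \<delta>)) powr (p/2) * ((2 * M) powr p) powr (1 - p/2)) powr (1/p)
        = A powr (1/2) * 2 powr (1 - p/2) * (M powr ((p - 1)/2) * M powr (1 - p/2)) * \<delta> powr (1/2)"
      if "A > 0" for A :: real
      using that p M d by (simp add: powr_mult powr_powr mult_ac)
    from this[of "4 / (p - 1)"] p show ?thesis by simp
  qed
  also have "M powr ((p - 1)/2) * M powr (1 - p/2) = M powr (1/2)"
    by (cases "M = 0") (auto simp: powr_add[symmetric] field_simps)
  also have "Lp_int \<Omega> p y powr (1/p) = Lp_norm \<Omega> p y" by (simp add: Lp_norm_def)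
  also have "Lp_norm \<Omega> p y = 1/2 * Lp_norm \<Omega> p (\<lambda>z. u z - v z)"
    unfolding y_def half Lp_norm_cmult[OF p0] by simp
  finally show ?thesis by (simp add: M_def mult_ac)
qed

section \<open>Change of variables for holomorphic maps\<close>

subsection \<open>Real coordinates\<close>

text \<open>An enumeration of the standard basis identifies \<open>complex^'n\<close> isometrically with a space
  \<open>real^'m\<close>, where the change of variables formula is available. The index type \<open>'n bit0\<close> has as many
  elements as \<open>complex^'n\<close> has real dimensions and is well-ordered, as that formula requires.\<close>

definition basis_enum :: "'n bit0 \<Rightarrow> complex^'n::finite" where
  "basis_enum = (SOME \<beta>. bij_betw \<beta> UNIV Basis)"

definition to_real :: "complex^'n::finite \<Rightarrow> real^'n bit0" where
  "to_real z = (\<chi> m. z \<bullet> basis_enum m)"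

definition from_real :: "real^'n bit0 \<Rightarrow> complex^'n::finite" where
  "from_real x = (\<Sum>m\<in>UNIV. x $ m *\<^sub>R basis_enum m)"

lemma bij_basis_enum: "bij_betw (basis_enum :: 'n::finite bit0 \<Rightarrow> complex^'n) UNIV Basis"
proof -
  have "card (UNIV :: 'n bit0 set) = card (Basis :: (complex^'n) set)"
    by simp
  then have "\<exists>\<beta>. bij_betw \<beta> (UNIV :: 'n bit0 set) (Basis :: (complex^'n) set)"
    by (intro finite_same_card_bij) auto
  then show ?thesis unfolding basis_enum_def by (rule someI_ex)
qed

lemma basis_enum_in [simp]: "basis_enum m \<in> Basis"
  using bij_basis_enum by (auto simp: bij_betw_def)

lemma basis_enum_inner: "basis_enum i \<bullet> basis_enum j = (if i = j then 1 else 0)"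
  using inner_Basis[OF basis_enum_in basis_enum_in] bij_basis_enum
  by (metis bij_betw_def inj_onD UNIV_I)

lemma linear_to_real: "linear to_real"
  by (rule linearI) (auto simp: to_real_def vec_eq_iff inner_add_left)

lemma linear_from_real: "linear from_real"
  by (rule linearI) (auto simp: from_real_def algebra_simps sum.distrib scaleR_sum_right)

lemma to_real_from_real [simp]: "to_real (from_real x) = x"
  by (simp add: to_real_def from_real_def vec_eq_iff inner_sum_left basis_enum_inner if_distrib cong: if_cong)

lemma from_real_to_real [simp]: "from_real (to_real z) = z"
proof -
  have "(\<Sum>m\<in>UNIV. (z \<bullet> basis_enum m) *\<^sub>R basis_enum m) = (\<Sum>b\<in>Basis. (z \<bullet> b) *\<^sub>R b)"
    by (rule sum.reindex_bij_betw[OF bij_basis_enum])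
  then show ?thesis by (simp add: to_real_def from_real_def euclidean_representation)
qed

lemma to_real_inner: "to_real u \<bullet> to_real v = u \<bullet> v"
proof -
  have "(\<Sum>m\<in>UNIV. (u \<bullet> basis_enum m) * (v \<bullet> basis_enum m)) = (\<Sum>b\<in>Basis. (u \<bullet> b) * (v \<bullet> b))"
    by (rule sum.reindex_bij_betw[OF bij_basis_enum])
  then show ?thesis unfolding inner_vec_def[of "to_real u"] euclidean_inner[of u v] by (simp add: to_real_def)
qed

lemma bij_to_real: "bij to_real"
  by (rule bij_betw_byWitness[where f'=from_real]; simp)

lemma lborel_distr_to_real: "distr lborel borel to_real = (lborel :: (real^'n::finite bit0) measure)"
proof (rule lborel_eqI[symmetric])
  have [measurable]: "to_real \<in> borel_measurable (borel :: (complex^'n) measure)"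
    using linear_to_real by (intro borel_measurable_continuous_onI linear_continuous_on)
      (simp add: linear_conv_bounded_linear)
  fix l u :: "real^'n bit0"
  assume lu: "\<And>b. b \<in> Basis \<Longrightarrow> l \<bullet> b \<le> u \<bullet> b"
  have lu': "l $ m \<le> u $ m" for m using lu[of "axis m 1"] by (simp add: inner_axis)
  have comp: "from_real x \<bullet> basis_enum m = x $ m" for x :: "real^'n bit0" and m
    using to_real_from_real[of x] by (simp add: to_real_def vec_eq_iff)
  have all_basis: "(\<forall>b\<in>(Basis :: (complex^'n) set). P b) \<longleftrightarrow> (\<forall>m. P (basis_enum m))" for P
  proof -
    have B: "(Basis :: (complex^'n) set) = range basis_enum"
      using bij_basis_enum[where 'n='n] unfolding bij_betw_def by simp
    show ?thesis unfolding B by simp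
  qed
  have vim: "to_real -` box l u = box (from_real l) (from_real u :: complex^'n)"
  proof (rule set_eqI)
    fix z :: "complex^'n"
    have "z \<in> to_real -` box l u \<longleftrightarrow> (\<forall>m. l $ m < z \<bullet> basis_enum m \<and> z \<bullet> basis_enum m < u $ m)"
      unfolding vimage_eq mem_box_cart by (simp add: to_real_def)
    also have "\<dots> \<longleftrightarrow> z \<in> box (from_real l) (from_real u)"
      unfolding mem_box(1) all_basis comp ..
    finally show "z \<in> to_real -` box l u \<longleftrightarrow> z \<in> box (from_real l) (from_real u)" .
  qed
  have le: "\<forall>b\<in>Basis. from_real l \<bullet> b \<le> (from_real u :: complex^'n) \<bullet> b"
    unfolding all_basis comp using lu' by simp
  have "emeasure (distr lborel borel to_real) (box l u) = emeasure lborel (box (from_real l) (from_real u :: complex^'n))"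
    by (simp add: emeasure_distr vim)
  also have "\<dots> = ennreal (\<Prod>b\<in>Basis. (from_real u - from_real l :: complex^'n) \<bullet> b)"
    by (rule emeasure_lborel_box) (rule bspec[OF le])
  also have "(\<Prod>b\<in>Basis. (from_real u - from_real l :: complex^'n) \<bullet> b)
      = (\<Prod>m\<in>UNIV. (from_real u - from_real l :: complex^'n) \<bullet> basis_enum m)"
    by (rule prod.reindex_bij_betw[OF bij_basis_enum, symmetric])
  also have "\<dots> = (\<Prod>m\<in>UNIV. (u - l) $ m)"
    by (simp add: inner_diff_left comp)
  also have "\<dots> = (\<Prod>b\<in>Basis. (u - l) \<bullet> b)"
  proof -
    have "bij_betw (\<lambda>m. axis m (1::real)) (UNIV :: 'n bit0 set) Basis"
      by (auto simp: bij_betw_def inj_on_def axis_eq_axis Basis_vec_def)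
    from prod.reindex_bij_betw[OF this, of "\<lambda>b. (u - l) \<bullet> b"] show ?thesis
      by (simp add: inner_axis)
  qed
  finally show "emeasure (distr lborel borel to_real) (box l u) = ennreal (\<Prod>b\<in>Basis. (u - l) \<bullet> b)"
    by simp
qed simp

lemma lborel_distr_from_real: "distr lborel borel from_real = (lborel :: (complex^'n::finite) measure)"
proof -
  have [measurable]: "to_real \<in> borel_measurable (borel :: (complex^'n) measure)"
      "from_real \<in> borel_measurable (borel :: (real^'n bit0) measure)"
    using linear_to_real linear_from_real by (intro borel_measurable_continuous_onI linear_continuous_on;
      simp add: linear_conv_bounded_linear)+
  have "distr lborel borel from_real = distr (distr lborel borel to_real) borel (from_real :: _ \<Rightarrow> complex^'n)"
    by (simp add: lborel_distr_to_real)
  also have "\<dots> = distr lborel lborel (\<lambda>x. x)"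
    by (subst distr_distr) (auto simp: o_def cong: distr_cong)
  finally show ?thesis by (simp add: distr_id)
qed

text \<open>A Lebesgue measurable set differs from a Borel set by a subset of a Borel null set, and
  preimages of Borel null sets are null sets.\<close>

lemma lebesgue_measure_preserving:
  fixes T :: "'a::euclidean_space \<Rightarrow> 'b::euclidean_space"
  assumes T: "T \<in> borel_measurable borel" and distr: "distr lborel borel T = lborel"
  shows "T \<in> lebesgue \<rightarrow>\<^sub>M lebesgue" "distr lebesgue lebesgue T = lebesgue"
proof -
  have TL: "T \<in> lebesgue \<rightarrow>\<^sub>M lborel"
    using T by (simp add: measurable_completion)
  have null: "T -` N \<in> null_sets lebesgue" if "N \<in> null_sets lborel" for N
  proof -
    have "N \<in> null_sets (distr lborel borel T)" using that distr by simp
    then have "T -` N \<in> null_sets lborel" using T by (simp add: null_sets_distr_iff)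
    then show ?thesis by (rule null_sets_completionI)
  qed
  have dl: "distr lebesgue lborel T = lborel"
    using distr T by (simp add: distr_completion cong: distr_cong)
  show meas: "T \<in> lebesgue \<rightarrow>\<^sub>M lebesgue"
  proof (rule completion.measurable_completion2[OF TL])
    show "null_sets lborel \<subseteq> null_sets (distr lebesgue lborel T)"
      by (simp add: dl)
  qed
  show "distr lebesgue lebesgue T = lebesgue"
  proof (rule measure_eqI)
    fix S assume "S \<in> sets (distr lebesgue lebesgue T)"
    then have S: "S \<in> sets lebesgue" by simp
    then obtain A N N' where A: "S = A \<union> N" "N \<subseteq> N'" "N' \<in> null_sets lborel" "A \<in> sets lborel"
      by (auto elim: sets_completionE)
    have N': "T -` N' \<in> null_sets lebesgue" by (rule null[OF A(3)])
    have N: "T -` N \<in> null_sets lebesgue"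
      by (rule null_sets_completion_subset[OF vimage_mono[OF A(2)] N'])
    have N0: "N \<in> null_sets lebesgue"
      by (rule null_sets_completion_subset[OF A(2) null_sets_completionI[OF A(3)]])
    have "emeasure (distr lebesgue lebesgue T) S = emeasure lebesgue (T -` S)"
      using S meas by (simp add: emeasure_distr del: emeasure_completion)
    also have "T -` S = T -` A \<union> T -` N" using A by auto
    also have "emeasure lebesgue (T -` A \<union> T -` N) = emeasure lebesgue (T -` A)"
      by (rule emeasure_Un_null_set[OF _ N]) (use measurable_sets[OF TL A(4)] in simp)
    also have "\<dots> = emeasure (distr lebesgue lborel T) A"
      using A(4) TL by (simp add: emeasure_distr del: emeasure_completion)
    also have "\<dots> = emeasure lborel A" by (simp add: dl)
    also have "\<dots> = emeasure lebesgue A" using A(4) by simp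
    also have "\<dots> = emeasure lebesgue S"
      unfolding A(1) by (rule emeasure_Un_null_set[OF _ N0, symmetric]) (use A(4) in simp)
    finally show "emeasure (distr lebesgue lebesgue T) S = emeasure lebesgue S" .
  qed simp
qed

lemma borel_measurable_linear:
  assumes "linear (T :: 'a::euclidean_space \<Rightarrow> 'b::euclidean_space)"
  shows "T \<in> borel_measurable borel"
  using assms by (intro borel_measurable_continuous_onI linear_continuous_on)
    (simp add: linear_conv_bounded_linear)

lemmas to_real_lebesgue = lebesgue_measure_preserving[OF borel_measurable_linear[OF linear_to_real] lborel_distr_to_real]
lemmas from_real_lebesgue = lebesgue_measure_preserving[OF borel_measurable_linear[OF linear_from_real] lborel_distr_from_real]

lemma to_real_lebesgue_set: "S \<in> sets lebesgue \<Longrightarrow> to_real ` S \<in> sets lebesgue"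
proof -
  assume S: "S \<in> sets lebesgue"
  have "to_real ` S = from_real -` S \<inter> space lebesgue"
    by (auto simp: image_iff) (metis to_real_from_real)
  then show ?thesis using measurable_sets[OF from_real_lebesgue(1) S] by simp
qed

lemma has_bochner_integral_measure_preserving:
  fixes f :: "'b \<Rightarrow> real"
  assumes T: "T \<in> M \<rightarrow>\<^sub>M N" "distr M N T = N" and f: "has_bochner_integral N f b"
  shows "has_bochner_integral M (\<lambda>x. f (T x)) b"
proof -
  have fm: "f \<in> borel_measurable N"
    using f by (simp add: has_bochner_integral_iff borel_measurable_integrable)
  have "has_bochner_integral (distr M N T) f b" unfolding T(2) by (rule f)
  then show ?thesis
    unfolding has_bochner_integral_iff integrable_distr_eq[OF T(1) fm] integral_distr[OF T(1) fm] .
qed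

lemma has_bochner_integral_from_real:
  fixes f :: "complex^'n::finite \<Rightarrow> real"
  shows "has_bochner_integral lebesgue f b \<longleftrightarrow> has_bochner_integral lebesgue (\<lambda>x. f (from_real x)) b"
  using has_bochner_integral_measure_preserving[OF from_real_lebesgue, of f b]
    has_bochner_integral_measure_preserving[OF to_real_lebesgue, of "\<lambda>x. f (from_real x)" b]
  by (auto simp only: from_real_to_real)

lemma has_bochner_integral_lebesgue_on:
  fixes f :: "'a::euclidean_space \<Rightarrow> real"
  assumes S: "S \<in> sets lebesgue"
  shows "has_bochner_integral (lebesgue_on S) f b
    \<longleftrightarrow> has_bochner_integral lebesgue (\<lambda>x. indicator S x *\<^sub>R f x) b"
proof -
  have S': "S \<inter> space lebesgue \<in> sets lebesgue" using S by simp
  show ?thesis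
    unfolding has_bochner_integral_iff integrable_restrict_space[OF S'] integral_restrict_space[OF S'] ..
qed

lemma has_bochner_integral_lebesgue_on_to_real:
  fixes f :: "complex^'n::finite \<Rightarrow> real"
  assumes S: "S \<in> sets lebesgue"
  shows "has_bochner_integral (lebesgue_on S) f b
    \<longleftrightarrow> has_bochner_integral (lebesgue_on (to_real ` S)) (\<lambda>x. f (from_real x)) b"
proof -
  have "from_real x \<in> S \<longleftrightarrow> x \<in> to_real ` S" for x :: "real^'n bit0"
    by (metis from_real_to_real image_iff to_real_from_real)
  then have ind: "indicator S (from_real x) = (indicator (to_real ` S) x :: real)" for x :: "real^'n bit0"
    by (auto simp: indicator_def)
  show ?thesis
    unfolding has_bochner_integral_lebesgue_on[OF S] has_bochner_integral_lebesgue_on[OF to_real_lebesgue_set[OF S]]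
    unfolding has_bochner_integral_from_real[of "\<lambda>x. indicator S x *\<^sub>R f x"] ind ..
qed

subsection \<open>The real determinant of a complex matrix\<close>

definition real_matrix :: "complex^'n::finite^'n \<Rightarrow> real^'n bit0^'n bit0" where
  "real_matrix A = matrix (\<lambda>x. to_real (A *v from_real x))"

lemma linear_complex_mult: "linear (\<lambda>x. (A :: complex^'n::finite^'m::finite) *v x)"
  by (rule linearI) (auto simp: vec_eq_iff matrix_vector_mult_def scaleR_sum_right distrib_left sum.distrib)

lemma linear_real_matrix: "linear (\<lambda>x. to_real (A *v from_real x))"
  using linear_compose[OF linear_compose[OF linear_from_real linear_complex_mult] linear_to_real]
  by (simp add: o_def)

lemma real_matrix_mult: "real_matrix (A ** B) = real_matrix A ** real_matrix B"
proof -
  have "(\<lambda>x. to_real ((A ** B) *v from_real x))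
      = (\<lambda>x. to_real (A *v from_real x)) \<circ> (\<lambda>x. to_real (B *v from_real x))"
    by (simp add: o_def matrix_vector_mul_assoc)
  then show ?thesis unfolding real_matrix_def
    using matrix_compose[OF linear_real_matrix linear_real_matrix] by simp
qed

lemma real_matrix_1 [simp]: "real_matrix (mat 1) = mat 1"
  unfolding real_matrix_def using matrix_id_mat_1 by (simp add: id_def)

text \<open>The relation between the real and the complex determinant is made a predicate because it is
  proved by propagating it along factorizations.\<close>

definition det_square :: "complex^'n::finite^'n \<Rightarrow> bool" where
  "det_square A \<longleftrightarrow> \<bar>det (real_matrix A)\<bar> = (norm (det A))\<^sup>2"

lemma det_square_mult: "det_square A \<Longrightarrow> det_square B \<Longrightarrow> det_square (A ** B)"
  by (simp add: det_square_def real_matrix_mult det_mul abs_mult norm_mult power_mult_distrib)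

lemma det_square_cancel:
  assumes "det_square (A ** B)" "det_square A" "det A \<noteq> 0"
  shows "det_square B"
  using assms by (simp add: det_square_def real_matrix_mult det_mul abs_mult norm_mult power_mult_distrib)

lemma det_square_1: "det_square (mat 1)"
  by (simp add: det_square_def)

lemma det_square_isometry:
  fixes A :: "complex^'n::finite^'n"
  assumes iso: "\<And>x. norm (A *v x) = norm x" and det: "norm (det A) = 1"
  shows "det_square A"
proof -
  have "norm (to_real z) = norm z" for z :: "complex^'n"
    by (simp add: norm_eq_sqrt_inner to_real_inner)
  moreover from this have "norm (from_real x :: complex^'n) = norm x" for x
    using to_real_from_real by metis
  ultimately have "orthogonal_transformation (\<lambda>x. to_real (A *v from_real x))"
    using linear_real_matrix[of A] iso by (auto simp: orthogonal_transformation)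
  then show ?thesis unfolding det_square_def real_matrix_def using det by simp
qed

definition scale_row :: "'n::finite \<Rightarrow> complex \<Rightarrow> complex^'n^'n" where
  "scale_row k c = (\<chi> i j. if i = j then (if i = k then c else 1) else 0)"

lemma scale_row_mult_vec: "scale_row k c *v x = (\<chi> i. if i = k then c * x $ i else x $ i)"
proof -
  have "(\<Sum>j\<in>UNIV. (if i = j then if i = k then c else 1 else 0) * x $ j)
      = (if i = k then c * x $ i else x $ i)" for i
    by (subst sum.remove[of UNIV i]) (auto intro!: sum.neutral)
  then show ?thesis by (simp add: scale_row_def matrix_vector_mult_def vec_eq_iff)
qed

lemma det_scale_row: "det (scale_row k c) = c"
proof -
  have "det (scale_row k c) = (\<Prod>i\<in>UNIV. if i = k then c else 1)"
    by (subst det_diagonal) (auto simp: scale_row_def)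
  then show ?thesis by simp
qed

lemma matrix_eq_mult_vec: "(\<And>x. A *v x = B *v x) \<Longrightarrow> A = (B :: complex^'n::finite^'n)"
  by (simp add: matrix_eq)

lemma scale_row_mult: "scale_row k a ** scale_row k b = scale_row k (a * b)"
  by (rule matrix_eq_mult_vec) (auto simp: matrix_vector_mul_assoc[symmetric] scale_row_mult_vec vec_eq_iff)

text \<open>In the real basis a real diagonal matrix stays diagonal, with every entry occurring twice.\<close>

lemma det_square_scale_row_real:
  "det_square (scale_row k (of_real r) :: complex^'n::finite^'n)"
proof -
  have entry: "real_matrix (scale_row k (of_real r) :: complex^'n^'n) $ i $ j
      = (if i = j then (if basis_enum i \<in> {axis k 1, axis k \<i>} then r else 1) else 0)" for i j
  proof -
    obtain k' u where u: "basis_enum j = (axis k' u :: complex^'n)" "u \<in> Basis"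
      using basis_enum_in[of j] unfolding Basis_vec_def by auto
    have "axis j 1 $ m *\<^sub>R basis_enum m = (if m = j then basis_enum j else (0::complex^'n))" for m
      by (simp add: axis_def)
    then have "from_real (axis j 1) = (basis_enum j :: complex^'n)"
      unfolding from_real_def by simp
    moreover have "scale_row k (of_real r) *v (axis k' u :: complex^'n) = (if k' = k then r else 1) *\<^sub>R axis k' u"
      by (auto simp: scale_row_mult_vec vec_eq_iff axis_def of_real_def)
    ultimately have "real_matrix (scale_row k (of_real r) :: complex^'n^'n) $ i $ j
        = (if k' = k then r else 1) * (basis_enum j \<bullet> (basis_enum i :: complex^'n))"
      by (simp add: real_matrix_def matrix_def to_real_def u)
    moreover have "k' = k \<longleftrightarrow> basis_enum j \<in> {axis k 1, axis k \<i> :: complex^'n}"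
      using u by (auto simp: axis_eq_axis Basis_complex_def)
    ultimately show ?thesis by (simp add: basis_enum_inner)
  qed
  have "det (real_matrix (scale_row k (of_real r) :: complex^'n^'n))
      = (\<Prod>i\<in>UNIV. if basis_enum i \<in> {axis k 1, axis k \<i> :: complex^'n} then r else 1)"
    by (subst det_diagonal) (auto simp: entry)
  also have "\<dots> = (\<Prod>b\<in>Basis. if b \<in> {axis k 1, axis k \<i> :: complex^'n} then r else 1)"
    by (rule prod.reindex_bij_betw[OF bij_basis_enum])
  also have "\<dots> = (\<Prod>b\<in>Basis \<inter> {axis k 1, axis k \<i> :: complex^'n}. r)"
    by (rule prod.inter_restrict[symmetric]) simp
  also have "Basis \<inter> {axis k 1, axis k \<i> :: complex^'n} = {axis k 1, axis k \<i>}"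
    by (auto simp: Basis_complex_def)
  also have "(\<Prod>b\<in>{axis k 1, axis k \<i> :: complex^'n}. r) = r\<^sup>2"
    by (simp add: axis_eq_axis power2_eq_square complex_eq_iff)
  finally show ?thesis by (simp add: det_square_def det_scale_row)
qed

text \<open>A nonzero complex number is a positive number times a number of modulus 1. The first factor
  gives a real diagonal matrix, the second an isometry.\<close>

lemma det_square_scale_row:
  fixes c :: complex
  assumes "c \<noteq> 0" shows "det_square (scale_row k c)"
proof -
  have iso: "det_square (scale_row k (c / of_real (norm c)))"
  proof (rule det_square_isometry)
    show "norm (scale_row k (c / of_real (norm c)) *v x) = norm x" for x
      unfolding norm_vec_def scale_row_mult_vec
      by (rule arg_cong[where f="\<lambda>f. L2_set f UNIV"]) (use assms in \<open>auto simp: norm_mult norm_divide\<close>)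
    show "norm (det (scale_row k (c / of_real (norm c)))) = 1"
      using assms by (simp add: det_scale_row norm_divide)
  qed
  from det_square_mult[OF iso det_square_scale_row_real[of k "norm c"]] assms
  show ?thesis by (simp add: scale_row_mult)
qed

definition set_row :: "'n::finite \<Rightarrow> complex^'n \<Rightarrow> complex^'n^'n" where
  "set_row k v = (\<chi> i. if i = k then v else axis i 1)"

lemma set_row_mult_vec: "set_row k v *v x = (\<chi> i. if i = k then (\<Sum>j\<in>UNIV. v $ j * x $ j) else x $ i)"
proof -
  have "(\<Sum>j\<in>UNIV. axis i 1 $ j * x $ j) = x $ i" for i
    by (simp add: axis_def if_distrib[of "\<lambda>y. y * _"] cong: if_cong)
  then show ?thesis by (auto simp: set_row_def matrix_vector_mult_def vec_eq_iff)
qed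

text \<open>If the diagonal entry is 1, then conjugating with the reflection in the \<open>k\<close>-th coordinate
  inverts the matrix, so that both determinants have square 1.\<close>

lemma det_square_set_row:
  fixes v :: "complex^'n::finite"
  assumes "v $ k \<noteq> 0"
  shows "det_square (set_row k v)" and "det (set_row k v) \<noteq> 0"
proof -
  define S where "S = set_row k ((1 / v $ k) *s v)"
  define J :: "complex^'n^'n" where "J = scale_row k (-1)"
  have v_split: "(\<Sum>j\<in>UNIV. v $ j * x $ j) = v $ k * x $ k + (\<Sum>j\<in>UNIV-{k}. v $ j * x $ j)" for x
    by (subst sum.remove[of UNIV k]) auto
  have S_mult: "S *v x = (\<chi> i. if i = k then x $ k + (\<Sum>j\<in>UNIV-{k}. v $ j / v $ k * x $ j) else x $ i)" for x
  proof -
    have "(\<Sum>j\<in>UNIV. ((1 / v $ k) *s v) $ j * x $ j) = x $ k + (\<Sum>j\<in>UNIV-{k}. v $ j / v $ k * x $ j)"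
      by (subst sum.remove[of UNIV k]) (use assms in auto)
    then show ?thesis by (simp add: S_def set_row_mult_vec vec_eq_iff)
  qed
  have inv: "(J ** S) ** (J ** S) = mat 1"
  proof (rule matrix_eq_mult_vec)
    fix x
    have sums: "(\<Sum>j\<in>UNIV-{k}. v $ j / v $ k * (if j = k then a else x $ j)) = (\<Sum>j\<in>UNIV-{k}. v $ j / v $ k * x $ j)" for a
      by (rule sum.cong) auto
    show "((J ** S) ** (J ** S)) *v x = mat 1 *v x"
      by (simp add: matrix_vector_mul_assoc[symmetric] J_def scale_row_mult_vec S_mult vec_eq_iff sums
          cong: if_cong)
  qed
  have "(det (J ** S))\<^sup>2 = 1" "(det (real_matrix (J ** S)))\<^sup>2 = 1"
    using arg_cong[OF inv, of det] arg_cong[OF inv, of "\<lambda>A. det (real_matrix A)"]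
    by (simp_all add: det_mul real_matrix_mult power2_eq_square)
  then have d: "norm (det (J ** S)) = 1" "\<bar>det (real_matrix (J ** S))\<bar> = 1"
    by (metis norm_one norm_power power2_eq_1_iff norm_minus_cancel,
        metis abs_1 abs_minus_cancel power2_eq_1_iff)
  then have "det_square (J ** S)" by (simp add: det_square_def)
  then have S: "det_square S"
    by (rule det_square_cancel) (auto simp: J_def det_square_scale_row det_scale_row)
  have dS: "det S \<noteq> 0" using d(1) by (auto simp: det_mul)
  have eq: "set_row k v = scale_row k (v $ k) ** S"
  proof (rule matrix_eq_mult_vec)
    fix x
    have "(\<Sum>j\<in>UNIV-{k}. v $ j * x $ j) = v $ k * (\<Sum>j\<in>UNIV-{k}. v $ j / v $ k * x $ j)"
      unfolding sum_distrib_left by (rule sum.cong) (use assms in auto)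
    then show "set_row k v *v x = (scale_row k (v $ k) ** S) *v x"
      by (auto simp: matrix_vector_mul_assoc[symmetric] scale_row_mult_vec S_mult set_row_mult_vec vec_eq_iff
        v_split distrib_left)
  qed
  show "det_square (set_row k v)" unfolding eq
    by (rule det_square_mult[OF det_square_scale_row[OF assms] S])
  show "det (set_row k v) \<noteq> 0" unfolding eq det_mul using dS assms by (simp add: det_scale_row)
qed

lemma set_row_times: "(set_row k v ** A) $ i = (if i = k then v v* A else A $ i)"
proof -
  have "(\<Sum>j\<in>UNIV. axis i 1 $ j * A $ j $ l) = A $ i $ l" for l
    by (simp add: axis_def if_distrib[of "\<lambda>y. y * _"] cong: if_cong)
  then show ?thesis
    by (auto simp: set_row_def matrix_matrix_mult_def vector_matrix_mult_def vec_eq_iff mult.commute)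
qed

text \<open>Gaussian elimination: multiplying an invertible matrix by at most two matrices \<open>set_row\<close>
  turns one more row into a unit vector.\<close>

lemma det_square_invertible:
  fixes A :: "complex^'n::finite^'n"
  shows "det A \<noteq> 0 \<Longrightarrow> det_square A"
proof (induction "card {i. A $ i \<noteq> axis i 1}" arbitrary: A rule: less_induct)
  case less
  show ?case
  proof (cases "\<exists>k. A $ k \<noteq> axis k 1")
    case False
    then have "A = mat 1" by (auto simp: vec_eq_iff mat_def axis_def)
    then show ?thesis by (simp add: det_square_1)
  next
    case True
    then obtain k where k: "A $ k \<noteq> axis k 1" by blast
    \<comment> \<open>If the inverse \<open>B\<close> has a nonzero diagonal entry at \<open>k\<close>, then multiplication by the matrix with
      \<open>k\<close>-th row \<open>B $ k\<close> turns the \<open>k\<close>-th row of \<open>A\<close> into a unit vector and keeps the other rows.\<close>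
    have step: "det_square A"
      if A: "det A \<noteq> 0" "A $ k \<noteq> axis k 1" "{i. A $ i \<noteq> axis i 1} \<subseteq> W"
        "card W \<le> card {i. A' $ i \<noteq> axis i 1}" and W: "finite W" "k \<in> W"
        and B: "B ** A = mat 1" "B $ k $ k \<noteq> 0"
        and IH: "\<And>C :: complex^'n^'n. card {i. C $ i \<noteq> axis i 1} < card {i. A' $ i \<noteq> axis i 1} \<Longrightarrow> det C \<noteq> 0 \<Longrightarrow> det_square C"
      for A B A' :: "complex^'n^'n" and W
    proof -
      have row: "(B $ k) v* A = axis k 1"
      proof -
        have "(B $ k) v* A = (B ** A) $ k"
          by (simp add: vector_matrix_mult_def matrix_matrix_mult_def vec_eq_iff mult.commute)
        then show ?thesis unfolding B(1) by (auto simp: mat_def vec_eq_iff axis_def)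
      qed
      have sub: "{i. (set_row k (B $ k) ** A) $ i \<noteq> axis i 1} \<subseteq> W - {k}"
        using A(3) by (auto simp: set_row_times row)
      have "card {i. (set_row k (B $ k) ** A) $ i \<noteq> axis i 1} \<le> card (W - {k})"
        using sub W(1) by (intro card_mono) auto
      also have "\<dots> < card W" using W by (intro card_Diff1_less)
      finally have "det_square (set_row k (B $ k) ** A)"
        using A(1,4) det_square_set_row(2)[OF B(2)] by (intro IH) (auto simp: det_mul)
      then show ?thesis using det_square_set_row[OF B(2)] by (rule det_square_cancel)
    qed
    define W where "W = {i. A $ i \<noteq> axis i 1}"
    have "invertible A" using less.prems by (simp add: invertible_det_nz)
    then obtain B where B: "B ** A = mat 1" by (auto simp: invertible_def)
    show ?thesis
    proof (cases "B $ k $ k = 0")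
      case False
      show ?thesis
        by (rule step[OF less.prems k _ _ _ _ B False less(1), where W=W]) (simp_all add: W_def k)
    next
      case True
      have "\<exists>j. B $ k $ j \<noteq> 0 \<and> A $ j \<noteq> axis j 1"
      proof (rule ccontr)
        assume "\<nexists>j. B $ k $ j \<noteq> 0 \<and> A $ j \<noteq> axis j 1"
        then have "B $ k $ j * A $ j $ k = (if j = k then B $ k $ k else 0)" for j
          by (cases "B $ k $ j = 0") (auto simp: axis_def)
        then have "(B ** A) $ k $ k = B $ k $ k" by (simp add: matrix_matrix_mult_def)
        then show False using B True by (simp add: mat_def)
      qed
      then obtain j where j: "B $ k $ j \<noteq> 0" "A $ j \<noteq> axis j 1" by blast
      with True have jk: "j \<noteq> k" by auto
      \<comment> \<open>Subtracting row \<open>k\<close> from row \<open>j\<close> adds column \<open>j\<close> of the inverse to its column \<open>k\<close>, so that its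
        diagonal entry at \<open>k\<close> becomes \<open>B $ k $ j\<close>.\<close>
      define E where "E = set_row j (axis j 1 - axis k 1 :: complex^'n)"
      define E' where "E' = set_row j (axis j 1 + axis k 1 :: complex^'n)"
      have E: "det_square E" "det E \<noteq> 0"
        unfolding E_def using jk by (auto intro!: det_square_set_row simp: axis_def)
      have sums: "(\<Sum>l\<in>UNIV. (axis j 1 + axis k 1 :: complex^'n) $ l * x $ l) = x $ j + x $ k"
        "(\<Sum>l\<in>UNIV. (axis j 1 - axis k 1 :: complex^'n) $ l * x $ l) = x $ j - x $ k" for x
        by (simp_all add: axis_def if_distrib[of "\<lambda>y. y * _"] distrib_right left_diff_distrib
            sum.distrib sum_subtractf cong: if_cong)
      have E_vec: "E *v x = (\<chi> i. if i = j then x $ j - x $ k else x $ i)"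
        and E'_vec: "E' *v x = (\<chi> i. if i = j then x $ j + x $ k else x $ i)" for x
        unfolding E_def E'_def set_row_mult_vec sums by (rule refl)+
      have E'E: "E' ** E = mat 1"
        by (rule matrix_eq_mult_vec)
          (use jk in \<open>simp add: matrix_vector_mul_assoc[symmetric] E_vec E'_vec vec_eq_iff\<close>)
      have inv: "(B ** E') ** (E ** A) = mat 1"
        using B E'E by (metis matrix_mul_assoc matrix_mul_lid)
      have entry: "(B ** E') $ k $ k = B $ k $ j"
      proof -
        have "B $ k $ l * E' $ l $ k = (if l = j then B $ k $ j else 0)" for l
          using jk True by (auto simp: E'_def set_row_def axis_def)
        then show ?thesis by (simp add: matrix_matrix_mult_def)
      qed
      have rows: "(E ** A) $ i = A $ i" if "i \<noteq> j" for i
        using that by (simp add: E_def set_row_times)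
      have "det_square (E ** A)"
      proof (rule step[OF _ _ _ _ _ _ inv _ less(1), where W=W])
        show "{i. (E ** A) $ i \<noteq> axis i 1} \<subseteq> W" using rows j(2) unfolding W_def by (auto, metis)
        show "(E ** A) $ k \<noteq> axis k 1" using rows[of k] jk k by simp
        show "det (E ** A) \<noteq> 0" using E(2) less.prems by (simp add: det_mul)
        show "(B ** E') $ k $ k \<noteq> 0" using entry j(1) by simp
      qed (simp_all add: W_def k)
      then show ?thesis using E by (rule det_square_cancel)
    qed
  qed
qed

subsection \<open>Change of variables\<close>

text \<open>Formulated as an equivalence, so that integrability is transferred in both directions.\<close>

theorem holomorphic_change_of_variables:
  fixes f :: "complex^'n::finite \<Rightarrow> real"
  assumes S: "S \<in> sets lebesgue" and FS: "F ` S \<in> sets lebesgue"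
    and der: "\<And>z. z \<in> S \<Longrightarrow> (F has_derivative (\<lambda>v. A z *v v)) (at z within S)"
    and det: "\<And>z. z \<in> S \<Longrightarrow> det (A z) \<noteq> 0" and inj: "inj_on F S"
  shows "has_bochner_integral (lebesgue_on (F ` S)) f b \<longleftrightarrow>
         has_bochner_integral (lebesgue_on S) (\<lambda>z. (norm (det (A z)))\<^sup>2 * f (F z)) b"
proof -
  define G where "G = (\<lambda>x. to_real (F (from_real x)))"
  define g where "g = (\<lambda>x. vec (f (from_real x)) :: real^1)"
  define T where "T = to_real ` S"
  have T: "T \<in> sets lebesgue" unfolding T_def by (rule to_real_lebesgue_set[OF S])
  have GT: "G ` T = to_real ` F ` S" by (simp add: G_def T_def image_image)
  have GT': "G ` T \<in> sets lebesgue" unfolding GT by (rule to_real_lebesgue_set[OF FS])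
  have fT: "from_real ` T = S" by (simp add: T_def image_image)
  have derG: "(G has_derivative (\<lambda>v. to_real (A (from_real x) *v from_real v))) (at x within T)" if "x \<in> T" for x
  proof -
    have xS: "from_real x \<in> S" using that fT by blast
    have 1: "(from_real has_derivative from_real) (at x within T)"
      using linear_from_real by (intro bounded_linear_imp_has_derivative) (simp add: linear_conv_bounded_linear)
    have 2: "(F has_derivative (\<lambda>v. A (from_real x) *v v)) (at (from_real x) within from_real ` T)"
      using der[OF xS] fT by simp
    have 3: "(to_real has_derivative to_real) (at y within U)" for y U
      using linear_to_real by (intro bounded_linear_imp_has_derivative) (simp add: linear_conv_bounded_linear)
    show ?thesis
      using has_derivative_compose[OF has_derivative_in_compose[OF 1 2] 3] by (simp add: G_def)
  qed
  have injG: "inj_on G T"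
    using inj bij_to_real unfolding G_def T_def inj_on_def bij_def by (auto dest: injD)
  have detG: "\<bar>det (matrix (\<lambda>v. to_real (A (from_real x) *v from_real v)))\<bar> = (norm (det (A (from_real x))))\<^sup>2"
    if "x \<in> T" for x
  proof -
    have "from_real x \<in> S" using that fT by blast
    from det_square_invertible[OF det[OF this]] show ?thesis
      by (simp add: det_square_def real_matrix_def)
  qed
  have real1: "g' absolutely_integrable_on U \<and> integral U g' = vec b \<longleftrightarrow>
      has_bochner_integral (lebesgue_on U) (\<lambda>x. g' x $ 1) b"
    if U: "U \<in> sets lebesgue" for g' :: "real^'n bit0 \<Rightarrow> real^1" and U b
  proof -
    have lin: "bounded_linear (\<lambda>x::real^1. x $ 1)" by (rule bounded_linear_vec_nth)
    have lin': "bounded_linear (\<lambda>x::real. vec x :: real^1)"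
      by (rule linear_conv_bounded_linear[THEN iffD1], rule linearI) (auto simp: vec_eq_iff)
    have gv: "g' = (\<lambda>x. vec (g' x $ 1))" by (auto simp: vec_eq_iff)
    have ai: "g' absolutely_integrable_on U \<longleftrightarrow> integrable (lebesgue_on U) g'"
      using U by (simp add: set_integrable_def integrable_restrict_space)
    have iff: "integrable (lebesgue_on U) g' \<longleftrightarrow> integrable (lebesgue_on U) (\<lambda>x. g' x $ 1)"
      using integrable_bounded_linear[OF lin, of "lebesgue_on U" g']
        integrable_bounded_linear[OF lin', of "lebesgue_on U" "\<lambda>x. g' x $ 1"] gv by auto
    have int: "integral U g' = vec b \<longleftrightarrow> integral\<^sup>L (lebesgue_on U) (\<lambda>x. g' x $ 1) = b"
      if "integrable (lebesgue_on U) g'"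
    proof -
      have "integral U g' = integral\<^sup>L (lebesgue_on U) g'"
        using lebesgue_integral_eq_integral[OF that U] by simp
      moreover have "integral\<^sup>L (lebesgue_on U) (\<lambda>x. g' x $ 1) = (integral\<^sup>L (lebesgue_on U) g') $ 1"
        by (rule integral_bounded_linear[OF lin that])
      ultimately show ?thesis by (auto simp: vec_eq_iff)
    qed
    show ?thesis unfolding has_bochner_integral_iff using ai iff int by auto
  qed
  have "has_bochner_integral (lebesgue_on (F ` S)) f b
      \<longleftrightarrow> has_bochner_integral (lebesgue_on (G ` T)) (\<lambda>x. g x $ 1) b"
    unfolding GT has_bochner_integral_lebesgue_on_to_real[OF FS] by (simp add: g_def)
  also have "\<dots> \<longleftrightarrow> g absolutely_integrable_on (G ` T) \<and> integral (G ` T) g = vec b"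
    by (rule real1[OF GT', symmetric])
  also have "\<dots> \<longleftrightarrow>
      (\<lambda>x. \<bar>det (matrix (\<lambda>v. to_real (A (from_real x) *v from_real v)))\<bar> *\<^sub>R g (G x)) absolutely_integrable_on T \<and>
      integral T (\<lambda>x. \<bar>det (matrix (\<lambda>v. to_real (A (from_real x) *v from_real v)))\<bar> *\<^sub>R g (G x)) = vec b"
    by (rule has_absolute_integral_change_of_variables[OF T derG injG, symmetric])
  also have "\<dots> \<longleftrightarrow> has_bochner_integral (lebesgue_on T)
      (\<lambda>x. (\<bar>det (matrix (\<lambda>v. to_real (A (from_real x) *v from_real v)))\<bar> *\<^sub>R g (G x)) $ 1) b"
    by (rule real1[OF T])
  also have "\<dots> \<longleftrightarrow> has_bochner_integral (lebesgue_on T)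
      (\<lambda>x. (norm (det (A (from_real x))))\<^sup>2 * f (F (from_real x))) b"
    by (rule has_bochner_integral_cong) (use detG in \<open>auto simp: g_def G_def\<close>)
  also have "\<dots> \<longleftrightarrow> has_bochner_integral (lebesgue_on S) (\<lambda>z. (norm (det (A z)))\<^sup>2 * f (F z)) b"
    unfolding T_def by (rule has_bochner_integral_lebesgue_on_to_real[OF S, symmetric])
  finally show ?thesis .
qed

section \<open>Holomorphic functions of several variables\<close>

subsection \<open>Basic properties\<close>

lemma norm_vector_smult: "norm (c *s v) = norm c * norm (v :: complex^'n::finite)"
proof -
  have "norm (c *s v) = L2_set (\<lambda>i. norm c * norm (v $ i)) UNIV"
    by (simp add: norm_vec_def norm_mult)
  then show ?thesis by (simp add: norm_vec_def L2_set_right_distrib)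
qed

lemma bounded_linear_vector_smult: "bounded_linear (\<lambda>c. c *s (v :: complex^'n::finite))"
proof (rule bounded_linear_intro[where K="norm v"])
  show "(a + b) *s v = a *s v + b *s v" for a b by (simp add: vector_sadd_rdistrib)
  show "(r *\<^sub>R a) *s v = r *\<^sub>R (a *s v)" for r a by (simp add: vec_eq_iff)
  show "norm (a *s v) \<le> norm a * norm v" for a by (simp add: norm_vector_smult)
qed

definition complex_deriv :: "(complex^'n::finite \<Rightarrow> complex) \<Rightarrow> complex^'n \<Rightarrow> (complex^'n \<Rightarrow> complex) \<Rightarrow> bool" where
  "complex_deriv f z D \<longleftrightarrow> (f has_derivative D) (at z) \<and> (\<forall>c v. D (c *s v) = c * D v)"

lemma holo_on_iff: "holo_on \<Omega> f \<longleftrightarrow> (\<forall>z\<in>\<Omega>. \<exists>D. complex_deriv f z D)"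
  by (simp add: holo_on_def complex_deriv_def)

lemma complex_derivD:
  assumes "complex_deriv f z D"
  shows "(f has_derivative D) (at z)" "D (c *s v) = c * D v"
  using assms by (auto simp: complex_deriv_def)

lemma holo_onE:
  assumes "holo_on \<Omega> f" "z \<in> \<Omega>"
  obtains D where "complex_deriv f z D"
  using assms unfolding holo_on_iff by blast

lemma holo_on_subset: "holo_on \<Omega> f \<Longrightarrow> S \<subseteq> \<Omega> \<Longrightarrow> holo_on S f"
  by (auto simp: holo_on_def)

lemma holo_on_cong_open:
  assumes "open \<Omega>" "\<And>z. z \<in> \<Omega> \<Longrightarrow> f z = g z"
  shows "holo_on \<Omega> f \<longleftrightarrow> holo_on \<Omega> g"
proof -
  have "(f has_derivative D) (at z) \<longleftrightarrow> (g has_derivative D) (at z)" if "z \<in> \<Omega>" for z D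
  proof -
    have ev: "\<forall>\<^sub>F w in at z. f w = g w"
      using assms eventually_at_topological that by blast
    then have "\<forall>\<^sub>F w in at z. g w = f w" by (simp add: eq_commute)
    with ev show ?thesis
      using has_derivative_transform_eventually[of f D z UNIV g] has_derivative_transform_eventually[of g D z UNIV f]
        assms(2)[OF that] by auto
  qed
  then show ?thesis unfolding holo_on_def by auto
qed

lemma holo_on_imp_continuous_on: "holo_on \<Omega> f \<Longrightarrow> continuous_on \<Omega> f"
  unfolding holo_on_def
  by (auto intro!: continuous_at_imp_continuous_on dest: has_derivative_continuous)

lemma holo_on_imp_lebesgue_measurable:
  "open \<Omega> \<Longrightarrow> holo_on \<Omega> f \<Longrightarrow> f \<in> borel_measurable (lebesgue_on \<Omega>)"
  by (intro continuous_imp_measurable_on_sets_lebesgue holo_on_imp_continuous_on) auto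

lemma holo_on_const: "holo_on \<Omega> (\<lambda>z. c)"
  unfolding holo_on_def by (intro ballI exI[of _ "\<lambda>v. 0"]) auto

lemma holo_on_diff:
  assumes "holo_on \<Omega> f" "holo_on \<Omega> g" shows "holo_on \<Omega> (\<lambda>z. f z - g z)"
  unfolding holo_on_def
proof
  fix z assume "z \<in> \<Omega>"
  obtain D where D: "complex_deriv f z D" by (rule holo_onE[OF assms(1) \<open>z \<in> \<Omega>\<close>])
  obtain E where E: "complex_deriv g z E" by (rule holo_onE[OF assms(2) \<open>z \<in> \<Omega>\<close>])
  from complex_derivD[OF D] complex_derivD[OF E] show "\<exists>D. ((\<lambda>z. f z - g z) has_derivative D) (at z) \<and> (\<forall>c v. D (c *s v) = c * D v)"
    by (intro exI[of _ "\<lambda>v. D v - E v"]) (auto intro: has_derivative_diff simp: right_diff_distrib)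
qed

lemma holo_on_mult:
  assumes "holo_on \<Omega> f" "holo_on \<Omega> g" shows "holo_on \<Omega> (\<lambda>z. f z * g z)"
  unfolding holo_on_def
proof
  fix z assume "z \<in> \<Omega>"
  obtain D where D: "complex_deriv f z D" by (rule holo_onE[OF assms(1) \<open>z \<in> \<Omega>\<close>])
  obtain E where E: "complex_deriv g z E" by (rule holo_onE[OF assms(2) \<open>z \<in> \<Omega>\<close>])
  have "((\<lambda>z. f z * g z) has_derivative (\<lambda>v. f z * E v + D v * g z)) (at z)"
    by (rule has_derivative_mult[OF complex_derivD(1)[OF D] complex_derivD(1)[OF E]])
  then show "\<exists>D. ((\<lambda>z. f z * g z) has_derivative D) (at z) \<and> (\<forall>c v. D (c *s v) = c * D v)"
    by (rule exI[of _ "\<lambda>v. f z * E v + D v * g z", OF conjI])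
      (simp add: complex_derivD(2)[OF D] complex_derivD(2)[OF E] algebra_simps)
qed

lemma holo_on_add:
  assumes "holo_on \<Omega> f" "holo_on \<Omega> g" shows "holo_on \<Omega> (\<lambda>z. f z + g z)"
  using holo_on_diff[OF assms(1) holo_on_mult[OF holo_on_const[of _ "-1"] assms(2)]] by simp

lemma holo_on_field_compose:
  assumes f: "holo_on \<Omega> f" and g: "\<And>z. z \<in> \<Omega> \<Longrightarrow> g field_differentiable (at (f z))"
  shows "holo_on \<Omega> (\<lambda>z. g (f z))"
  unfolding holo_on_def
proof
  fix z assume z: "z \<in> \<Omega>"
  obtain D where "complex_deriv f z D" by (rule holo_onE[OF f z])
  note D = complex_derivD[OF this]
  obtain g' where g': "(g has_field_derivative g') (at (f z))"
    using g[OF z] by (auto simp: field_differentiable_def)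
  have "((\<lambda>z. g (f z)) has_derivative (\<lambda>v. g' * D v)) (at z)"
    using has_derivative_compose[OF D(1)] g' by (simp add: has_field_derivative_def)
  with D(2) show "\<exists>D. ((\<lambda>z. g (f z)) has_derivative D) (at z) \<and> (\<forall>c v. D (c *s v) = c * D v)"
    by (intro exI[of _ "\<lambda>v. g' * D v"]) auto
qed

subsection \<open>Restriction to complex lines\<close>

lemma complex_deriv_line:
  assumes "complex_deriv f (z + t *s v) D"
  shows "((\<lambda>s. f (z + s *s v)) has_field_derivative D v) (at t)"
proof -
  have "((\<lambda>s. z + s *s v) has_derivative (\<lambda>s. 0 + s *s v)) (at t)"
    by (intro has_derivative_add has_derivative_const bounded_linear_imp_has_derivative bounded_linear_vector_smult)
  moreover have "(f has_derivative D) (at (z + t *s v))" using assms by (simp add: complex_deriv_def)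
  ultimately have "((\<lambda>s. f (z + s *s v)) has_derivative (\<lambda>s. D (0 + s *s v))) (at t)"
    by (rule has_derivative_compose)
  moreover have "(\<lambda>s. D (0 + s *s v)) = (\<lambda>s. D v * s)"
    using assms by (auto simp: complex_deriv_def mult.commute)
  ultimately show ?thesis by (simp add: has_field_derivative_def)
qed

lemma line_in_ball: "norm t * norm (v :: complex^'n::finite) < r \<Longrightarrow> z + t *s v \<in> ball z r"
  by (simp add: dist_norm norm_vector_smult)

lemma holo_on_line:
  fixes v :: "complex^'n::finite"
  assumes f: "holo_on (ball z r) f" and S: "\<And>t. t \<in> S \<Longrightarrow> norm t * norm v < r"
  shows "(\<lambda>t. f (z + t *s v)) holomorphic_on S"
proof -
  have "\<exists>d. ((\<lambda>t. f (z + t *s v)) has_field_derivative d) (at t within S)" if t: "t \<in> S" for t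
  proof -
    obtain D where "complex_deriv f (z + t *s v) D"
      by (rule holo_onE[OF f line_in_ball[OF S[OF t]]])
    from complex_deriv_line[OF this] show ?thesis by (blast intro: has_field_derivative_at_within)
  qed
  then show ?thesis by (simp add: holomorphic_on_def field_differentiable_def)
qed

text \<open>The one-variable Cauchy estimate on the complex line through \<open>z\<close> in direction \<open>v\<close>. The factor
  2 comes from using a circle of half the maximal radius, whose closed disc stays inside the ball.\<close>

lemma several_Cauchy_estimate:
  assumes f: "holo_on (ball z r) f" and B: "\<And>w. w \<in> ball z r \<Longrightarrow> norm (f w) \<le> B"
    and r: "r > 0" and D: "complex_deriv f z D"
  shows "norm (D v) \<le> 2 * B / r * norm v"
proof (cases "v = 0")
  case True
  have "D (0 *s v) = 0 * D v" using D unfolding complex_deriv_def by blast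
  then show ?thesis using True by simp
next
  case False
  define s where "s = r / (2 * norm v)"
  have s: "s > 0" "s * norm v < r" using r False by (auto simp: s_def)
  have small: "norm t * norm v < r" if "norm t \<le> s" for t :: complex
    using mult_right_mono[OF that, of "norm v"] s by simp
  define g where "g = (\<lambda>t. f (z + t *s v))"
  have hol: "g holomorphic_on cball 0 s"
    unfolding g_def by (rule holo_on_line[OF f small]) simp
  have "norm ((deriv ^^ 1) g 0) \<le> fact 1 * B / s ^ 1"
  proof (rule Cauchy_inequality)
    show "g holomorphic_on ball 0 s" using hol by (rule holomorphic_on_subset) auto
    show "continuous_on (cball 0 s) g" using hol by (rule holomorphic_on_imp_continuous_on)
    show "norm (g t) \<le> B" if "norm (0 - t) = s" for t
      unfolding g_def using that by (intro B line_in_ball small) auto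
  qed (rule s)
  moreover have "deriv g 0 = D v"
    unfolding g_def by (rule DERIV_imp_deriv, rule complex_deriv_line) (use D in simp)
  ultimately show ?thesis using r False by (simp add: s_def field_simps)
qed

subsection \<open>The sub-mean value inequality\<close>

text \<open>The mean is a nonnegative integral, to which Fubini's theorem applies without any
  integrability.\<close>

lemma circle_mean_bound:
  assumes g: "g holomorphic_on cball 0 1"
  shows "ennreal (norm (g 0)) \<le>
    (\<integral>\<^sup>+\<theta>. indicator {0..1} \<theta> * ennreal (norm (g (exp (2 * of_real pi * \<i> * of_real \<theta>)))) \<partial>lborel)"
proof -
  define e where "e = (\<lambda>\<theta>::real. exp (2 * of_real pi * \<i> * of_real \<theta>))"
  have cp: "circlepath 0 1 = e" by (auto simp: circlepath_def part_circlepath_def e_def linepath_def algebra_simps)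
  have e: "norm (e \<theta>) = 1" "e \<theta> \<noteq> 0" for \<theta> by (simp_all add: e_def)
  have "((\<lambda>u. g u / (u - 0)) has_contour_integral 2 * of_real pi * \<i> * g 0) (circlepath 0 1)"
    by (rule Cauchy_integral_circlepath_simple) (use g in auto)
  then have "((\<lambda>x. g (e x) / e x * vector_derivative (circlepath 0 1) (at x)) has_integral 2 * of_real pi * \<i> * g 0) {0..1}"
    unfolding has_contour_integral cp by simp
  then have "((\<lambda>x. g (e x) * (2 * of_real pi * \<i>)) has_integral 2 * of_real pi * \<i> * g 0) {0..1}"
    by (simp add: vector_derivative_circlepath e_def[symmetric])
       (simp add: e_def field_simps)
  from has_integral_mult_left[OF this, of "1 / (2 * of_real pi * \<i>)"]
  have int: "((\<lambda>x. g (e x)) has_integral g 0) {0..1}"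
    by (simp add: field_simps)
  have cont: "continuous_on {0..1} (\<lambda>x. g (e x))"
  proof (rule continuous_on_compose2[OF holomorphic_on_imp_continuous_on[OF g]])
    show "continuous_on {0..1} e" unfolding e_def by (intro continuous_intros)
  qed (use e in auto)
  have I: "set_integrable lborel {0..1} (\<lambda>x. g (e x))"
    unfolding set_integrable_def by (rule borel_integrable_compact[OF _ cont]) simp
  have "g 0 = (LINT x|lborel. indicator {0..1} x *\<^sub>R g (e x))"
    using set_borel_integral_eq_integral(2)[OF I] int
    by (simp add: set_lebesgue_integral_def integral_unique)
  then have "ennreal (norm (g 0)) \<le> (\<integral>\<^sup>+x. ennreal (norm (indicator {0..1} x *\<^sub>R g (e x))) \<partial>lborel)"
    using integral_norm_bound_ennreal[OF I[unfolded set_integrable_def]] by simp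
  also have "\<dots> = (\<integral>\<^sup>+\<theta>. indicator {0..1} \<theta> * ennreal (norm (g (e \<theta>))) \<partial>lborel)"
    by (rule nn_integral_cong) (auto simp: indicator_def)
  finally show ?thesis unfolding e_def .
qed

lemma matrix_smult_mult_vec: "(\<chi> i j. if i = j then c else 0) *v v = c *s (v :: complex^'n::finite)"
proof -
  have "(\<Sum>j\<in>UNIV. (if i = j then c else 0) * v $ j) = c * v $ i" for i
    by (subst sum.remove[of UNIV i]) (auto intro!: sum.neutral)
  then show ?thesis by (simp add: matrix_vector_mult_def vec_eq_iff)
qed

text \<open>The determinant of multiplication by \<open>c\<close> is a power of \<open>c\<close>, so boxes keep their volume.\<close>

lemma lborel_distr_rotation:
  assumes c: "norm c = 1"
  shows "distr lborel borel (\<lambda>w. c *s w) = (lborel :: (complex^'n::finite) measure)"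
proof (rule lborel_eqI[symmetric])
  define T where "T = (\<lambda>w :: complex^'n. c *s w)"
  define A :: "complex^'n^'n" where "A = (\<chi> i j. if i = j then c else 0)"
  have Av: "T = (\<lambda>v. A *v v)" by (simp add: T_def A_def matrix_smult_mult_vec)
  have c0: "c \<noteq> 0" using c by auto
  have detA: "norm (det A) = 1"
    unfolding A_def by (subst det_diagonal) (auto simp: c norm_power)
  have lin: "bounded_linear T"
    using linear_complex_mult[of A] unfolding Av by (simp add: linear_conv_bounded_linear)
  have [measurable]: "T \<in> borel_measurable borel"
    using lin by (intro borel_measurable_continuous_onI linear_continuous_on)
  have inv: "T ((1/c) *s w) = w" for w using c0 by (simp add: T_def vector_smult_assoc)
  have inj: "inj T"
    by (rule inj_on_inverseI[where g="\<lambda>w. (1/c) *s w"]) (use c0 in \<open>simp add: T_def vector_smult_assoc\<close>)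
  fix l u :: "complex^'n"
  assume lu: "\<And>b. b \<in> Basis \<Longrightarrow> l \<bullet> b \<le> u \<bullet> b"
  define S where "S = T -` box l u"
  have Sb: "S \<in> sets borel"
    using measurable_sets[of T borel borel "box l u"] by (simp add: S_def)
  have TS: "T ` S = box l u"
    unfolding S_def using inv by (auto simp: image_iff) metis
  have "has_bochner_integral (lebesgue_on (T ` S)) (\<lambda>w. 1) (measure lborel (box l u)) \<longleftrightarrow>
     has_bochner_integral (lebesgue_on S) (\<lambda>z. (norm (det A))\<^sup>2 * 1) (measure lborel (box l u))"
  proof (rule holomorphic_change_of_variables)
    show "(T has_derivative (\<lambda>v. A *v v)) (at z within S)" for z
      using bounded_linear_imp_has_derivative[OF lin] by (simp add: Av)
  qed (use Sb TS detA inj in \<open>auto simp: inj_on_def\<close>)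
  moreover have "has_bochner_integral (lebesgue_on (T ` S)) (\<lambda>w. 1) (measure lborel (box l u))"
  proof -
    have "has_bochner_integral lborel (indicator (box l u)) (measure lborel (box l u) *\<^sub>R (1::real))"
      by (subst has_bochner_integral_iff) (auto simp: emeasure_lborel_box_eq)
    then have "has_bochner_integral lebesgue (indicator (box l u)) (measure lborel (box l u))"
      unfolding has_bochner_integral_iff by (simp add: integrable_completion integral_completion)
    then show ?thesis unfolding TS
      by (subst has_bochner_integral_lebesgue_on) simp_all
  qed
  ultimately have "has_bochner_integral (lebesgue_on S) (\<lambda>z. 1::real) (measure lborel (box l u))"
    using detA by simp
  then have "has_bochner_integral lebesgue (indicator S :: _ \<Rightarrow> real) (measure lborel (box l u))"
    using Sb by (subst (asm) has_bochner_integral_lebesgue_on) auto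
  then have "integrable lborel (indicator S :: _ \<Rightarrow> real)" "measure lborel S = measure lborel (box l u)"
    unfolding has_bochner_integral_iff using Sb by (auto simp: integrable_completion integral_completion)
  moreover have "emeasure lborel (box l u) \<noteq> top" by (simp add: emeasure_lborel_box_eq)
  ultimately have "emeasure lborel S = emeasure lborel (box l u)"
    using Sb by (simp add: emeasure_eq_ennreal_measure integrable_indicator_iff less_top)
  then show "emeasure (distr lborel borel (\<lambda>w. c *s w)) (box l u) = ennreal (\<Prod>b\<in>Basis. (u - l) \<bullet> b)"
    using lu unfolding T_def[symmetric] by (simp add: emeasure_distr S_def)
qed simp

text \<open>On every complex line through \<open>z\<close> the modulus of a holomorphic function satisfies the
  one-variable mean value inequality. Averaging over all directions in the ball, the rotations drop
  out because they preserve Lebesgue measure.\<close>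

lemma sub_mean_value:
  fixes f :: "complex^'n::finite \<Rightarrow> complex"
  assumes f: "holo_on (ball z r) f"
  shows "ennreal (norm (f z)) * emeasure lborel (ball (0::complex^'n) r)
    \<le> (\<integral>\<^sup>+w. indicator (ball z r) w * ennreal (norm (f w)) \<partial>lborel)"
proof -
  define \<phi> where "\<phi> = (\<lambda>w. indicator (ball 0 r) w * ennreal (norm (f (z + w))))"
  have fm: "(\<lambda>w. indicator (ball z r) w *\<^sub>R f w) \<in> borel_measurable borel"
    using holo_on_imp_continuous_on[OF f] by (intro borel_measurable_continuous_on_indicator) auto
  have ind: "indicator (ball 0 r) w = (indicator (ball z r) (z + w) :: ennreal)" for w
    by (auto simp: indicator_def dist_norm)
  have \<phi>_eq: "\<phi> = (\<lambda>w. ennreal (norm (indicator (ball z r) (z + w) *\<^sub>R f (z + w))))"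
    unfolding \<phi>_def ind by (auto simp: indicator_def)
  have [measurable]: "(\<lambda>w. indicator (ball z r) (z + w) *\<^sub>R f (z + w)) \<in> borel_measurable borel"
    by (rule measurable_compose[OF _ fm]) simp
  have \<phi>m[measurable]: "\<phi> \<in> borel_measurable borel"
    unfolding \<phi>_eq by measurable
  define e where "e = (\<lambda>\<theta>::real. exp (2 * of_real pi * \<i> * of_real \<theta>))"
  have e: "norm (e \<theta>) = 1" for \<theta> by (simp add: e_def)
  have pair[measurable]: "(\<lambda>x. e (snd x) *s fst x) \<in> borel_measurable (lborel \<Otimes>\<^sub>M lborel :: ((complex^'n) \<times> real) measure)"
  proof -
    have "continuous_on UNIV (\<lambda>x :: (complex^'n) \<times> real. e (snd x) *s fst x)"
      unfolding e_def vector_scalar_mult_def by (intro continuous_intros)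
    then show ?thesis by (simp add: borel_measurable_continuous_onI lborel_prod)
  qed
  have "ennreal (norm (f z)) * emeasure lborel (ball (0::complex^'n) r)
      = (\<integral>\<^sup>+w. ennreal (norm (f z)) * indicator (ball (0::complex^'n) r) w \<partial>lborel)"
    by (simp add: nn_integral_cmult_indicator)
  also have "\<dots> \<le> (\<integral>\<^sup>+w. (\<integral>\<^sup>+\<theta>. indicator {0..1} \<theta> * \<phi> (e \<theta> *s w) \<partial>lborel) \<partial>lborel)"
  proof (rule nn_integral_mono)
    fix w :: "complex^'n"
    show "ennreal (norm (f z)) * indicator (ball 0 r) w \<le> (\<integral>\<^sup>+\<theta>. indicator {0..1} \<theta> * \<phi> (e \<theta> *s w) \<partial>lborel)"
    proof (cases "w \<in> ball 0 r")
      case True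
      then have w: "norm w < r" by simp
      have "(\<lambda>t. f (z + t *s w)) holomorphic_on cball 0 1"
      proof (rule holo_on_line[OF f])
        fix t :: complex assume "t \<in> cball 0 1"
        then have "norm t * norm w \<le> 1 * norm w" by (intro mult_right_mono) auto
        with w show "norm t * norm w < r" by simp
      qed
      from circle_mean_bound[OF this]
      have "ennreal (norm (f z)) \<le> (\<integral>\<^sup>+\<theta>. indicator {0..1} \<theta> * ennreal (norm (f (z + e \<theta> *s w))) \<partial>lborel)"
        by (simp add: e_def)
      also have "\<dots> = (\<integral>\<^sup>+\<theta>. indicator {0..1} \<theta> * \<phi> (e \<theta> *s w) \<partial>lborel)"
        using w by (intro nn_integral_cong) (simp add: \<phi>_def norm_vector_smult e)
      finally show ?thesis using True by simp
    qed simp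
  qed
  also have "\<dots> = (\<integral>\<^sup>+\<theta>. (\<integral>\<^sup>+w. indicator {0..1} \<theta> * \<phi> (e \<theta> *s w) \<partial>lborel) \<partial>lborel)"
    by (rule lborel_pair.Fubini'[symmetric]) (simp add: case_prod_unfold)
  also have "\<dots> = (\<integral>\<^sup>+\<theta>. indicator {0..1::real} \<theta> * (\<integral>\<^sup>+w. \<phi> w \<partial>lborel) \<partial>lborel)"
  proof (intro nn_integral_cong)
    fix \<theta> :: real
    have [measurable]: "(\<lambda>w::complex^'n. e \<theta> *s w) \<in> borel_measurable borel"
      unfolding vector_scalar_mult_def by (intro borel_measurable_continuous_onI continuous_intros)
    have "(\<integral>\<^sup>+w. indicator {0..1} \<theta> * \<phi> (e \<theta> *s w) \<partial>lborel) = indicator {0..1} \<theta> * (\<integral>\<^sup>+w. \<phi> (e \<theta> *s w) \<partial>lborel)"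
      by (rule nn_integral_cmult) simp
    also have "(\<integral>\<^sup>+w. \<phi> (e \<theta> *s w) \<partial>lborel) = (\<integral>\<^sup>+w. \<phi> w \<partial>distr lborel borel (\<lambda>w. e \<theta> *s w))"
      by (subst nn_integral_distr) auto
    finally show "(\<integral>\<^sup>+w. indicator {0..1} \<theta> * \<phi> (e \<theta> *s w) \<partial>lborel) = indicator {0..1} \<theta> * (\<integral>\<^sup>+w. \<phi> w \<partial>lborel)"
      by (simp add: lborel_distr_rotation e)
  qed
  also have "\<dots> = (\<integral>\<^sup>+w. \<phi> w \<partial>lborel)"
    by (simp add: nn_integral_multc)
  also have "\<dots> = (\<integral>\<^sup>+w. \<phi> w \<partial>distr lborel borel ((+) (- z)))"
    by (simp add: lborel_distr_plus)
  also have "\<dots> = (\<integral>\<^sup>+w. \<phi> (- z + w) \<partial>lborel)"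
    by (rule nn_integral_distr) auto
  also have "\<dots> = (\<integral>\<^sup>+w. indicator (ball z r) w * ennreal (norm (f w)) \<partial>lborel)"
    unfolding \<phi>_def ind by simp
  finally show ?thesis .
qed

lemma holo_bound_by_L1:
  fixes f :: "complex^'n::finite \<Rightarrow> complex"
  assumes \<Omega>: "open \<Omega>" and f: "holo_on \<Omega> f" "integrable (lebesgue_on \<Omega>) (\<lambda>z. norm (f z))"
    and B: "ball z r \<subseteq> \<Omega>" "r > 0"
  shows "norm (f z) \<le> integral\<^sup>L (lebesgue_on \<Omega>) (\<lambda>z. norm (f z)) / measure lborel (ball (0::complex^'n) r)"
proof -
  have fin: "emeasure lborel (ball (0::complex^'n) r) < \<infinity>"
    by (rule emeasure_bounded_finite) simp
  have pos: "measure lborel (ball (0::complex^'n) r) > 0"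
    using content_ball_pos[OF B(2), of 0] by simp
  have meas: "(\<lambda>w. indicator (ball z r) w * ennreal (norm (f w))) \<in> borel_measurable borel"
  proof -
    have "(\<lambda>w. indicator (ball z r) w *\<^sub>R f w) \<in> borel_measurable borel"
      using holo_on_imp_continuous_on[OF holo_on_subset[OF f(1) B(1)]]
      by (intro borel_measurable_continuous_on_indicator) auto
    then have "(\<lambda>w. ennreal (norm (indicator (ball z r) w *\<^sub>R f w))) \<in> borel_measurable borel" by measurable
    also have "(\<lambda>w. ennreal (norm (indicator (ball z r) w *\<^sub>R f w))) = (\<lambda>w. indicator (ball z r) w * ennreal (norm (f w)))"
      by (auto simp: indicator_def)
    finally show ?thesis .
  qed
  have "ennreal (norm (f z) * measure lborel (ball (0::complex^'n) r))
      = ennreal (norm (f z)) * emeasure lborel (ball (0::complex^'n) r)"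
    using fin by (simp add: ennreal_mult' emeasure_eq_ennreal_measure)
  also have "\<dots> \<le> (\<integral>\<^sup>+w. indicator (ball z r) w * ennreal (norm (f w)) \<partial>lborel)"
    by (rule sub_mean_value[OF holo_on_subset[OF f(1) B(1)]])
  also have "\<dots> = (\<integral>\<^sup>+w. indicator (ball z r) w * ennreal (norm (f w)) \<partial>lebesgue)"
    using meas by (intro nn_integral_completion[symmetric])
  also have "\<dots> \<le> (\<integral>\<^sup>+w. ennreal (norm (f w)) * indicator \<Omega> w \<partial>lebesgue)"
    using B by (intro nn_integral_mono) (auto simp: indicator_def)
  also have "\<dots> = (\<integral>\<^sup>+w. ennreal (norm (f w)) \<partial>lebesgue_on \<Omega>)"
    using \<Omega> by (subst nn_integral_restrict_space) auto
  also have "\<dots> = ennreal (integral\<^sup>L (lebesgue_on \<Omega>) (\<lambda>z. norm (f z)))"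
    by (rule nn_integral_eq_integral[OF f(2)]) simp
  finally have "norm (f z) * measure lborel (ball (0::complex^'n) r) \<le> integral\<^sup>L (lebesgue_on \<Omega>) (\<lambda>z. norm (f z))"
    by (subst (asm) ennreal_le_iff) auto
  then show ?thesis using pos by (simp add: pos_le_divide_eq)
qed

subsection \<open>Locally uniform limits\<close>

lemma complex_deriv_frechet:
  assumes "holo_on \<Omega> f" "z \<in> \<Omega>" shows "complex_deriv f z (frechet_derivative f (at z))"
  using assms by (auto simp: holo_on_def complex_deriv_def dest: frechet_derivative_at)

text \<open>By the Cauchy estimate applied to differences, the derivatives converge uniformly as well.\<close>

lemma uniform_limit_complex_deriv:
  fixes f :: "nat \<Rightarrow> complex^'n::finite \<Rightarrow> complex"
  assumes hol: "\<And>k. k \<ge> N \<Longrightarrow> holo_on (ball z r) (f k)" and r: "r > 0"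
    and lim: "uniform_limit (ball z r) f H sequentially"
  shows "\<exists>D. complex_deriv H z D"
proof -
  define S where "S = ball z (r/2)"
  define D where "D = (\<lambda>k w. frechet_derivative (f (k + N)) (at w))"
  have S: "ball w (r/2) \<subseteq> ball z r" if "w \<in> S" for w
    using that unfolding S_def subset_iff mem_ball by (smt (verit) dist_triangle field_sum_of_halves)
  have SB: "S \<subseteq> ball z r" using r by (auto simp: S_def)
  have D: "complex_deriv (f (k + N)) w (D k w)" if "w \<in> S" for k w
    unfolding D_def using that SB by (intro complex_deriv_frechet[OF hol]) auto
  have diff_D: "norm (D k w v - D l w v) \<le> 4 * e / r * norm v"
    if w: "w \<in> S" and e: "\<And>u. u \<in> ball z r \<Longrightarrow> norm (f (k + N) u - f (l + N) u) \<le> e" for k l w v e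
  proof -
    have "norm ((\<lambda>v. D k w v - D l w v) v) \<le> 2 * e / (r/2) * norm v"
    proof (rule several_Cauchy_estimate)
      show "holo_on (ball w (r/2)) (\<lambda>u. f (k + N) u - f (l + N) u)"
        by (intro holo_on_diff holo_on_subset[OF hol S[OF w]]) auto
      show "complex_deriv (\<lambda>u. f (k + N) u - f (l + N) u) w (\<lambda>v. D k w v - D l w v)"
        using D[OF w, of k] D[OF w, of l] by (auto simp: complex_deriv_def right_diff_distrib intro: has_derivative_diff)
    qed (use e S[OF w] r in auto)
    then show ?thesis by simp
  qed
  have Cauchy_unif: "\<exists>M. \<forall>k\<ge>M. \<forall>l\<ge>M. \<forall>w\<in>S. \<forall>v. norm (D k w v - D l w v) \<le> e * norm v" if e: "e > 0" for e
  proof -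
    have "uniformly_Cauchy_on (ball z r) f"
      using lim uniformly_convergent_on_def uniformly_convergent_Cauchy by blast
    then obtain M where M: "\<And>k l u. k \<ge> M \<Longrightarrow> l \<ge> M \<Longrightarrow> u \<in> ball z r \<Longrightarrow> dist (f k u) (f l u) < e * r / 4"
      using e r unfolding uniformly_Cauchy_on_def by (metis divide_pos_pos mult_pos_pos zero_less_numeral)
    have "norm (D k w v - D l w v) \<le> e * norm v" if "k \<ge> M" "l \<ge> M" "w \<in> S" for k l w v
      using diff_D[OF that(3), of k l "e * r / 4" v] M[of "k + N" "l + N"] that r
      by (force simp: dist_norm less_imp_le)
    then show ?thesis by blast
  qed
  have conv: "\<exists>d. (\<lambda>k. D k w v) \<longlonglongrightarrow> d" if w: "w \<in> S" for w v
  proof -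
    have "Cauchy (\<lambda>k. D k w v)"
    proof (rule metric_CauchyI)
      fix e :: real assume e: "e > 0"
      define e' where "e' = e / (norm v + 1) / 2"
      have e': "e' > 0" "e' * norm v < e"
      proof -
        have v: "norm v + 1 > 0" "norm v < 2 * (norm v + 1)" by (smt (verit) norm_ge_zero)+
        show "e' > 0" using e v by (simp add: e'_def)
        have "e * norm v < e * (2 * (norm v + 1))" by (rule mult_strict_left_mono[OF v(2) e])
        then show "e' * norm v < e" unfolding e'_def
          using e v(1) by (simp add: field_simps)
      qed
      from Cauchy_unif[OF e'(1)] obtain M where
        "\<And>k l. k \<ge> M \<Longrightarrow> l \<ge> M \<Longrightarrow> norm (D k w v - D l w v) \<le> e' * norm v" using w by blast
      with e'(2) show "\<exists>M. \<forall>k\<ge>M. \<forall>l\<ge>M. dist (D k w v) (D l w v) < e"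
        unfolding dist_norm by (meson le_less_trans)
    qed
    then show ?thesis by (simp add: convergent_eq_Cauchy)
  qed
  define D' where "D' = (\<lambda>w v. lim (\<lambda>k. D k w v))"
  have D': "(\<lambda>k. D k w v) \<longlonglongrightarrow> D' w v" if "w \<in> S" for w v
    unfolding D'_def using conv[OF that] by (metis limI)
  have zS: "z \<in> S" using r by (simp add: S_def)
  have limS: "(\<lambda>k. f (k + N) w) \<longlonglongrightarrow> H w" if "w \<in> S" for w
    using that SB by (intro LIMSEQ_ignore_initial_segment tendsto_uniform_limitI[OF lim]) auto
  have "\<exists>g. \<forall>w\<in>S. (\<lambda>k. f (k + N) w) \<longlonglongrightarrow> g w \<and> (g has_derivative D' w) (at w within S)"
  proof (rule has_derivative_sequence)
    show "convex S" by (simp add: S_def)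
    show "(f (k + N) has_derivative D k w) (at w within S)" if "w \<in> S" for k w
      using D[OF that] by (auto simp: complex_deriv_def intro: has_derivative_at_withinI)
    show "\<forall>\<^sub>F k in sequentially. \<forall>w\<in>S. \<forall>v. norm (D k w v - D' w v) \<le> e * norm v" if e: "e > 0" for e
    proof -
      from Cauchy_unif[OF e] obtain M where
        M: "\<And>k l w v. k \<ge> M \<Longrightarrow> l \<ge> M \<Longrightarrow> w \<in> S \<Longrightarrow> norm (D k w v - D l w v) \<le> e * norm v" by blast
      have "norm (D k w v - D' w v) \<le> e * norm v" if "k \<ge> M" "w \<in> S" for k w v
      proof (rule LIMSEQ_le_const2)
        show "(\<lambda>l. norm (D k w v - D l w v)) \<longlonglongrightarrow> norm (D k w v - D' w v)"
          by (intro tendsto_intros D' that)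
      qed (use M that in blast)
      then show ?thesis by (auto simp: eventually_sequentially)
    qed
  qed (use zS limS in auto)
  then obtain g where g: "\<And>w. w \<in> S \<Longrightarrow> (\<lambda>k. f (k + N) w) \<longlonglongrightarrow> g w"
    "\<And>w. w \<in> S \<Longrightarrow> (g has_derivative D' w) (at w within S)" by blast
  have oS: "open S" by (simp add: S_def)
  have gH: "g w = H w" if "w \<in> S" for w by (rule LIMSEQ_unique[OF g(1)[OF that] limS[OF that]])
  have "(g has_derivative D' z) (at z)" using g(2)[OF zS] unfolding at_within_open[OF zS oS] .
  then have "(H has_derivative D' z) (at z)"
    by (rule has_derivative_transform_within_open[of _ _ _ _ S]) (use zS gH in \<open>auto simp: S_def\<close>)
  moreover have "D' z (c *s v) = c * D' z v" for c v
  proof (rule LIMSEQ_unique[OF D'[OF zS]])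
    show "(\<lambda>k. D k z (c *s v)) \<longlonglongrightarrow> c * D' z v"
      using D[OF zS] tendsto_mult_left[OF D'[OF zS], of c v] by (simp add: complex_deriv_def)
  qed
  ultimately show ?thesis by (auto simp: complex_deriv_def)
qed

subsection \<open>Montel's theorem\<close>

text \<open>The Lipschitz constant depends on the bound and the radius only, which makes locally bounded
  families equicontinuous.\<close>

lemma locally_bounded_equi_Lipschitz:
  assumes f: "holo_on (ball z r) f" and M: "\<And>w. w \<in> ball z r \<Longrightarrow> norm (f w) \<le> M"
    and w: "w \<in> ball z (r/2)" "w' \<in> ball z (r/2)"
  shows "norm (f w - f w') \<le> 4 * M / r * norm (w - w')"
proof -
  have r: "r > 0" using w(1) by (smt (verit) dist_nz field_sum_of_halves mem_ball zero_le_dist)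
  have S: "ball u (r/2) \<subseteq> ball z r" if "u \<in> ball z (r/2)" for u
    using that unfolding subset_iff mem_ball by (smt (verit) dist_triangle field_sum_of_halves)
  have M0: "M \<ge> 0" using M[of z] r by (smt (verit) centre_in_ball norm_ge_zero)
  show ?thesis
  proof (rule differentiable_bound[OF convex_ball _ _ w, where f'="\<lambda>u. frechet_derivative f (at u)"])
    fix u assume u: "u \<in> ball z (r/2)"
    then have u': "u \<in> ball z r" using r by auto
    have cd: "complex_deriv f u (frechet_derivative f (at u))"
      by (rule complex_deriv_frechet[OF f u'])
    then show "(f has_derivative frechet_derivative f (at u)) (at u within ball z (r/2))"
      by (auto simp: complex_deriv_def intro: has_derivative_at_withinI)
    show "onorm (frechet_derivative f (at u)) \<le> 4 * M / r"
    proof (rule onorm_bound)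
      fix v
      have "norm (frechet_derivative f (at u) v) \<le> 2 * M / (r/2) * norm v"
        by (rule several_Cauchy_estimate[OF holo_on_subset[OF f S[OF u]] _ _ cd]) (use M S[OF u] r in auto)
      then show "norm (frechet_derivative f (at u) v) \<le> 4 * M / r * norm v" by simp
    qed (use M0 r in simp)
  qed
qed

text \<open>Near each point the functions only need to be holomorphic from some index on; mollifications,
  which are holomorphic away from the boundary, satisfy no more. A diagonal argument gives
  convergence on a countable dense set, and equicontinuity makes it locally uniform.\<close>

theorem Montel_several:
  fixes f :: "nat \<Rightarrow> complex^'n::finite \<Rightarrow> complex"
  assumes bd: "\<And>z. z \<in> \<Omega> \<Longrightarrow> \<exists>r>0. \<exists>M N. ball z r \<subseteq> \<Omega> \<and>
      (\<forall>k\<ge>N. holo_on (ball z r) (f k) \<and> (\<forall>w\<in>ball z r. norm (f k w) \<le> M))"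
  obtains s H where "strict_mono (s :: nat \<Rightarrow> nat)" "holo_on \<Omega> H"
    "locally_uniform_limit \<Omega> (\<lambda>k. f (s k)) H"
proof -
  obtain D where D: "countable D" "D \<subseteq> \<Omega>" "\<Omega> \<subseteq> closure D" by (metis separable)
  have "\<exists>B>0. \<forall>k. norm (f k x) \<le> B" if "x \<in> \<Omega>" for x
  proof -
    obtain r M N where "r > 0" "\<forall>k\<ge>N. holo_on (ball x r) (f k) \<and> (\<forall>w\<in>ball x r. norm (f k w) \<le> M)"
      using bd[OF \<open>x \<in> \<Omega>\<close>] by blast
    then have "\<And>k. k \<ge> N \<Longrightarrow> norm (f k x) \<le> M" by simp
    then have "Bseq (\<lambda>k. f (k + N) x)" by (intro BseqI'[of _ M]) auto
    then have "Bseq (\<lambda>k. f k x)" by (rule Bseq_offset)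
    then show ?thesis by (simp add: Bseq_def)
  qed
  then obtain B where B: "\<And>x. x \<in> \<Omega> \<Longrightarrow> B x > 0" "\<And>x k. x \<in> \<Omega> \<Longrightarrow> norm (f k x) \<le> B x" by metis
  \<comment> \<open>The pointwise bounds are not uniform over the dense set, so the values are normalized first.\<close>
  have normalized: "norm (f k x / of_real (B x)) \<le> 1" if "x \<in> D" for k x
    using B[of x] D(2) that by (auto simp: norm_divide divide_le_eq)
  obtain s where s: "strict_mono (s :: nat \<Rightarrow> nat)"
    and conv: "\<And>x. x \<in> D \<Longrightarrow> \<exists>l. (\<lambda>k. f (s k) x / of_real (B x)) \<longlonglongrightarrow> l"
    by (rule function_convergent_subsequence[OF D(1), of "\<lambda>k x. f k x / of_real (B x)" 1]) (use normalized in auto)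
  have Cauchy_D: "Cauchy (\<lambda>k. f (s k) x)" if x: "x \<in> D" for x
  proof -
    obtain l where "(\<lambda>k. f (s k) x / of_real (B x)) \<longlonglongrightarrow> l" using conv[OF x] by blast
    from tendsto_mult_right[OF this, of "of_real (B x)"] have "(\<lambda>k. f (s k) x) \<longlonglongrightarrow> l * of_real (B x)"
      using B(1)[of x] x D(2) by (auto simp: subset_iff)
    then show ?thesis by (rule LIMSEQ_imp_Cauchy)
  qed
  define H where "H = (\<lambda>z. lim (\<lambda>k. f (s k) z))"
  have local: "\<exists>r>0. \<exists>N. ball z r \<subseteq> \<Omega> \<and> (\<forall>k\<ge>N. holo_on (ball z r) (f (s k))) \<and>
      uniform_limit (ball z r) (\<lambda>k. f (s k)) H sequentially" if z: "z \<in> \<Omega>" for z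
  proof -
    obtain r M N where r: "r > 0" "ball z r \<subseteq> \<Omega>"
      and N: "\<And>k. k \<ge> N \<Longrightarrow> holo_on (ball z r) (f k)" "\<And>k w. k \<ge> N \<Longrightarrow> w \<in> ball z r \<Longrightarrow> norm (f k w) \<le> M"
      using bd[OF z] by metis
    define L where "L = \<bar>4 * M / r\<bar> + 1"
    have L: "L > 0" "4 * M / r \<le> L" unfolding L_def by linarith+
    have Lip: "norm (f k w - f k w') \<le> L * norm (w - w')"
      if "k \<ge> N" "w \<in> ball z (r/2)" "w' \<in> ball z (r/2)" for k w w'
    proof -
      have "norm (f k w - f k w') \<le> 4 * M / r * norm (w - w')"
        by (rule locally_bounded_equi_Lipschitz) (use N that in auto)
      also have "\<dots> \<le> L * norm (w - w')" using L(2) by (intro mult_right_mono) auto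
      finally show ?thesis .
    qed
    have "uniformly_Cauchy_on (ball z (r/4)) (\<lambda>k. f (s k))"
    proof (rule uniformly_Cauchy_onI)
      fix e :: real assume e: "e > 0"
      define d where "d = min (e / (3 * L)) (r/4)"
      have d: "d > 0" "L * d \<le> e / 3" "d \<le> r/4"
      proof -
        show "d > 0" "d \<le> r/4" using e L(1) r by (auto simp: d_def)
        have "L * d \<le> L * (e / (3 * L))" using L(1) by (intro mult_left_mono) (auto simp: d_def)
        then show "L * d \<le> e / 3" using L(1) by simp
      qed
      have "cball z (r/4) \<subseteq> (\<Union>x\<in>D \<inter> ball z (r/2). ball x d)"
      proof
        fix w assume w: "w \<in> cball z (r/4)"
        then have "w \<in> \<Omega>" using r by (auto simp: subset_iff)
        then have "w \<in> closure D" using D(3) by blast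
        then obtain x where x: "x \<in> D" "dist x w < d" using d(1) by (meson closure_approachable)
        have "dist z x < r/2" using w x(2) d(3) dist_triangle[of z x w] by (simp add: dist_commute)
        then show "w \<in> (\<Union>x\<in>D \<inter> ball z (r/2). ball x d)" using x by auto
      qed
      then obtain T where T: "T \<subseteq> D \<inter> ball z (r/2)" "finite T" "cball z (r/4) \<subseteq> (\<Union>x\<in>T. ball x d)"
        by (rule compactE_image[OF compact_cball, rotated]) auto
      have "\<exists>K. \<forall>k\<ge>K. \<forall>l\<ge>K. dist (f (s k) x) (f (s l) x) < e / 3" if "x \<in> T" for x
        using Cauchy_D[of x] T(1) that e unfolding Cauchy_def by (metis Int_iff subsetD divide_pos_pos zero_less_numeral)
      then obtain K where K: "\<And>x k l. x \<in> T \<Longrightarrow> k \<ge> K x \<Longrightarrow> l \<ge> K x \<Longrightarrow> dist (f (s k) x) (f (s l) x) < e / 3"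
        by metis
      define m where "m = Max (insert N (K ` T))"
      have m: "m \<ge> N" "\<And>x. x \<in> T \<Longrightarrow> m \<ge> K x" using T(2) by (auto simp: m_def)
      have "dist (f (s k) w) (f (s l) w) < e" if w: "w \<in> ball z (r/4)" and kl: "k \<ge> m" "l \<ge> m" for w k l
      proof -
        obtain x where x: "x \<in> T" "dist x w < d" using T(3) w by (force simp: subset_iff)
        have in_ball: "w \<in> ball z (r/2)" "x \<in> ball z (r/2)" using w x(1) T(1) r by (auto simp: subset_iff)
        have sN: "s k \<ge> N" "s l \<ge> N"
          using kl m(1) seq_suble[OF s, of k] seq_suble[OF s, of l] by linarith+
        have near: "norm (f (s k') w - f (s k') x) \<le> e / 3" if "s k' \<ge> N" for k'
        proof -
          have "norm (f (s k') w - f (s k') x) \<le> L * norm (w - x)" by (rule Lip[OF that in_ball])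
          also have "\<dots> \<le> L * d" using x(2) L(1) by (intro mult_left_mono) (auto simp: dist_norm norm_minus_commute)
          finally show ?thesis using d(2) by simp
        qed
        have "dist (f (s k) x) (f (s l) x) < e / 3"
          using K[OF x(1)] m(2)[OF x(1)] kl by auto
        moreover have "dist (f (s k) w) (f (s k) x) \<le> e / 3" "dist (f (s l) w) (f (s l) x) \<le> e / 3"
          using near[OF sN(1)] near[OF sN(2)] by (simp_all add: dist_norm)
        moreover have "dist (f (s k) w) (f (s l) w) \<le> dist (f (s k) w) (f (s k) x) + dist (f (s k) x) (f (s l) w)"
          "dist (f (s k) x) (f (s l) w) \<le> dist (f (s k) x) (f (s l) x) + dist (f (s l) w) (f (s l) x)"
          by (rule dist_triangle, rule dist_triangle2)
        ultimately show ?thesis by linarith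
      qed
      then show "\<exists>M. \<forall>w\<in>ball z (r/4). \<forall>k\<ge>M. \<forall>l\<ge>M. dist (f (s k) w) (f (s l) w) < e" by blast
    qed
    then have "uniform_limit (ball z (r/4)) (\<lambda>k. f (s k)) H sequentially"
      unfolding H_def using Cauchy_uniformly_convergent uniformly_convergent_uniform_limit_iff by blast
    moreover have sub: "ball z (r/4) \<subseteq> ball z r" using r by (intro subset_ball) simp
    have "holo_on (ball z (r/4)) (f (s k))" if "k \<ge> N" for k
    proof -
      have "s k \<ge> N" using that seq_suble[OF s, of k] by linarith
      from holo_on_subset[OF N(1)[OF this] sub] show ?thesis .
    qed
    moreover have "ball z (r/4) \<subseteq> \<Omega>" "r/4 > 0" using sub r by auto
    ultimately show ?thesis by blast
  qed
  show ?thesis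
  proof (rule that[OF s])
    show "holo_on \<Omega> H" unfolding holo_on_iff
    proof
      fix z assume "z \<in> \<Omega>"
      from local[OF this] obtain r N where "r > 0" "\<And>k. k \<ge> N \<Longrightarrow> holo_on (ball z r) (f (s k))"
        "uniform_limit (ball z r) (\<lambda>k. f (s k)) H sequentially" by blast
      then show "\<exists>D. complex_deriv H z D" by (intro uniform_limit_complex_deriv) auto
    qed
    show "locally_uniform_limit \<Omega> (\<lambda>k. f (s k)) H"
      unfolding locally_uniform_limit_def using local by blast
  qed
qed

lemma locally_uniform_limit_pointwise:
  assumes "locally_uniform_limit \<Omega> f H" "z \<in> \<Omega>"
  shows "(\<lambda>k. f k z) \<longlonglongrightarrow> H z"
proof -
  obtain r where "r > 0" "uniform_limit (ball z r) f H sequentially"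
    using assms unfolding locally_uniform_limit_def by blast
  then show ?thesis by (intro tendsto_uniform_limitI) auto
qed

corollary Montel_L1:
  fixes f :: "nat \<Rightarrow> complex^'n::finite \<Rightarrow> complex"
  assumes \<Omega>: "open \<Omega>" and hol: "\<And>k. holo_on \<Omega> (f k)"
    and int: "\<And>k. integrable (lebesgue_on \<Omega>) (\<lambda>z. norm (f k z))"
    and B: "\<And>k. integral\<^sup>L (lebesgue_on \<Omega>) (\<lambda>z. norm (f k z)) \<le> B"
  obtains s H where "strict_mono (s :: nat \<Rightarrow> nat)" "holo_on \<Omega> H"
    "locally_uniform_limit \<Omega> (\<lambda>k. f (s k)) H"
proof (rule Montel_several[of \<Omega> f])
  fix z assume "z \<in> \<Omega>"
  then obtain r where r: "r > 0" "ball z r \<subseteq> \<Omega>" using \<Omega> open_contains_ball by blast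
  define m where "m = measure lborel (ball (0::complex^'n) (r/2))"
  have m: "m > 0" unfolding m_def using content_ball_pos[of "r/2" 0] r by simp
  have "norm (f k w) \<le> B / m" if w: "w \<in> ball z (r/2)" for k w
  proof -
    have "ball w (r/2) \<subseteq> ball z r"
      using w unfolding subset_iff mem_ball by (smt (verit) dist_triangle field_sum_of_halves)
    then have "norm (f k w) \<le> integral\<^sup>L (lebesgue_on \<Omega>) (\<lambda>z. norm (f k z)) / m"
      unfolding m_def using r by (intro holo_bound_by_L1[OF \<Omega> hol int]) auto
    also have "\<dots> \<le> B / m" using B m by (intro divide_right_mono) auto
    finally show ?thesis .
  qed
  moreover have sub: "ball z (r/2) \<subseteq> \<Omega>"
    using r(1) by (intro order.trans[OF subset_ball r(2)]) simp
  moreover have "holo_on (ball z (r/2)) (f k)" for k by (rule holo_on_subset[OF hol sub])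
  moreover have "r/2 > 0" using r(1) by simp
  ultimately show "\<exists>r>0. \<exists>M N. ball z r \<subseteq> \<Omega> \<and>
      (\<forall>k\<ge>N. holo_on (ball z r) (f k) \<and> (\<forall>w\<in>ball z r. norm (f k w) \<le> M))"
    by blast
qed (rule that)

section \<open>The Bergman projection\<close>

locale bounded_open_set =
  fixes \<Omega> :: "(complex^'n::finite) set"
  assumes open_\<Omega>: "open \<Omega>" and bounded_\<Omega>: "bounded \<Omega>" and nonempty_\<Omega>: "\<Omega> \<noteq> {}"
begin

definition vol :: real where "vol = measure lebesgue \<Omega>"

lemma lmeasurable_\<Omega>: "\<Omega> \<in> lmeasurable"
  by (rule lmeasurable_open[OF bounded_\<Omega> open_\<Omega>])

lemma sets_\<Omega> [simp]: "\<Omega> \<in> sets lebesgue"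
  using lmeasurable_\<Omega> by (rule fmeasurableD)

lemma vol_pos: "vol > 0"
proof -
  have "\<not> negligible \<Omega>" using open_not_negligible[OF open_\<Omega> nonempty_\<Omega>] .
  then show ?thesis
    unfolding vol_def using lmeasurable_\<Omega> negligible_iff_measure0 zero_less_measure_iff by blast
qed

lemma integrable_const_\<Omega> [simp]: "integrable (lebesgue_on \<Omega>) (\<lambda>z. c :: real)"
  and integral_const_\<Omega>: "integral\<^sup>L (lebesgue_on \<Omega>) (\<lambda>z. c :: real) = c * vol"
proof -
  have "emeasure (lebesgue_on \<Omega>) (space (lebesgue_on \<Omega>)) < \<infinity>"
    using lmeasurable_\<Omega> by (simp add: emeasure_restrict_space fmeasurableD fmeasurableD2 less_top[symmetric]
        del: emeasure_completion)
  then show "integrable (lebesgue_on \<Omega>) (\<lambda>z. c)"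
    by (intro finite_measure.integrable_const finite_measureI) auto
  show "integral\<^sup>L (lebesgue_on \<Omega>) (\<lambda>z. c) = c * vol"
    by (simp add: vol_def measure_restrict_space)
qed

lemma AE_false_\<Omega>: "\<not> (AE z in lebesgue_on \<Omega>. False)"
proof
  assume "AE z in lebesgue_on \<Omega>. False"
  then have "space (lebesgue_on \<Omega>) \<in> null_sets (lebesgue_on \<Omega>)"
    by (subst AE_iff_null_sets) (auto elim: eventually_mono)
  then have "emeasure (lebesgue_on \<Omega>) (space (lebesgue_on \<Omega>)) = 0" by (rule null_setsD1)
  then have "measure lebesgue \<Omega> = 0"
    by (simp add: emeasure_restrict_space measure_def del: emeasure_completion)
  then show False using vol_pos by (simp add: vol_def)
qed

text \<open>The exceptional set is relatively open, and a nonempty open set has positive measure.\<close>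

lemma AE_imp_everywhere:
  fixes f :: "complex^'n \<Rightarrow> 'b::topological_space"
  assumes ae: "AE z in lebesgue_on \<Omega>. f z \<in> C" and cont: "continuous_on \<Omega> f" and C: "closed C"
    and z: "z \<in> \<Omega>"
  shows "f z \<in> C"
proof -
  define U where "U = \<Omega> \<inter> f -` (- C)"
  have U: "open U" unfolding U_def
    by (rule continuous_open_preimage[OF cont open_\<Omega>]) (use C in auto)
  have "AE z in lebesgue. z \<in> \<Omega> \<longrightarrow> f z \<in> C"
    using ae by (simp add: AE_restrict_space_iff)
  then obtain N where N: "{z. \<not> (z \<in> \<Omega> \<longrightarrow> f z \<in> C)} \<subseteq> N" "N \<in> null_sets lebesgue"
    by (auto simp: eventually_ae_filter)
  have "negligible N" using N(2) by (simp add: negligible_iff_null_sets)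
  then have "negligible U" by (rule negligible_subset) (use N(1) in \<open>auto simp: U_def\<close>)
  with U have "U = {}" using open_not_negligible by blast
  then show ?thesis using z by (auto simp: U_def)
qed

lemma Lp_L1:
  assumes p: "p \<ge> 1" and f: "f \<in> Lp \<Omega> p"
  shows "integrable (lebesgue_on \<Omega>) (\<lambda>z. norm (f z))" "integrable (lebesgue_on \<Omega>) f"
    "integral\<^sup>L (lebesgue_on \<Omega>) (\<lambda>z. norm (f z)) \<le> vol powr (1 - 1/p) * Lp_norm \<Omega> p f"
proof -
  note pm = Lp_power_mean[OF lmeasurable_\<Omega> vol_pos[unfolded vol_def] _ p f, folded vol_def]
  have f1: "f \<in> Lp \<Omega> 1" using pm(1) by simp
  show i: "integrable (lebesgue_on \<Omega>) (\<lambda>z. norm (f z))"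
    using Lp_integrable[OF f1] by simp
  then show "integrable (lebesgue_on \<Omega>) f"
    using Lp_measurable[OF f] by (simp add: integrable_norm_iff)
  have n1: "Lp_norm \<Omega> 1 f = integral\<^sup>L (lebesgue_on \<Omega>) (\<lambda>z. norm (f z))"
    by (simp add: Lp_norm_def)
  have "vol powr (-1) * Lp_norm \<Omega> 1 f \<le> vol powr (- (1/p)) * Lp_norm \<Omega> p f"
    using pm(2) by simp
  then have "vol * (vol powr (-1) * Lp_norm \<Omega> 1 f) \<le> vol * (vol powr (- (1/p)) * Lp_norm \<Omega> p f)"
    using vol_pos by (intro mult_left_mono) auto
  moreover have "vol * vol powr (-1) = 1" "vol * vol powr (- (1/p)) = vol powr (1 - 1/p)"
    using vol_pos powr_mult_base[of vol "-1"] powr_mult_base[of vol "-(1/p)"] by auto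
  ultimately show "integral\<^sup>L (lebesgue_on \<Omega>) (\<lambda>z. norm (f z)) \<le> vol powr (1 - 1/p) * Lp_norm \<Omega> p f"
    unfolding n1 by (simp add: mult.assoc[symmetric])
qed

subsection \<open>Best approximation\<close>

lemma Ap_Lp: "h \<in> Ap \<Omega> p \<Longrightarrow> h \<in> Lp \<Omega> p" and Ap_holo: "h \<in> Ap \<Omega> p \<Longrightarrow> holo_on \<Omega> h"
  by (auto simp: Ap_def)

lemma Ap_zero: "(\<lambda>z. 0) \<in> Ap \<Omega> p"
  by (simp add: Ap_def holo_on_const)

lemma Ap_midpoint:
  assumes "p > 0" "h \<in> Ap \<Omega> p" "k \<in> Ap \<Omega> p"
  shows "(\<lambda>z. (1/2) * (h z + k z)) \<in> Ap \<Omega> p"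
  using Lp_cmult[OF Lp_add[OF assms(1) Ap_Lp[OF assms(2)] Ap_Lp[OF assms(3)]], of "1/2"]
    holo_on_mult[OF holo_on_const[of \<Omega> "1/2"] holo_on_add[OF Ap_holo[OF assms(2)] Ap_holo[OF assms(3)]]]
  unfolding Ap_def by blast

lemma Ap_dist_le: "h \<in> Ap \<Omega> p \<Longrightarrow> Ap_dist \<Omega> p f \<le> Lp_norm \<Omega> p (\<lambda>z. f z - h z)"
  unfolding Ap_dist_def by (rule cINF_lower) (auto intro!: bdd_belowI2[where m=0])

lemma Ap_dist_greatest: "(\<And>h. h \<in> Ap \<Omega> p \<Longrightarrow> c \<le> Lp_norm \<Omega> p (\<lambda>z. f z - h z)) \<Longrightarrow> c \<le> Ap_dist \<Omega> p f"
  unfolding Ap_dist_def by (rule cINF_greatest) (use Ap_zero in auto)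

lemma Ap_dist_nonneg: "Ap_dist \<Omega> p f \<ge> 0"
  by (rule Ap_dist_greatest) simp

lemma Ap_dist_le_norm: "Ap_dist \<Omega> p f \<le> Lp_norm \<Omega> p f"
  using Ap_dist_le[OF Ap_zero, of p f] by simp

text \<open>A minimizing sequence is bounded in \<open>L^1\<close>, hence has a locally uniformly convergent
  subsequence by Montel's theorem, and by Fatou's lemma its limit is a best approximation.\<close>

lemma best_approximation_exists:
  assumes p: "p \<ge> 1" and f: "f \<in> Lp \<Omega> p"
  shows "\<exists>h\<in>Ap \<Omega> p. Lp_norm \<Omega> p (\<lambda>z. f z - h z) \<le> Ap_dist \<Omega> p f"
proof -
  define d where "d = Ap_dist \<Omega> p f"
  have p0: "p > 0" using p by simp
  have "\<exists>h\<in>Ap \<Omega> p. Lp_norm \<Omega> p (\<lambda>z. f z - h z) < d + 1 / real (Suc k)" for k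
  proof (rule ccontr)
    assume "\<not> ?thesis"
    then have "d + 1 / real (Suc k) \<le> d"
      unfolding d_def by (intro Ap_dist_greatest) (auto simp: not_less d_def)
    then show False by (simp add: not_le)
  qed
  then obtain h where h: "\<And>k. h k \<in> Ap \<Omega> p" "\<And>k. Lp_norm \<Omega> p (\<lambda>z. f z - h k z) < d + 1 / real (Suc k)"
    by metis
  have hL: "h k \<in> Lp \<Omega> p" for k using h(1) by (rule Ap_Lp)
  define B where "B = vol powr (1 - 1/p) * (d + 1 + Lp_norm \<Omega> p f)"
  have L1: "integral\<^sup>L (lebesgue_on \<Omega>) (\<lambda>z. norm (h k z)) \<le> B" for k
  proof -
    have "Lp_norm \<Omega> p (h k) \<le> Lp_norm \<Omega> p (\<lambda>z. h k z - f z) + Lp_norm \<Omega> p f"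
      by (rule Lp_norm_triangle[OF p hL f])
    also have "Lp_norm \<Omega> p (\<lambda>z. h k z - f z) = Lp_norm \<Omega> p (\<lambda>z. f z - h k z)"
      by (rule Lp_norm_minus_commute)
    also have "\<dots> \<le> d + 1"
      using less_imp_le[OF h(2)[of k]] by (rule order.trans) simp
    finally have "Lp_norm \<Omega> p (h k) \<le> d + 1 + Lp_norm \<Omega> p f" by simp
    then have "vol powr (1 - 1/p) * Lp_norm \<Omega> p (h k) \<le> B"
      unfolding B_def by (intro mult_left_mono) auto
    with Lp_L1(3)[OF p hL[of k]] show ?thesis by (rule order.trans)
  qed
  obtain s H where s: "strict_mono (s :: nat \<Rightarrow> nat)" and H: "holo_on \<Omega> H"
    and lim: "locally_uniform_limit \<Omega> (\<lambda>k. h (s k)) H"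
    by (rule Montel_L1[OF open_\<Omega> Ap_holo[OF h(1)] Lp_L1(1)[OF p hL] L1])
  have B: "(\<lambda>k. d + 1 / real (Suc (s k))) \<longlonglongrightarrow> d"
  proof -
    have "(\<lambda>k. 1 / real (Suc k)) \<longlonglongrightarrow> 0" using LIMSEQ_inverse_real_of_nat by (simp add: divide_inverse)
    from LIMSEQ_subseq_LIMSEQ[OF this s] have "(\<lambda>k. 1 / real (Suc (s k))) \<longlonglongrightarrow> 0" by (simp add: o_def)
    from tendsto_add[OF tendsto_const this, of d] show ?thesis by simp
  qed
  have ptw: "(\<lambda>k. f z - h (s k) z) \<longlonglongrightarrow> f z - H z" if "z \<in> \<Omega>" for z
    by (intro tendsto_diff tendsto_const locally_uniform_limit_pointwise[OF lim that])
  have bd: "Lp_norm \<Omega> p (\<lambda>z. f z - h (s k) z) \<le> d + 1 / real (Suc (s k))" for k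
    by (rule less_imp_le[OF h(2)])
  note fat = Lp_Fatou[where u="\<lambda>k z. f z - h (s k) z", OF p0 Lp_diff[OF p0 f hL] ptw bd B]
  have "H \<in> Lp \<Omega> p" using Lp_diff[OF p0 f fat(1)] by simp
  then show ?thesis using H fat(2) unfolding d_def by (auto simp: Ap_def)
qed

text \<open>The modulus of uniform convexity in the form in which the estimate for the projection needs
  it: the exponent is \<open>1/p\<close> for \<open>p > 2\<close> and \<open>1/2\<close> for \<open>p \<le> 2\<close>.\<close>

definition convexity_const :: "real \<Rightarrow> real \<Rightarrow> bool" where
  "convexity_const p C \<longleftrightarrow> (\<forall>u\<in>Lp \<Omega> p. \<forall>v\<in>Lp \<Omega> p. \<forall>d\<ge>0. \<forall>\<delta>\<ge>0.
     Lp_norm \<Omega> p u \<le> d + 2 * \<delta> \<longrightarrow> Lp_norm \<Omega> p v \<le> d + 2 * \<delta> \<longrightarrow>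
     d \<le> Lp_norm \<Omega> p (\<lambda>z. (1/2) *\<^sub>R (u z + v z)) \<longrightarrow>
     Lp_norm \<Omega> p (\<lambda>z. u z - v z) \<le> (if 2 < p then C * (d + 2 * \<delta>) powr (1 - 1/p) * \<delta> powr (1/p)
                                           else C * (d + 2 * \<delta>) powr (1/2) * \<delta> powr (1/2)))"

lemma convexity_constD:
  "\<lbrakk>convexity_const p C; u \<in> Lp \<Omega> p; v \<in> Lp \<Omega> p; d \<ge> 0; \<delta> \<ge> 0; Lp_norm \<Omega> p u \<le> d + 2 * \<delta>;
    Lp_norm \<Omega> p v \<le> d + 2 * \<delta>; d \<le> Lp_norm \<Omega> p (\<lambda>z. (1/2) *\<^sub>R (u z + v z))\<rbrakk> \<Longrightarrow>
    Lp_norm \<Omega> p (\<lambda>z. u z - v z) \<le> (if 2 < p then C * (d + 2 * \<delta>) powr (1 - 1/p) * \<delta> powr (1/p)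
                                           else C * (d + 2 * \<delta>) powr (1/2) * \<delta> powr (1/2))"
  unfolding convexity_const_def by blast

lemma convexity_const_exists:
  assumes p: "p > 1"
  shows "\<exists>C>0. convexity_const p C"
proof (cases "p < 2")
  case True
  have "convexity_const p (2 * (4 / (p - 1)) powr (1/2) * 2 powr (1 - p/2))"
    unfolding convexity_const_def
  proof (intro ballI allI impI)
    fix u v d \<delta>
    assume "u \<in> Lp \<Omega> p" "v \<in> Lp \<Omega> p" "d \<ge> 0" "\<delta> \<ge> 0" "Lp_norm \<Omega> p u \<le> d + 2 * \<delta>" "Lp_norm \<Omega> p v \<le> d + 2 * \<delta>"
       "d \<le> Lp_norm \<Omega> p (\<lambda>z. (1/2) *\<^sub>R (u z + v z))"
    from Lp_midpoint_gap_less_2[OF p True this] True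
    show "Lp_norm \<Omega> p (\<lambda>z. u z - v z) \<le> (if 2 < p
        then 2 * (4 / (p - 1)) powr (1/2) * 2 powr (1 - p/2) * (d + 2 * \<delta>) powr (1 - 1/p) * \<delta> powr (1/p)
        else 2 * (4 / (p - 1)) powr (1/2) * 2 powr (1 - p/2) * (d + 2 * \<delta>) powr (1/2) * \<delta> powr (1/2))"
      by simp
  qed
  then show ?thesis using p by (intro exI[of _ "2 * (4 / (p - 1)) powr (1/2) * 2 powr (1 - p/2)"]) auto
next
  case False
  then have p2: "p \<ge> 2" by simp
  have half: "1/p = 1/2" "1 - 1/p = 1/2" if "\<not> 2 < p"
  proof -
    have "p = 2" using that False by simp
    then show "1/p = 1/2" "1 - 1/p = 1/2" by simp_all
  qed
  have "convexity_const p (2 * (2 * p) powr (1/p))"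
    unfolding convexity_const_def
  proof (intro ballI allI impI)
    fix u v d \<delta>
    assume "u \<in> Lp \<Omega> p" "v \<in> Lp \<Omega> p" "d \<ge> 0" "\<delta> \<ge> 0" "Lp_norm \<Omega> p u \<le> d + 2 * \<delta>" "Lp_norm \<Omega> p v \<le> d + 2 * \<delta>"
       "d \<le> Lp_norm \<Omega> p (\<lambda>z. (1/2) *\<^sub>R (u z + v z))"
    note * = Lp_midpoint_gap_ge_2[OF p2 this]
    show "Lp_norm \<Omega> p (\<lambda>z. u z - v z) \<le> (if 2 < p then 2 * (2 * p) powr (1/p) * (d + 2 * \<delta>) powr (1 - 1/p) * \<delta> powr (1/p)
                                           else 2 * (2 * p) powr (1/p) * (d + 2 * \<delta>) powr (1/2) * \<delta> powr (1/2))"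
      using * half by (cases "2 < p") auto
  qed
  then show ?thesis using p2 by (intro exI[of _ "2 * (2 * p) powr (1/p)"]) auto
qed

text \<open>The midpoint of two best approximations is again a competitor, so the convexity estimate
  applies with \<open>\<delta> = 0\<close>.\<close>

lemma best_approximation_unique:
  assumes p: "p > 1" and f: "f \<in> Lp \<Omega> p" and h: "h \<in> Ap \<Omega> p" and k: "k \<in> Ap \<Omega> p"
    and hd: "Lp_norm \<Omega> p (\<lambda>z. f z - h z) \<le> Ap_dist \<Omega> p f" and kd: "Lp_norm \<Omega> p (\<lambda>z. f z - k z) \<le> Ap_dist \<Omega> p f"
    and z: "z \<in> \<Omega>"
  shows "h z = k z"
proof -
  have p0: "p > 0" using p by simp
  obtain C where C: "convexity_const p C" using convexity_const_exists[OF p] by blast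
  have mid: "(\<lambda>z. (1/2) *\<^sub>R ((f z - h z) + (f z - k z))) = (\<lambda>z. f z - (1/2) * (h z + k z))"
    by (auto simp: scaleR_conv_of_real field_simps)
  have "Lp_norm \<Omega> p (\<lambda>z. (f z - h z) - (f z - k z)) \<le> (if 2 < p
      then C * (Ap_dist \<Omega> p f + 2 * 0) powr (1 - 1/p) * 0 powr (1/p)
      else C * (Ap_dist \<Omega> p f + 2 * 0) powr (1/2) * 0 powr (1/2))"
  proof (rule convexity_constD[OF C])
    show "Ap_dist \<Omega> p f \<le> Lp_norm \<Omega> p (\<lambda>z. (1/2) *\<^sub>R ((f z - h z) + (f z - k z)))"
      unfolding mid by (rule Ap_dist_le[OF Ap_midpoint[OF p0 h k]])
  qed (use Lp_diff[OF p0 f Ap_Lp] h k hd kd Ap_dist_nonneg in auto)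
  then have "Lp_norm \<Omega> p (\<lambda>z. k z - h z) \<le> 0" by (simp split: if_splits)
  then have n0: "Lp_norm \<Omega> p (\<lambda>z. k z - h z) = 0" using Lp_norm_nonneg[of \<Omega> p "\<lambda>z. k z - h z"] by linarith
  have "AE z in lebesgue_on \<Omega>. k z - h z \<in> {0}"
    using Lp_norm_eq_0_AE[OF Lp_diff[OF p0 Ap_Lp[OF k] Ap_Lp[OF h]] n0] by simp
  then have "k z - h z \<in> {0}"
    by (rule AE_imp_everywhere) (use z holo_on_imp_continuous_on[OF Ap_holo] h k in \<open>auto intro!: continuous_on_diff\<close>)
  then show ?thesis by simp
qed

lemma bergman_proj:
  assumes p: "p > 1" and f: "f \<in> Lp \<Omega> p"
  shows "bergman_proj \<Omega> p f \<in> Ap \<Omega> p"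
    and "Lp_norm \<Omega> p (\<lambda>z. f z - bergman_proj \<Omega> p f z) = Ap_dist \<Omega> p f"
proof -
  have "\<exists>!h. h \<in> Ap \<Omega> p \<and> (\<forall>z. z \<notin> \<Omega> \<longrightarrow> h z = 0) \<and> Lp_norm \<Omega> p (\<lambda>z. f z - h z) = Ap_dist \<Omega> p f"
  proof (rule ex_ex1I)
    obtain h where h: "h \<in> Ap \<Omega> p" "Lp_norm \<Omega> p (\<lambda>z. f z - h z) \<le> Ap_dist \<Omega> p f"
      using best_approximation_exists[OF _ f] p by auto
    define h0 where "h0 = (\<lambda>z. if z \<in> \<Omega> then h z else 0)"
    have eq: "h z = h0 z" if "z \<in> \<Omega>" for z using that by (simp add: h0_def)
    have "h0 \<in> Ap \<Omega> p"
      using h(1) Lp_cong(1)[of \<Omega> h h0 p, OF eq] holo_on_cong_open[OF open_\<Omega> eq] by (auto simp: Ap_def)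
    moreover have "Lp_norm \<Omega> p (\<lambda>z. f z - h0 z) = Lp_norm \<Omega> p (\<lambda>z. f z - h z)"
      by (rule Lp_cong(2)) (simp add: h0_def)
    ultimately show "\<exists>h. h \<in> Ap \<Omega> p \<and> (\<forall>z. z \<notin> \<Omega> \<longrightarrow> h z = 0) \<and> Lp_norm \<Omega> p (\<lambda>z. f z - h z) = Ap_dist \<Omega> p f"
      using h(2) Ap_dist_le[of h0 p f] by (intro exI[of _ h0]) (auto simp: h0_def)
  next
    fix h k
    assume h: "h \<in> Ap \<Omega> p \<and> (\<forall>z. z \<notin> \<Omega> \<longrightarrow> h z = 0) \<and> Lp_norm \<Omega> p (\<lambda>z. f z - h z) = Ap_dist \<Omega> p f"
      and k: "k \<in> Ap \<Omega> p \<and> (\<forall>z. z \<notin> \<Omega> \<longrightarrow> k z = 0) \<and> Lp_norm \<Omega> p (\<lambda>z. f z - k z) = Ap_dist \<Omega> p f"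
    show "h = k"
    proof
      fix z show "h z = k z"
        using best_approximation_unique[OF p f, of h k z] h k by (cases "z \<in> \<Omega>") auto
    qed
  qed
  from theI'[OF this] show "bergman_proj \<Omega> p f \<in> Ap \<Omega> p"
    and "Lp_norm \<Omega> p (\<lambda>z. f z - bergman_proj \<Omega> p f z) = Ap_dist \<Omega> p f"
    unfolding bergman_proj_def by auto
qed

lemma bergman_proj_eqI:
  assumes "p > 1" "f \<in> Lp \<Omega> p" "h \<in> Ap \<Omega> p" "Lp_norm \<Omega> p (\<lambda>z. f z - h z) \<le> Ap_dist \<Omega> p f" "z \<in> \<Omega>"
  shows "bergman_proj \<Omega> p f z = h z"
  by (rule best_approximation_unique[OF assms(1,2) bergman_proj(1)[OF assms(1,2)] assms(3) _ assms(4,5)])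
    (simp add: bergman_proj(2)[OF assms(1,2)])

subsection \<open>Hoelder continuity\<close>

text \<open>The distance to \<open>A^p\<close> is 1-Lipschitz, so \<open>f - P g\<close> has norm at most \<open>d + 2\<delta>\<close>, where \<open>d\<close> is the
  distance of \<open>f\<close> and \<open>\<delta>\<close> is the norm of \<open>f - g\<close>.\<close>

theorem bergman_proj_Hoelder:
  assumes p: "p > 1"
  shows "\<exists>C>0. \<forall>f\<in>Lp \<Omega> p. \<forall>g\<in>Lp \<Omega> p.
        Lp_norm \<Omega> p (\<lambda>z. bergman_proj \<Omega> p f z - bergman_proj \<Omega> p g z) \<le>
          (if 2 < p
           then C * (Lp_norm \<Omega> p f + Lp_norm \<Omega> p (\<lambda>z. f z - g z)) powr (1 - 1 / p)
                  * Lp_norm \<Omega> p (\<lambda>z. f z - g z) powr (1 / p)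
           else C * (Lp_norm \<Omega> p f + Lp_norm \<Omega> p (\<lambda>z. f z - g z)) powr (1 / 2)
                  * Lp_norm \<Omega> p (\<lambda>z. f z - g z) powr (1 / 2))"
proof -
  have p0: "p > 0" and p1: "p \<ge> 1" using p by auto
  obtain C where C0: "C > 0" and C: "convexity_const p C" using convexity_const_exists[OF p] by blast
  have main: "Lp_norm \<Omega> p (\<lambda>z. bergman_proj \<Omega> p f z - bergman_proj \<Omega> p g z) \<le>
          (if 2 < p
           then (2 * C) * (Lp_norm \<Omega> p f + Lp_norm \<Omega> p (\<lambda>z. f z - g z)) powr (1 - 1 / p)
                  * Lp_norm \<Omega> p (\<lambda>z. f z - g z) powr (1 / p)
           else (2 * C) * (Lp_norm \<Omega> p f + Lp_norm \<Omega> p (\<lambda>z. f z - g z)) powr (1 / 2)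
                  * Lp_norm \<Omega> p (\<lambda>z. f z - g z) powr (1 / 2))"
    if f: "f \<in> Lp \<Omega> p" and g: "g \<in> Lp \<Omega> p" for f g
  proof -
    define d where "d = Ap_dist \<Omega> p f"
    define \<delta> where "\<delta> = Lp_norm \<Omega> p (\<lambda>z. f z - g z)"
    define X where "X = Lp_norm \<Omega> p f + \<delta>"
    define Pf Pg where "Pf = bergman_proj \<Omega> p f" and "Pg = bergman_proj \<Omega> p g"
    have Pf: "Pf \<in> Ap \<Omega> p" "Lp_norm \<Omega> p (\<lambda>z. f z - Pf z) = d"
      and Pg: "Pg \<in> Ap \<Omega> p" "Lp_norm \<Omega> p (\<lambda>z. g z - Pg z) = Ap_dist \<Omega> p g"
      unfolding Pf_def Pg_def d_def using bergman_proj p f g by auto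
    have d: "d \<ge> 0" and \<delta>: "\<delta> \<ge> 0" unfolding d_def \<delta>_def by (auto simp: Ap_dist_nonneg)
    note sub = Lp_diff[OF p0 f Ap_Lp[OF Pf(1)]] Lp_diff[OF p0 g Ap_Lp[OF Pg(1)]] Lp_diff[OF p0 f Ap_Lp[OF Pg(1)]]
      Lp_diff[OF p0 g Ap_Lp[OF Pf(1)]] Lp_diff[OF p0 f g]
    have "Ap_dist \<Omega> p g \<le> Lp_norm \<Omega> p (\<lambda>z. g z - Pf z)" by (rule Ap_dist_le[OF Pf(1)])
    also have "\<dots> \<le> Lp_norm \<Omega> p (\<lambda>z. (g z - Pf z) - (f z - Pf z)) + Lp_norm \<Omega> p (\<lambda>z. f z - Pf z)"
      by (rule Lp_norm_triangle[OF p1 sub(4) sub(1)])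
    also have "\<dots> = \<delta> + d" using Pf(2) Lp_norm_minus_commute[of \<Omega> p g f] by (simp add: \<delta>_def)
    finally have dg: "Ap_dist \<Omega> p g \<le> \<delta> + d" .
    have "Lp_norm \<Omega> p (\<lambda>z. f z - Pg z) \<le> Lp_norm \<Omega> p (\<lambda>z. (f z - Pg z) - (g z - Pg z)) + Lp_norm \<Omega> p (\<lambda>z. g z - Pg z)"
      by (rule Lp_norm_triangle[OF p1 sub(3) sub(2)])
    also have "\<dots> \<le> d + 2 * \<delta>" using dg Pg(2) by (simp add: \<delta>_def)
    finally have v: "Lp_norm \<Omega> p (\<lambda>z. f z - Pg z) \<le> d + 2 * \<delta>" .
    have mid: "(\<lambda>z. (1/2) *\<^sub>R ((f z - Pg z) + (f z - Pf z))) = (\<lambda>z. f z - (1/2) * (Pg z + Pf z))"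
      by (auto simp: scaleR_conv_of_real field_simps)
    have "Lp_norm \<Omega> p (\<lambda>z. (f z - Pg z) - (f z - Pf z)) \<le>
        (if 2 < p then C * (d + 2 * \<delta>) powr (1 - 1/p) * \<delta> powr (1/p)
                  else C * (d + 2 * \<delta>) powr (1/2) * \<delta> powr (1/2))"
    proof (rule convexity_constD[OF C sub(3,1) d \<delta> v])
      show "d \<le> Lp_norm \<Omega> p (\<lambda>z. (1/2) *\<^sub>R ((f z - Pg z) + (f z - Pf z)))"
        unfolding mid d_def by (rule Ap_dist_le[OF Ap_midpoint[OF p0 Pg(1) Pf(1)]])
    qed (use Pf(2) \<delta> in simp)
    moreover
    have "C * (d + 2 * \<delta>) powr a * b \<le> (2 * C) * X powr a * b" if a: "0 \<le> a" "a \<le> 1" and b: "b \<ge> 0" for a b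
    proof -
      have "d + 2 * \<delta> \<le> 2 * X" using Ap_dist_le_norm[of p f] \<delta> d unfolding X_def d_def[symmetric] by simp
      then have "(d + 2 * \<delta>) powr a \<le> (2 * X) powr a" using a d \<delta> by (intro powr_mono2) auto
      also have "\<dots> = 2 powr a * X powr a" using \<delta> by (intro powr_mult)
      also have "\<dots> \<le> 2 * X powr a"
        using a powr_mono[of a 1 2] by (intro mult_right_mono) auto
      finally have "C * ((d + 2 * \<delta>) powr a * b) \<le> C * ((2 * X powr a) * b)"
        using C0 b by (intro mult_left_mono mult_right_mono) auto
      then show ?thesis by (simp add: mult_ac)
    qed
    from this[of "1 - 1/p" "\<delta> powr (1/p)"] this[of "1/2" "\<delta> powr (1/2)"]
    have "(if 2 < p then C * (d + 2 * \<delta>) powr (1 - 1/p) * \<delta> powr (1/p)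
                  else C * (d + 2 * \<delta>) powr (1/2) * \<delta> powr (1/2)) \<le>
        (if 2 < p then (2 * C) * X powr (1 - 1/p) * \<delta> powr (1/p)
                  else (2 * C) * X powr (1/2) * \<delta> powr (1/2))"
      using p by (cases "2 < p") simp_all
    ultimately have "Lp_norm \<Omega> p (\<lambda>z. Pf z - Pg z) \<le>
        (if 2 < p then (2 * C) * X powr (1 - 1/p) * \<delta> powr (1/p)
                  else (2 * C) * X powr (1/2) * \<delta> powr (1/2))"
      by simp
    then show ?thesis unfolding X_def \<delta>_def Pf_def Pg_def .
  qed
  show ?thesis
    by (intro exI[of _ "2 * C"] conjI ballI main) (use C0 in simp_all)
qed

end

section \<open>Invariance under automorphisms\<close>

text \<open>The derivative of a holomorphic map is complex linear, hence is given by the complex Jacobian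
  matrix.\<close>

lemma holo_map_on_deriv:
  fixes F :: "complex^'n::finite \<Rightarrow> complex^'n"
  assumes F: "holo_map_on \<Omega> F" and z: "z \<in> \<Omega>"
  shows "(F has_derivative (\<lambda>v. matrix (frechet_derivative F (at z)) *v v)) (at z)"
proof -
  have "\<exists>D. complex_deriv (\<lambda>z. F z $ i) z D" for i
    using F z unfolding holo_map_on_def holo_on_iff by blast
  then obtain D where D: "\<And>i. complex_deriv (\<lambda>z. F z $ i) z (D i)" by metis
  define E where "E = (\<lambda>v. \<chi> i. D i v)"
  have FE: "(F has_derivative E) (at z)"
  proof (rule has_derivative_componentwise_within[THEN iffD2], rule ballI)
    fix b :: "complex^'n" assume "b \<in> Basis"
    then obtain k u where "b = axis k u" by (auto simp: Basis_vec_def)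
    then show "((\<lambda>w. F w \<bullet> b) has_derivative (\<lambda>v. E v \<bullet> b)) (at z)"
      using has_derivative_inner_left[OF complex_derivD(1)[OF D[of k]], of u] by (simp add: inner_axis E_def)
  qed
  have lin: "linear E" using FE has_derivative_linear by blast
  have smult: "E (c *s v) = c *s E v" for c v
    using complex_derivD(2)[OF D] by (simp add: E_def vec_eq_iff)
  have "matrix E *v v = E v" for v
  proof -
    have "E v = E (\<Sum>j\<in>UNIV. v $ j *s axis j 1)" by (simp add: basis_expansion)
    also have "\<dots> = (\<Sum>j\<in>UNIV. v $ j *s E (axis j 1))" by (simp add: linear_sum[OF lin] smult)
    also have "\<dots> = matrix E *v v"
      by (simp add: vec_eq_iff matrix_def matrix_vector_mult_def mult.commute)
    finally show ?thesis by simp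
  qed
  moreover have "frechet_derivative F (at z) = E" using FE by (simp add: frechet_derivative_at[symmetric])
  ultimately show ?thesis using FE by simp
qed

lemma matrix_vector_mult_smult: "A *v (c *s v) = c *s (A *v (v :: complex^'n::finite))"
  by (simp add: vec_eq_iff matrix_vector_mult_def sum_distrib_left mult_ac)

lemma holo_on_compose_map:
  assumes F: "holo_map_on \<Omega> F" and FS: "\<And>z. z \<in> \<Omega> \<Longrightarrow> F z \<in> U" and h: "holo_on U h"
  shows "holo_on \<Omega> (\<lambda>z. h (F z))"
  unfolding holo_on_iff
proof
  fix z assume z: "z \<in> \<Omega>"
  obtain D where D: "complex_deriv h (F z) D" by (rule holo_onE[OF h FS[OF z]])
  have "((\<lambda>z. h (F z)) has_derivative (\<lambda>v. D (matrix (frechet_derivative F (at z)) *v v))) (at z)"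
    by (rule has_derivative_compose[OF holo_map_on_deriv[OF F z] complex_derivD(1)[OF D]])
  then have "complex_deriv (\<lambda>z. h (F z)) z (\<lambda>v. D (matrix (frechet_derivative F (at z)) *v v))"
    by (simp add: complex_deriv_def matrix_vector_mult_smult complex_derivD(2)[OF D])
  then show "\<exists>D. complex_deriv (\<lambda>z. h (F z)) z D" by blast
qed

lemma complex_measurable_iff_Re_Im:
  "f \<in> borel_measurable M \<longleftrightarrow> (\<lambda>x. Re (f x)) \<in> borel_measurable M \<and> (\<lambda>x. Im (f x)) \<in> borel_measurable M"
proof
  assume "(\<lambda>x. Re (f x)) \<in> borel_measurable M \<and> (\<lambda>x. Im (f x)) \<in> borel_measurable M"
  then have [measurable]: "(\<lambda>x. Re (f x)) \<in> borel_measurable M" "(\<lambda>x. Im (f x)) \<in> borel_measurable M" by auto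
  have "(\<lambda>x. complex_of_real (Re (f x)) + \<i> * complex_of_real (Im (f x))) \<in> borel_measurable M" by measurable
  then show "f \<in> borel_measurable M" by (simp add: complex_eq[symmetric])
qed auto

locale automorphism_weight = bounded_open_set \<Omega> for \<Omega> :: "(complex^'n::finite) set" +
  fixes F :: "complex^'n \<Rightarrow> complex^'n" and p :: real and G :: "complex^'n \<Rightarrow> complex"
  assumes F: "F \<in> Aut \<Omega>" and G: "holo_power_branch \<Omega> (jac F) (2 / p) G" and p: "p > 1"
begin

definition pull :: "(complex^'n \<Rightarrow> complex) \<Rightarrow> complex^'n \<Rightarrow> complex" where
  "pull f = (\<lambda>z. f (F z) * G z)"

lemma automorphism_facts: "bij_betw F \<Omega> \<Omega>" "holo_map_on \<Omega> F" "holo_map_on \<Omega> (inv_into \<Omega> F)"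
  using F by (auto simp: Aut_def)

lemma F_in: "z \<in> \<Omega> \<Longrightarrow> F z \<in> \<Omega>"
  using automorphism_facts(1) by (auto simp: bij_betw_def)

lemma inv_F: "z \<in> \<Omega> \<Longrightarrow> inv_into \<Omega> F z \<in> \<Omega>" "z \<in> \<Omega> \<Longrightarrow> F (inv_into \<Omega> F z) = z"
    "z \<in> \<Omega> \<Longrightarrow> inv_into \<Omega> F (F z) = z"
  using automorphism_facts(1) by (auto simp: bij_betw_def inv_into_into f_inv_into_f inv_into_f_f)

lemma weight_facts: "holo_on \<Omega> G" "\<And>z. z \<in> \<Omega> \<Longrightarrow> G z \<noteq> 0" "\<And>z. z \<in> \<Omega> \<Longrightarrow> jac F z \<noteq> 0"
    "\<And>z. z \<in> \<Omega> \<Longrightarrow> norm (G z) powr p = (norm (jac F z))\<^sup>2"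
proof -
  obtain L where L: "holo_on \<Omega> L" "\<And>z. z \<in> \<Omega> \<Longrightarrow> exp (L z) = jac F z"
    "\<And>z. z \<in> \<Omega> \<Longrightarrow> G z = exp (of_real (2/p) * L z)"
    using G unfolding holo_power_branch_def by blast
  have "holo_on \<Omega> (\<lambda>z. exp (of_real (2/p) * L z))"
  proof (rule holo_on_field_compose[of _ _ exp])
    show "holo_on \<Omega> (\<lambda>z. of_real (2/p) * L z)" by (rule holo_on_mult[OF holo_on_const L(1)])
  qed (auto simp: field_differentiable_def intro: DERIV_exp)
  then show "holo_on \<Omega> G" using holo_on_cong_open[OF open_\<Omega>, of G] L(3) by simp
  show "G z \<noteq> 0" "jac F z \<noteq> 0" if "z \<in> \<Omega>" for z using L(2,3) that by (simp, metis exp_not_eq_zero)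
  show "norm (G z) powr p = (norm (jac F z))\<^sup>2" if "z \<in> \<Omega>" for z
  proof -
    have "norm (G z) powr p = exp (2 * Re (L z))"
      using L(3)[OF that] p by (simp add: powr_def)
    also have "\<dots> = (norm (jac F z))\<^sup>2"
      by (simp add: L(2)[OF that, symmetric] power2_eq_square flip: exp_add)
    finally show ?thesis .
  qed
qed

lemma change_of_variables_automorphism:
  "has_bochner_integral (lebesgue_on \<Omega>) f b \<longleftrightarrow>
   has_bochner_integral (lebesgue_on \<Omega>) (\<lambda>z. norm (G z) powr p * f (F z)) b" for f :: "complex^'n \<Rightarrow> real"
proof -
  have im: "F ` \<Omega> = \<Omega>" using automorphism_facts(1) by (simp add: bij_betw_def)
  have "has_bochner_integral (lebesgue_on (F ` \<Omega>)) f b \<longleftrightarrow>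
     has_bochner_integral (lebesgue_on \<Omega>) (\<lambda>z. (norm (det (matrix (frechet_derivative F (at z)))))\<^sup>2 * f (F z)) b"
    by (rule holomorphic_change_of_variables)
      (use im automorphism_facts(1) weight_facts(3) holo_map_on_deriv[OF automorphism_facts(2)] in
        \<open>auto simp: bij_betw_def jac_def intro: has_derivative_at_withinI\<close>)
  also have "\<dots> \<longleftrightarrow> has_bochner_integral (lebesgue_on \<Omega>) (\<lambda>z. norm (G z) powr p * f (F z)) b"
    by (rule has_bochner_integral_cong) (auto simp: weight_facts(4) jac_def)
  finally show ?thesis unfolding im .
qed

lemma norm_pull: "norm (pull f z) powr p = norm (G z) powr p * norm (f (F z)) powr p"
  by (simp add: pull_def norm_mult powr_mult mult.commute)

text \<open>Composition with a homeomorphism need not preserve Lebesgue measurability. Here measurability is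
  read off from the change of variables formula for the real and imaginary part of \<open>f\<close>, which are
  integrable since \<open>\<Omega>\<close> has finite volume.\<close>

lemma pull_measurable:
  assumes f: "f \<in> Lp \<Omega> p"
  shows "pull f \<in> borel_measurable (lebesgue_on \<Omega>)"
proof -
  have Gm[measurable]: "G \<in> borel_measurable (lebesgue_on \<Omega>)"
    by (rule holo_on_imp_lebesgue_measurable[OF open_\<Omega> weight_facts(1)])
  have real: "(\<lambda>z. g (F z)) \<in> borel_measurable (lebesgue_on \<Omega>)"
    if g: "integrable (lebesgue_on \<Omega>) g" for g :: "complex^'n \<Rightarrow> real"
  proof -
    have "has_bochner_integral (lebesgue_on \<Omega>) g (integral\<^sup>L (lebesgue_on \<Omega>) g)"
      using g by (rule has_bochner_integral_integrable)
    then have "integrable (lebesgue_on \<Omega>) (\<lambda>z. norm (G z) powr p * g (F z))"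
      by (subst (asm) change_of_variables_automorphism) (auto intro: integrable.intros)
    then have [measurable]: "(\<lambda>z. norm (G z) powr p * g (F z)) \<in> borel_measurable (lebesgue_on \<Omega>)"
      by (rule borel_measurable_integrable)
    have "(\<lambda>z. (norm (G z) powr p * g (F z)) / norm (G z) powr p) \<in> borel_measurable (lebesgue_on \<Omega>)"
      by measurable
    then show ?thesis
      by (rule measurable_cong[THEN iffD1, rotated]) (use weight_facts(2) in auto)
  qed
  have "integrable (lebesgue_on \<Omega>) f" using Lp_L1(2)[OF _ f] p by simp
  then have "(\<lambda>z. Re (f (F z))) \<in> borel_measurable (lebesgue_on \<Omega>)" "(\<lambda>z. Im (f (F z))) \<in> borel_measurable (lebesgue_on \<Omega>)"
    by (rule real[OF integrable_Re], rule real[OF integrable_Im])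
  then have [measurable]: "(\<lambda>z. f (F z)) \<in> borel_measurable (lebesgue_on \<Omega>)"
    by (subst complex_measurable_iff_Re_Im) simp
  show ?thesis unfolding pull_def by measurable
qed

lemma pull_Lp:
  assumes f: "f \<in> Lp \<Omega> p"
  shows "pull f \<in> Lp \<Omega> p" "Lp_norm \<Omega> p (pull f) = Lp_norm \<Omega> p f"
proof -
  have "has_bochner_integral (lebesgue_on \<Omega>) (\<lambda>z. norm (f z) powr p) (Lp_int \<Omega> p f)"
    using Lp_integrable[OF f] by (rule has_bochner_integral_integrable)
  then have "has_bochner_integral (lebesgue_on \<Omega>) (\<lambda>z. norm (pull f z) powr p) (Lp_int \<Omega> p f)"
    unfolding norm_pull by (rule change_of_variables_automorphism[THEN iffD1])
  then have "integrable (lebesgue_on \<Omega>) (\<lambda>z. norm (pull f z) powr p)" "Lp_int \<Omega> p (pull f) = Lp_int \<Omega> p f"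
    by (auto simp: has_bochner_integral_iff)
  then show "pull f \<in> Lp \<Omega> p" "Lp_norm \<Omega> p (pull f) = Lp_norm \<Omega> p f"
    using pull_measurable[OF f] by (auto simp: Lp_def Lp_norm_def)
qed

lemma pull_Ap:
  assumes h: "h \<in> Ap \<Omega> p" shows "pull h \<in> Ap \<Omega> p"
  using pull_Lp(1)[OF Ap_Lp[OF h]] holo_on_mult[OF holo_on_compose_map[OF automorphism_facts(2) F_in Ap_holo[OF h]] weight_facts(1)]
  by (simp add: Ap_def pull_def)

lemma pull_Ap_surj:
  assumes k: "k \<in> Ap \<Omega> p" shows "\<exists>h\<in>Ap \<Omega> p. \<forall>z\<in>\<Omega>. pull h z = k z"
proof -
  \<comment> \<open>The inverse of the operator is composition of \<open>k / G\<close> with the inverse of \<open>F\<close>.\<close>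
  define h where "h = (\<lambda>w. k (inv_into \<Omega> F w) * inverse (G (inv_into \<Omega> F w)))"
  have eq: "pull h z = k z" if "z \<in> \<Omega>" for z
    using that inv_F(3) weight_facts(2) by (simp add: pull_def h_def)
  have "holo_on \<Omega> (\<lambda>z. k z * inverse (G z))"
    by (intro holo_on_mult Ap_holo[OF k] holo_on_field_compose[OF weight_facts(1)] field_differentiable_inverse
        field_differentiable_ident weight_facts(2))
  from holo_on_compose_map[OF automorphism_facts(3) inv_F(1) this] have hol: "holo_on \<Omega> h"
    by (simp add: h_def)
  have "has_bochner_integral (lebesgue_on \<Omega>) (\<lambda>z. norm (k z) powr p) (Lp_int \<Omega> p k)"
    using Lp_integrable[OF Ap_Lp[OF k]] by (rule has_bochner_integral_integrable)
  then have "has_bochner_integral (lebesgue_on \<Omega>) (\<lambda>z. norm (pull h z) powr p) (Lp_int \<Omega> p k)"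
    by (rule has_bochner_integral_cong[THEN iffD1, rotated -1]) (use eq in auto)
  then have "has_bochner_integral (lebesgue_on \<Omega>) (\<lambda>z. norm (h z) powr p) (Lp_int \<Omega> p k)"
    unfolding norm_pull by (rule change_of_variables_automorphism[THEN iffD2])
  then have "integrable (lebesgue_on \<Omega>) (\<lambda>z. norm (h z) powr p)" by (rule integrable.intros)
  then have "h \<in> Ap \<Omega> p"
    using hol holo_on_imp_lebesgue_measurable[OF open_\<Omega> hol] by (simp add: Ap_def Lp_def)
  with eq show ?thesis by blast
qed

text \<open>The weighted composition operator is an isometry of \<open>L^p\<close> which maps \<open>A^p\<close> onto itself, so it
  preserves best approximations.\<close>

theorem bergman_proj_pull:
  assumes f: "f \<in> Lp \<Omega> p" and z: "z \<in> \<Omega>"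
  shows "bergman_proj \<Omega> p (pull f) z = pull (bergman_proj \<Omega> p f) z"
proof (rule bergman_proj_eqI[OF p pull_Lp(1)[OF f] _ _ z])
  have p0: "p > 0" using p by simp
  show "pull (bergman_proj \<Omega> p f) \<in> Ap \<Omega> p" by (rule pull_Ap[OF bergman_proj(1)[OF p f]])
  have iso: "Lp_norm \<Omega> p (\<lambda>z. pull f z - pull h z) = Lp_norm \<Omega> p (\<lambda>z. f z - h z)" if h: "h \<in> Ap \<Omega> p" for h
    using pull_Lp(2)[OF Lp_diff[OF p0 f Ap_Lp[OF h]]] by (simp add: pull_def algebra_simps)
  show "Lp_norm \<Omega> p (\<lambda>z. pull f z - pull (bergman_proj \<Omega> p f) z) \<le> Ap_dist \<Omega> p (pull f)"
    unfolding iso[OF bergman_proj(1)[OF p f]] bergman_proj(2)[OF p f]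
  proof (rule Ap_dist_greatest)
    fix k assume "k \<in> Ap \<Omega> p"
    then obtain h where h: "h \<in> Ap \<Omega> p" "\<And>z. z \<in> \<Omega> \<Longrightarrow> pull h z = k z" using pull_Ap_surj by blast
    have "Ap_dist \<Omega> p f \<le> Lp_norm \<Omega> p (\<lambda>z. pull f z - pull h z)"
      unfolding iso[OF h(1)] by (rule Ap_dist_le[OF h(1)])
    also have "\<dots> = Lp_norm \<Omega> p (\<lambda>z. pull f z - k z)"
      by (rule Lp_cong(2)) (simp add: h(2))
    finally show "Ap_dist \<Omega> p f \<le> Lp_norm \<Omega> p (\<lambda>z. pull f z - k z)" .
  qed
qed

corollary pull_null:
  assumes f: "f \<in> bergman_null \<Omega> p" shows "pull f \<in> bergman_null \<Omega> p"
proof -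
  have f': "f \<in> Lp \<Omega> p" "\<And>z. z \<in> \<Omega> \<Longrightarrow> bergman_proj \<Omega> p f z = 0" using f by (auto simp: bergman_null_def)
  then show ?thesis using pull_Lp(1)[OF f'(1)] bergman_proj_pull[OF f'(1)] F_in
    by (auto simp: bergman_null_def) (simp add: pull_def)
qed

end

section \<open>The limit of large exponents\<close>

context bounded_open_set
begin

lemma Linf_AE:
  assumes f: "f \<in> Linf \<Omega>"
  shows "f \<in> borel_measurable (lebesgue_on \<Omega>)" "AE z in lebesgue_on \<Omega>. norm (f z) \<le> Linf_norm \<Omega> f"
proof -
  show m[measurable]: "f \<in> borel_measurable (lebesgue_on \<Omega>)" using f by (simp add: Linf_def)
  define E where "E = esssup (lebesgue_on \<Omega>) (\<lambda>z. ereal (norm (f z)))"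
  have AE: "AE z in lebesgue_on \<Omega>. ereal (norm (f z)) \<le> E" unfolding E_def by (rule esssup_AE)
  have "E < \<infinity>" using f by (simp add: Linf_def E_def)
  moreover have "E \<noteq> -\<infinity>" using AE AE_false_\<Omega> by (auto elim: eventually_mono)
  ultimately obtain e where e: "E = ereal e" by (cases E) auto
  then have "Linf_norm \<Omega> f = e" by (simp add: Linf_norm_def E_def)
  then show "AE z in lebesgue_on \<Omega>. norm (f z) \<le> Linf_norm \<Omega> f" using AE e by simp
qed

lemma Linf_I:
  assumes [measurable]: "f \<in> borel_measurable (lebesgue_on \<Omega>)" and c: "AE z in lebesgue_on \<Omega>. norm (f z) \<le> c"
  shows "f \<in> Linf \<Omega>" "Linf_norm \<Omega> f \<le> c"
proof -
  have le: "esssup (lebesgue_on \<Omega>) (\<lambda>z. ereal (norm (f z))) \<le> ereal c"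
    by (rule esssup_I) (use c in auto)
  then show fL: "f \<in> Linf \<Omega>" by (auto simp: Linf_def)
  have "c \<ge> 0"
  proof (rule ccontr)
    assume "\<not> c \<ge> 0"
    then have "\<not> norm (f z) \<le> c" for z by (smt (verit) norm_ge_zero)
    with c have "AE z in lebesgue_on \<Omega>. False" by simp
    then show False using AE_false_\<Omega> by blast
  qed
  then show "Linf_norm \<Omega> f \<le> c"
    using le by (cases "esssup (lebesgue_on \<Omega>) (\<lambda>z. ereal (norm (f z)))") (auto simp: Linf_norm_def)
qed

lemma Linf_norm_nonneg: "f \<in> Linf \<Omega> \<Longrightarrow> Linf_norm \<Omega> f \<ge> 0"
proof (rule ccontr)
  assume f: "f \<in> Linf \<Omega>" and "\<not> Linf_norm \<Omega> f \<ge> 0"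
  then have "\<not> norm (f z) \<le> Linf_norm \<Omega> f" for z by (smt (verit) norm_ge_zero)
  with Linf_AE(2)[OF f] have "AE z in lebesgue_on \<Omega>. False" by simp
  then show False using AE_false_\<Omega> by blast
qed

lemma Lp_of_bounded:
  assumes p: "p > 0" and [measurable]: "f \<in> borel_measurable (lebesgue_on \<Omega>)"
    and c: "AE z in lebesgue_on \<Omega>. norm (f z) \<le> c" "c \<ge> 0"
  shows "f \<in> Lp \<Omega> p" "vol powr (- (1/p)) * Lp_norm \<Omega> p f \<le> c"
proof -
  have ae: "AE z in lebesgue_on \<Omega>. norm (f z) powr p \<le> c powr p"
    using c(1) by (rule eventually_mono) (use p in \<open>auto intro!: powr_mono2\<close>)
  have i: "integrable (lebesgue_on \<Omega>) (\<lambda>z. norm (f z) powr p)"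
    by (rule Bochner_Integration.integrable_bound[OF integrable_const_\<Omega>[of "c powr p"]]) (use ae in auto)
  then show "f \<in> Lp \<Omega> p" by (simp add: Lp_def)
  have "Lp_int \<Omega> p f \<le> integral\<^sup>L (lebesgue_on \<Omega>) (\<lambda>z. c powr p)"
    using i ae by (intro integral_mono_AE) auto
  then have "Lp_int \<Omega> p f \<le> c powr p * vol" by (simp only: integral_const_\<Omega>)
  then have "Lp_norm \<Omega> p f \<le> (c powr p * vol) powr (1/p)"
    unfolding Lp_norm_def using p by (intro powr_mono2) auto
  also have "\<dots> = c * vol powr (1/p)" using p c(2) vol_pos by (simp add: powr_mult powr_powr)
  finally have "vol powr (- (1/p)) * Lp_norm \<Omega> p f \<le> vol powr (- (1/p)) * (c * vol powr (1/p))"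
    by (intro mult_left_mono) auto
  also have "\<dots> = c" using vol_pos by (simp add: powr_minus)
  finally show "vol powr (- (1/p)) * Lp_norm \<Omega> p f \<le> c" .
qed

text \<open>Chebyshev's inequality bounds the measure of \<open>norm f \<ge> c\<close> by \<open>vol (d/c)\<^sup>n\<close> for every \<open>n\<close>.\<close>

lemma AE_bound_of_all_Lp:
  assumes f: "\<And>n::nat. f \<in> Lp \<Omega> (real (Suc n))"
    and d: "\<And>n::nat. Lp_norm \<Omega> (real (Suc n)) f \<le> vol powr (1 / real (Suc n)) * d" and d0: "d \<ge> 0"
  shows "AE z in lebesgue_on \<Omega>. norm (f z) \<le> d"
proof -
  have [measurable]: "f \<in> borel_measurable (lebesgue_on \<Omega>)" using f[of 0] by auto
  have "AE z in lebesgue_on \<Omega>. norm (f z) < d + 1 / real (Suc k)" for k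
  proof -
    define c where "c = d + 1 / real (Suc k)"
    have c: "c > 0" "d < c" using d0 by (auto simp: c_def add_nonneg_pos)
    define A where "A = {z \<in> space (lebesgue_on \<Omega>). norm (f z) \<ge> c}"
    have A: "A \<in> sets (lebesgue_on \<Omega>)" unfolding A_def by measurable
    have fin: "emeasure (lebesgue_on \<Omega>) A \<noteq> \<infinity>"
    proof -
      have "emeasure (lebesgue_on \<Omega>) A \<le> emeasure (lebesgue_on \<Omega>) (space (lebesgue_on \<Omega>))"
        by (rule emeasure_space)
      also have "\<dots> = emeasure lebesgue \<Omega>" by (simp add: emeasure_restrict_space del: emeasure_completion)
      finally show ?thesis using fmeasurableD2[OF lmeasurable_\<Omega>] by (auto simp: top_unique)
    qed
    have bound: "measure (lebesgue_on \<Omega>) A \<le> vol * (d / c) ^ Suc n" for n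
    proof -
      have iA: "integrable (lebesgue_on \<Omega>) (\<lambda>z. c ^ Suc n * indicator A z :: real)"
        using A fin by (intro integrable_mult_right integrable_real_indicator) (auto simp: less_top)
      have "c ^ Suc n * measure (lebesgue_on \<Omega>) A = integral\<^sup>L (lebesgue_on \<Omega>) (\<lambda>z. c ^ Suc n * indicator A z)"
        using A sets.sets_into_space[OF A] by (simp add: Int_absorb1 Int_absorb2)
      also have "\<dots> \<le> Lp_int \<Omega> (real (Suc n)) f"
      proof (rule integral_mono[OF iA Lp_integrable[OF f]])
        fix z
        have "c powr real (Suc n) \<le> norm (f z) powr real (Suc n)" if "c \<le> norm (f z)"
          using that c by (intro powr_mono2) auto
        then show "c ^ Suc n * indicator A z \<le> norm (f z) powr real (Suc n)"
          using c powr_realpow[OF c(1), of "Suc n"] by (auto simp: indicator_def A_def simp del: power_Suc of_nat_Suc)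
      qed
      also have "\<dots> = Lp_norm \<Omega> (real (Suc n)) f powr real (Suc n)" by (simp add: Lp_norm_powr del: of_nat_Suc)
      also have "\<dots> \<le> (vol powr (1 / real (Suc n)) * d) powr real (Suc n)"
        by (rule powr_mono2) (use d in auto)
      also have "\<dots> = vol * d ^ Suc n"
        using vol_pos d0 by (cases "d = 0") (simp_all add: powr_mult powr_powr powr_realpow' del: of_nat_Suc power_Suc)
      finally show ?thesis using c by (simp add: power_divide pos_le_divide_eq mult.commute del: power_Suc)
    qed
    have "(\<lambda>n. vol * (d / c) ^ Suc n) \<longlonglongrightarrow> vol * 0"
      using c d0 by (intro tendsto_mult tendsto_const LIMSEQ_Suc LIMSEQ_power_zero) (auto simp: divide_less_eq)
    then have "measure (lebesgue_on \<Omega>) A \<le> 0"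
      using LIMSEQ_le_const[of _ "vol * 0" "measure (lebesgue_on \<Omega>) A"] bound by fastforce
    then have "measure (lebesgue_on \<Omega>) A = 0" by (simp add: measure_le_0_iff)
    then have "A \<in> null_sets (lebesgue_on \<Omega>)"
      using A fin by (simp add: null_sets_def emeasure_eq_ennreal_measure)
    then have "AE z in lebesgue_on \<Omega>. z \<notin> A" by (rule AE_not_in)
    then show ?thesis using AE_space by eventually_elim (auto simp: A_def c_def not_le)
  qed
  then have "AE z in lebesgue_on \<Omega>. \<forall>k. norm (f z) < d + 1 / real (Suc k)" by (simp add: AE_all_countable)
  then show ?thesis
  proof eventually_elim
    case (elim z)
    have "(\<lambda>k. d + 1 / real (Suc k)) \<longlonglongrightarrow> d + 0"
      using LIMSEQ_inverse_real_of_nat by (intro tendsto_add tendsto_const) (simp add: divide_inverse)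
    then show ?case using LIMSEQ_le_const[of _ "d + 0" "norm (f z)"] elim by (auto intro: less_imp_le)
  qed
qed

lemma Ainf_bounds:
  assumes f: "f \<in> Linf \<Omega>" and k: "k \<in> Ainf \<Omega>"
  shows "(\<lambda>z. f z - k z) \<in> Linf \<Omega>" "p > 0 \<Longrightarrow> k \<in> Ap \<Omega> p"
proof -
  have hol: "holo_on \<Omega> k" and "bounded (k ` \<Omega>)" using k by (auto simp: Ainf_def)
  then obtain B where B: "\<And>z. z \<in> \<Omega> \<Longrightarrow> norm (k z) \<le> B" by (auto simp: bounded_iff)
  obtain z0 where "z0 \<in> \<Omega>" using nonempty_\<Omega> by blast
  then have B0: "B \<ge> 0" using B[of z0] by (smt (verit) norm_ge_zero)
  have km[measurable]: "k \<in> borel_measurable (lebesgue_on \<Omega>)"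
    by (rule holo_on_imp_lebesgue_measurable[OF open_\<Omega> hol])
  have kB: "AE z in lebesgue_on \<Omega>. norm (k z) \<le> B" by (rule AE_I2) (use B in simp)
  have fm[measurable]: "f \<in> borel_measurable (lebesgue_on \<Omega>)" by (rule Linf_AE(1)[OF f])
  show "(\<lambda>z. f z - k z) \<in> Linf \<Omega>"
  proof (rule Linf_I(1))
    show "AE z in lebesgue_on \<Omega>. norm (f z - k z) \<le> Linf_norm \<Omega> f + B"
      using Linf_AE(2)[OF f] kB by eventually_elim (rule order.trans[OF norm_triangle_ineq4], simp)
  qed measurable
  show "k \<in> Ap \<Omega> p" if "p > 0" using Lp_of_bounded(1)[OF that km kB B0] hol by (simp add: Ap_def)
qed

lemma Ainf_zero: "(\<lambda>z. 0) \<in> Ainf \<Omega>"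
  using nonempty_\<Omega> by (auto simp: Ainf_def holo_on_const image_constant_conv)

lemma Ainf_dist_le:
  assumes f: "f \<in> Linf \<Omega>" and k: "k \<in> Ainf \<Omega>"
  shows "Ainf_dist \<Omega> f \<le> Linf_norm \<Omega> (\<lambda>z. f z - k z)"
  unfolding Ainf_dist_def
  by (rule cINF_lower[OF _ k]) (use Linf_norm_nonneg[OF Ainf_bounds(1)[OF f]] in \<open>auto intro!: bdd_belowI2[where m=0]\<close>)

text \<open>Normalized like a power mean, the distances increase with \<open>p\<close> and are bounded by the distance
  in \<open>L^\<infinity>\<close>, so that they converge.\<close>

definition normalized_dist :: "real \<Rightarrow> (complex^'n \<Rightarrow> complex) \<Rightarrow> real" where
  "normalized_dist p f = vol powr (- (1/p)) * Ap_dist \<Omega> p f"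

lemma Linf_Lp: "f \<in> Linf \<Omega> \<Longrightarrow> p > 0 \<Longrightarrow> f \<in> Lp \<Omega> p"
  by (rule Lp_of_bounded(1)[OF _ Linf_AE Linf_norm_nonneg])

lemma normalized_dist_le:
  assumes f: "f \<in> Linf \<Omega>" and p: "p > 0"
  shows "normalized_dist p f \<le> Ainf_dist \<Omega> f"
  unfolding Ainf_dist_def
proof (rule cINF_greatest)
  fix k assume k: "k \<in> Ainf \<Omega>"
  note fk = Ainf_bounds(1)[OF f k]
  have "normalized_dist p f \<le> vol powr (- (1/p)) * Lp_norm \<Omega> p (\<lambda>z. f z - k z)"
    unfolding normalized_dist_def by (intro mult_left_mono Ap_dist_le Ainf_bounds(2)[OF f k p]) auto
  also have "\<dots> \<le> Linf_norm \<Omega> (\<lambda>z. f z - k z)"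
    by (rule Lp_of_bounded(2)[OF p Linf_AE[OF fk] Linf_norm_nonneg[OF fk]])
  finally show "normalized_dist p f \<le> Linf_norm \<Omega> (\<lambda>z. f z - k z)" .
qed (use Ainf_zero in auto)

lemma Lp_norm_proj_le:
  assumes f: "f \<in> Lp \<Omega> p" and qp: "1 \<le> q" "q \<le> p" "p > 1"
  shows "bergman_proj \<Omega> p f \<in> Ap \<Omega> q"
    "vol powr (- (1/q)) * Lp_norm \<Omega> q (\<lambda>z. f z - bergman_proj \<Omega> p f z) \<le> normalized_dist p f"
proof -
  have p0: "p > 0" and q0: "q > 0" using qp by auto
  note P = bergman_proj[OF qp(3) f]
  note pm = Lp_power_mean[OF lmeasurable_\<Omega> vol_pos[unfolded vol_def] q0 qp(2), folded vol_def]
  show "bergman_proj \<Omega> p f \<in> Ap \<Omega> q"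
    using pm(1)[OF Ap_Lp[OF P(1)]] Ap_holo[OF P(1)] by (simp add: Ap_def)
  show "vol powr (- (1/q)) * Lp_norm \<Omega> q (\<lambda>z. f z - bergman_proj \<Omega> p f z) \<le> normalized_dist p f"
    using pm(2)[OF Lp_diff[OF p0 f Ap_Lp[OF P(1)]]] by (simp add: normalized_dist_def P(2))
qed

lemma normalized_dist_mono:
  assumes f: "f \<in> Linf \<Omega>" and qp: "1 \<le> q" "q \<le> p" "p > 1"
  shows "normalized_dist q f \<le> normalized_dist p f"
proof -
  have "f \<in> Lp \<Omega> p" using Linf_Lp[OF f] qp by simp
  note P = Lp_norm_proj_le[OF this qp]
  have "normalized_dist q f \<le> vol powr (- (1/q)) * Lp_norm \<Omega> q (\<lambda>z. f z - bergman_proj \<Omega> p f z)"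
    unfolding normalized_dist_def by (intro mult_left_mono Ap_dist_le P(1)) auto
  with P(2) show ?thesis by simp
qed

text \<open>The projections for the exponents \<open>j + 2\<close> are bounded in \<open>L^1\<close>, so Montel's theorem gives a
  convergent subsequence. By Fatou's lemma its limit \<open>h\<close> satisfies
  \<open>Lp_norm \<Omega> q (f - h) \<le> vol powr (1/q) * S\<close> for every \<open>q\<close>, where \<open>S\<close> is the limit of the normalized
  distances; hence \<open>norm (f - h) \<le> S\<close> almost everywhere.\<close>

theorem bergman_proj_large_exponents:
  assumes f: "f \<in> Linf \<Omega>"
  shows "\<exists>(q :: nat \<Rightarrow> real) h. (\<forall>j. 1 < q j) \<and> strict_mono q \<and> filterlim q at_top sequentially \<and>
    h \<in> Ainf \<Omega> \<and> locally_uniform_limit \<Omega> (\<lambda>j. bergman_proj \<Omega> (q j) f) h \<and>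
    Linf_norm \<Omega> (\<lambda>z. f z - h z) = Ainf_dist \<Omega> f \<and>
    (\<lambda>j. normalized_dist (q j) f) \<longlonglongrightarrow> Ainf_dist \<Omega> f"
proof -
  define r where "r = (\<lambda>j::nat. real j + 2)"
  have r: "r j > 1" for j by (simp add: r_def)
  define N where "N = (\<lambda>j. normalized_dist (r j) f)"
  define u where "u = (\<lambda>j. bergman_proj \<Omega> (r j) f)"
  have fL: "f \<in> Lp \<Omega> p" if "p > 0" for p using Linf_Lp[OF f that] .
  have N_le: "N j \<le> Ainf_dist \<Omega> f" for j
    unfolding N_def using r[of j] by (intro normalized_dist_le[OF f]) simp
  have "incseq N"
    by (rule monoI) (auto simp: N_def r_def intro!: normalized_dist_mono[OF f])
  then obtain S where S: "N \<longlonglongrightarrow> S" "\<And>j. N j \<le> S"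
    using incseq_convergent[of N "Ainf_dist \<Omega> f"] N_le by blast
  have N0: "N j \<ge> 0" for j unfolding N_def normalized_dist_def by (simp add: Ap_dist_nonneg)
  have S0: "S \<ge> 0" using S(2)[of 0] N0[of 0] by simp
  have SA: "S \<le> Ainf_dist \<Omega> f" using LIMSEQ_le_const2[OF S(1)] N_le by blast
  have u_Ap: "u j \<in> Ap \<Omega> q" and u_norm: "Lp_norm \<Omega> q (\<lambda>z. f z - u j z) \<le> vol powr (1/q) * S"
    if q: "1 \<le> q" "q \<le> r j" for q j
  proof -
    have fr: "f \<in> Lp \<Omega> (r j)" using r[of j] by (intro fL) simp
    note * = Lp_norm_proj_le[OF fr q r]
    show "u j \<in> Ap \<Omega> q" unfolding u_def by (rule *(1))
    have "vol powr (- (1/q)) * Lp_norm \<Omega> q (\<lambda>z. f z - u j z) \<le> S"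
      using *(2) S(2)[of j] by (simp add: u_def N_def)
    then have "vol powr (1/q) * (vol powr (- (1/q)) * Lp_norm \<Omega> q (\<lambda>z. f z - u j z)) \<le> vol powr (1/q) * S"
      by (intro mult_left_mono) auto
    moreover have "vol powr (1/q) * vol powr (- (1/q)) = 1" using vol_pos by (simp add: powr_minus)
    ultimately show "Lp_norm \<Omega> q (\<lambda>z. f z - u j z) \<le> vol powr (1/q) * S" by (simp add: mult.assoc[symmetric])
  qed
  have u1: "u j \<in> Ap \<Omega> 1" for j using u_Ap[of 1 j] r[of j] by simp
  have L1: "integral\<^sup>L (lebesgue_on \<Omega>) (\<lambda>z. norm (u j z)) \<le> vol * S + Lp_norm \<Omega> 1 f" for j
  proof -
    have "Lp_norm \<Omega> 1 (u j) \<le> Lp_norm \<Omega> 1 (\<lambda>z. u j z - f z) + Lp_norm \<Omega> 1 f"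
      by (rule Lp_norm_triangle[OF _ Ap_Lp[OF u1] fL]) auto
    also have "Lp_norm \<Omega> 1 (\<lambda>z. u j z - f z) = Lp_norm \<Omega> 1 (\<lambda>z. f z - u j z)" by (rule Lp_norm_minus_commute)
    also have "\<dots> \<le> vol * S" using u_norm[of 1 j] r[of j] vol_pos by simp
    finally show ?thesis by (simp add: Lp_norm_def)
  qed
  obtain s h where s: "strict_mono (s :: nat \<Rightarrow> nat)" and h: "holo_on \<Omega> h"
    and lim: "locally_uniform_limit \<Omega> (\<lambda>j. u (s j)) h"
    by (rule Montel_L1[OF open_\<Omega> Ap_holo[OF u1] Lp_L1(1)[OF _ Ap_Lp[OF u1]] L1]) simp_all
  have fh: "(\<lambda>z. f z - h z) \<in> Lp \<Omega> (real (Suc n))"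
    "Lp_norm \<Omega> (real (Suc n)) (\<lambda>z. f z - h z) \<le> vol powr (1 / real (Suc n)) * S" for n
  proof -
    \<comment> \<open>The shift by \<open>n\<close> discards the exponents below \<open>n + 1\<close>.\<close>
    have large: "real (Suc n) \<le> r (s (j + n))" for j
      using seq_suble[OF s, of "j + n"] by (simp add: r_def)
    have diff: "(\<lambda>z. f z - u (s (j + n)) z) \<in> Lp \<Omega> (real (Suc n))" for j
      using u_Ap[OF _ large] by (intro Lp_diff fL Ap_Lp) auto
    have ptw: "(\<lambda>j. f z - u (s (j + n)) z) \<longlonglongrightarrow> f z - h z" if "z \<in> \<Omega>" for z
      by (intro tendsto_diff tendsto_const LIMSEQ_ignore_initial_segment locally_uniform_limit_pointwise[OF lim that])
    have bd: "Lp_norm \<Omega> (real (Suc n)) (\<lambda>z. f z - u (s (j + n)) z) \<le> vol powr (1 / real (Suc n)) * S" for j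
      by (rule u_norm[OF _ large]) simp
    note * = Lp_Fatou[where u="\<lambda>j z. f z - u (s (j + n)) z", OF _ diff ptw bd tendsto_const]
    show "(\<lambda>z. f z - h z) \<in> Lp \<Omega> (real (Suc n))"
      "Lp_norm \<Omega> (real (Suc n)) (\<lambda>z. f z - h z) \<le> vol powr (1 / real (Suc n)) * S"
      by (rule *; simp)+
  qed
  have ae: "AE z in lebesgue_on \<Omega>. norm (f z - h z) \<le> S"
    by (rule AE_bound_of_all_Lp[OF fh S0])
  have hA: "h \<in> Ainf \<Omega>"
  proof -
    have "AE z in lebesgue_on \<Omega>. h z \<in> cball 0 (Linf_norm \<Omega> f + S)"
      using ae Linf_AE(2)[OF f]
    proof eventually_elim
      case (elim z)
      then show ?case using norm_triangle_ineq4[of "f z" "f z - h z"] by simp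
    qed
    from AE_imp_everywhere[OF this holo_on_imp_continuous_on[OF h] closed_cball]
    have "h ` \<Omega> \<subseteq> cball 0 (Linf_norm \<Omega> f + S)" by auto
    then show ?thesis using h bounded_subset[OF bounded_cball] by (auto simp: Ainf_def)
  qed
  have "Linf_norm \<Omega> (\<lambda>z. f z - h z) \<le> S"
    by (rule Linf_I(2)[OF _ ae]) (use Lp_measurable[OF fh(1)] in simp)
  with Ainf_dist_le[OF f hA] SA have eq: "S = Ainf_dist \<Omega> f" "Linf_norm \<Omega> (\<lambda>z. f z - h z) = Ainf_dist \<Omega> f"
    by auto
  show ?thesis
  proof (intro exI[of _ "\<lambda>j. r (s j)"] exI[of _ h] conjI allI)
    show "strict_mono (\<lambda>j. r (s j))" using s by (auto simp: strict_mono_def r_def)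
    show "filterlim (\<lambda>j. r (s j)) at_top sequentially"
    proof (rule filterlim_compose[of r])
      show "filterlim s sequentially sequentially" by (rule filterlim_subseq[OF s])
      show "filterlim r at_top sequentially" unfolding r_def
        by (rule filterlim_at_top_mono[OF filterlim_real_sequentially]) auto
    qed
    show "(\<lambda>j. normalized_dist (r (s j)) f) \<longlonglongrightarrow> Ainf_dist \<Omega> f"
      using LIMSEQ_subseq_LIMSEQ[OF S(1) s] by (simp add: eq(1) N_def o_def)
  qed (use r hA lim eq(2) in \<open>auto simp: u_def\<close>)
qed

theorem Ap_dist_tendsto_Ainf_dist:
  assumes f: "f \<in> Linf \<Omega>"
  shows "((\<lambda>p. Ap_dist \<Omega> p f) \<longlongrightarrow> Ainf_dist \<Omega> f) at_top"
proof -
  obtain q where q: "\<And>j. 1 < q j" "(\<lambda>j::nat. normalized_dist (q j) f) \<longlonglongrightarrow> Ainf_dist \<Omega> f"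
    using bergman_proj_large_exponents[OF f] by blast
  have N: "((\<lambda>p. normalized_dist p f) \<longlongrightarrow> Ainf_dist \<Omega> f) at_top"
  proof (rule order_tendstoI)
    fix a assume "a < Ainf_dist \<Omega> f"
    from order_tendstoD(1)[OF q(2) this] obtain j where j: "a < normalized_dist (q j) f"
      by (auto simp: eventually_sequentially)
    have "a < normalized_dist p f" if "p \<ge> q j" for p
      using j normalized_dist_mono[OF f, of "q j" p] q(1)[of j] that by simp
    then show "\<forall>\<^sub>F p in at_top. a < normalized_dist p f" by (auto simp: eventually_at_top_linorder)
  next
    fix a assume "Ainf_dist \<Omega> f < a"
    then have "normalized_dist p f < a" if "p > 0" for p
      using normalized_dist_le[OF f that] by simp
    then show "\<forall>\<^sub>F p in at_top. normalized_dist p f < a"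
      by (rule eventually_mono[OF eventually_gt_at_top[of 0]])
  qed
  have "((\<lambda>p::real. vol powr (1/p)) \<longlongrightarrow> vol powr 0) at_top"
    using vol_pos by (intro tendsto_powr tendsto_const tendsto_divide_0[OF tendsto_const]
      filterlim_at_top_imp_at_infinity filterlim_ident) auto
  from tendsto_mult[OF this N] have "((\<lambda>p. vol powr (1/p) * normalized_dist p f) \<longlongrightarrow> Ainf_dist \<Omega> f) at_top"
    using vol_pos by simp
  moreover have "vol powr (1/p) * normalized_dist p f = Ap_dist \<Omega> p f" for p
    using vol_pos by (simp add: normalized_dist_def powr_minus)
  ultimately show ?thesis by simp
qed

end

section \<open>Smooth functions with compact support\<close>

subsection \<open>Closure properties\<close>

lemma C_k_SucI:
  assumes "\<And>x. (f has_derivative f' x) (at x)" and "\<And>v. C_k k (\<lambda>x. f' x v)"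
  shows "C_k (Suc k) f"
proof -
  have "frechet_derivative f (at x) = f' x" for x
    using frechet_derivative_at[OF assms(1)] by simp
  then show ?thesis using assms by (auto simp: differentiable_def)
qed

lemma C_k_SucD: "C_k (Suc k) f \<Longrightarrow> (f has_derivative frechet_derivative f (at x)) (at x)"
  by (simp add: frechet_derivative_works)

lemma C_k_Suc_imp: "C_k (Suc k) f \<Longrightarrow> C_k k f"
proof (induction k arbitrary: f)
  case 0
  then show ?case
    by (auto intro!: continuous_at_imp_continuous_on differentiable_imp_continuous_within)
qed auto

lemma C_k_imp_continuous: "C_k k f \<Longrightarrow> continuous_on UNIV f"
  by (cases k) (auto intro!: continuous_at_imp_continuous_on differentiable_imp_continuous_within)

lemma C_k_const: "C_k k (\<lambda>x. c)"
  by (induction k arbitrary: c) (auto simp: frechet_derivative_const)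

lemma C_k_bounded_linear:
  assumes "bounded_linear f" shows "C_k k f"
proof (cases k)
  case 0
  then show ?thesis using assms linear_continuous_on by auto
next
  case (Suc m)
  show ?thesis unfolding Suc
    by (rule C_k_SucI[where f'="\<lambda>x. f"]) (use assms in \<open>auto intro: bounded_linear_imp_has_derivative C_k_const\<close>)
qed

lemma C_k_add: "C_k k f \<Longrightarrow> C_k k g \<Longrightarrow> C_k k (\<lambda>x. f x + g x)"
proof (induction k arbitrary: f g)
  case 0
  then show ?case by (auto intro: continuous_on_add)
next
  case (Suc k)
  show ?case
  proof (rule C_k_SucI)
    show "((\<lambda>x. f x + g x) has_derivative (\<lambda>v. frechet_derivative f (at x) v + frechet_derivative g (at x) v)) (at x)" for x
      by (intro has_derivative_add C_k_SucD[OF Suc.prems(1)] C_k_SucD[OF Suc.prems(2)])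
    show "C_k k (\<lambda>x. frechet_derivative f (at x) v + frechet_derivative g (at x) v)" for v
      using Suc.prems by (intro Suc.IH) auto
  qed
qed

lemma C_k_mult:
  fixes f g :: "'a::real_normed_vector \<Rightarrow> 'b::real_normed_algebra"
  shows "C_k k f \<Longrightarrow> C_k k g \<Longrightarrow> C_k k (\<lambda>x. f x * g x)"
proof (induction k arbitrary: f g)
  case 0
  then show ?case by (auto intro: continuous_on_mult)
next
  case (Suc k)
  show ?case
  proof (rule C_k_SucI)
    show "((\<lambda>x. f x * g x) has_derivative (\<lambda>v. f x * frechet_derivative g (at x) v + frechet_derivative f (at x) v * g x)) (at x)" for x
      by (intro has_derivative_mult C_k_SucD[OF Suc.prems(1)] C_k_SucD[OF Suc.prems(2)])
    show "C_k k (\<lambda>x. f x * frechet_derivative g (at x) v + frechet_derivative f (at x) v * g x)" for v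
      using Suc.prems by (intro C_k_add Suc.IH C_k_Suc_imp[of k f] C_k_Suc_imp[of k g]) auto
  qed
qed

subsection \<open>The flat functions\<close>

text \<open>The derivatives of \<open>exp (- 1/t)\<close> on the positive half-line are linear combinations of the
  functions \<open>flat m\<close>.\<close>

definition flat :: "nat \<Rightarrow> real \<Rightarrow> real" where
  "flat m t = (if t > 0 then inverse t ^ m * exp (- inverse t) else 0)"

lemma flat_nonneg: "flat m t \<ge> 0" and flat_pos: "t > 0 \<Longrightarrow> flat m t > 0"
  and flat_eq_0: "t \<le> 0 \<Longrightarrow> flat m t = 0"
  by (auto simp: flat_def)

lemma flat_tendsto_0: "((\<lambda>t. flat m t) \<longlongrightarrow> 0) (at_right 0)"
proof -
  have "((\<lambda>x. x ^ m / exp x) \<longlongrightarrow> (0::real)) at_top" by (rule tendsto_power_div_exp_0)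
  moreover have "\<forall>\<^sub>F x in at_top. x ^ m / exp x = flat m (inverse x)"
    using eventually_gt_at_top[of 0] by eventually_elim (simp add: flat_def exp_minus divide_inverse)
  ultimately have "((\<lambda>x. flat m (inverse x)) \<longlongrightarrow> 0) at_top" by (rule Lim_transform_eventually)
  then show ?thesis by (simp add: filterlim_at_right_to_top)
qed

lemma flat_has_derivative:
  "(flat m has_real_derivative (- real m * flat (Suc m) t + flat (Suc (Suc m)) t)) (at t)"
proof -
  consider "t > 0" | "t < 0" | "t = 0" by linarith
  then show ?thesis
  proof cases
    case 1
    have "((\<lambda>t. inverse t ^ m * exp (- inverse t)) has_real_derivative (- real m * flat (Suc m) t + flat (Suc (Suc m)) t)) (at t)"
    proof (rule DERIV_cong)
      show "((\<lambda>t. inverse t ^ m * exp (- inverse t)) has_real_derivative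
        real m * inverse t ^ (m - 1) * (- (inverse t * inverse t)) * exp (- inverse t)
        + inverse t ^ m * (exp (- inverse t) * (inverse t * inverse t))) (at t)"
        using 1 by (auto intro!: derivative_eq_intros simp: algebra_simps)
      show "real m * inverse t ^ (m - 1) * (- (inverse t * inverse t)) * exp (- inverse t)
        + inverse t ^ m * (exp (- inverse t) * (inverse t * inverse t))
        = - real m * flat (Suc m) t + flat (Suc (Suc m)) t"
        using 1 by (cases m) (simp_all add: flat_def algebra_simps)
    qed
    then show ?thesis
      by (rule has_field_derivative_transform_within_open[of _ _ _ "{0<..}"]) (use 1 in \<open>auto simp: flat_def\<close>)
  next
    case 2
    have "((\<lambda>t. 0) has_real_derivative (- real m * flat (Suc m) t + flat (Suc (Suc m)) t)) (at t)"
      using 2 by (simp add: flat_def)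
    then show ?thesis
      by (rule has_field_derivative_transform_within_open[of _ _ _ "{..<0}"]) (use 2 in \<open>auto simp: flat_def\<close>)
  next
    case 3
    have "((\<lambda>h. (flat m (0 + h) - flat m 0) / h) \<longlongrightarrow> 0) (at 0)"
    proof (rule filterlim_split_at)
      have "\<forall>\<^sub>F h in at_left 0. (0::real) = (flat m (0 + h) - flat m 0) / h"
        by (auto simp: flat_def eventually_at intro!: exI[of _ 1])
      then show "((\<lambda>h. (flat m (0 + h) - flat m 0) / h) \<longlongrightarrow> 0) (at_left 0)"
        by (rule Lim_transform_eventually[OF tendsto_const])
      have "\<forall>\<^sub>F h in at_right 0. flat (Suc m) h = (flat m (0 + h) - flat m 0) / h"
        by (auto simp: flat_def divide_inverse eventually_at intro!: exI[of _ 1])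
      then show "((\<lambda>h. (flat m (0 + h) - flat m 0) / h) \<longlongrightarrow> 0) (at_right 0)"
        by (rule Lim_transform_eventually[OF flat_tendsto_0])
    qed
    then show ?thesis using 3 by (simp add: DERIV_def flat_def)
  qed
qed

lemma continuous_flat: "continuous_on S (flat m)"
  using flat_has_derivative by (blast intro: continuous_at_imp_continuous_on DERIV_isCont)

subsection \<open>Bump functions\<close>

text \<open>The derivatives of these radial functions, which are supported in the ball of radius \<open>r\<close>, are
  again such functions up to a linear factor; so their smoothness is proved for all \<open>m\<close> at once.\<close>

definition bump :: "nat \<Rightarrow> real \<Rightarrow> 'a::euclidean_space \<Rightarrow> real" where
  "bump m r x = flat m (r\<^sup>2 - x \<bullet> x)"

definition bump' :: "nat \<Rightarrow> real \<Rightarrow> 'a::euclidean_space \<Rightarrow> 'a \<Rightarrow> real" where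
  "bump' m r x v = (- real m * bump (Suc m) r x + bump (Suc (Suc m)) r x) * (- 2 * (x \<bullet> v))"

lemma bump_has_derivative: "(bump m r has_derivative bump' m r x) (at x)"
proof -
  have "((\<lambda>x. r\<^sup>2 - x \<bullet> x) has_derivative (\<lambda>v. - 2 * (x \<bullet> v))) (at x)"
    by (auto intro!: derivative_eq_intros simp: inner_commute)
  from has_derivative_compose[OF this flat_has_derivative[unfolded has_field_derivative_def], of m]
  show ?thesis unfolding bump_def[abs_def] bump'_def[abs_def] by simp
qed

lemma bump_nonneg: "bump m r x \<ge> 0"
  by (simp add: bump_def flat_nonneg)

lemma bump_pos: "norm x < r \<Longrightarrow> bump m r x > 0"
  unfolding bump_def power2_norm_eq_inner[symmetric] by (intro flat_pos) (simp add: power_strict_mono)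

lemma bump_outside: "r \<ge> 0 \<Longrightarrow> r \<le> norm x \<Longrightarrow> bump m r x = 0"
  unfolding bump_def power2_norm_eq_inner[symmetric] by (intro flat_eq_0) (simp add: power_mono)

lemma continuous_bump: "continuous_on S (bump m r)"
  using bump_has_derivative has_derivative_continuous by (blast intro: continuous_at_imp_continuous_on)

lemma C_k_bump: "C_k k (\<lambda>x::'a::euclidean_space. complex_of_real (bump m r (x - a)))"
proof (induction k arbitrary: m)
  case 0
  show ?case by (auto intro!: continuous_intros continuous_on_compose2[OF continuous_bump[of UNIV]])
next
  case (Suc k)
  show ?case
  proof (rule C_k_SucI)
    fix x :: 'a
    have "((\<lambda>x. x - a) has_derivative (\<lambda>v. v)) (at x)" by (auto intro!: derivative_eq_intros)
    from has_derivative_compose[OF this bump_has_derivative]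
    have "((\<lambda>x. bump m r (x - a)) has_derivative bump' m r (x - a)) (at x)" by simp
    then show "((\<lambda>x. complex_of_real (bump m r (x - a))) has_derivative (\<lambda>v. complex_of_real (bump' m r (x - a) v))) (at x)"
      by (rule has_derivative_of_real)
  next
    fix v :: 'a
    have eq: "(\<lambda>x. complex_of_real (bump' m r (x - a) v)) =
       (\<lambda>x. (complex_of_real (- real m) * complex_of_real (bump (Suc m) r (x - a)) + complex_of_real (bump (Suc (Suc m)) r (x - a)))
          * (complex_of_real (- 2 * (x \<bullet> v)) + complex_of_real (2 * (a \<bullet> v))))"
      by (auto simp: bump'_def inner_diff_left algebra_simps)
    have lin: "bounded_linear (\<lambda>x. complex_of_real (- 2 * (x \<bullet> v)))"
      by (intro bounded_linear_compose[OF bounded_linear_of_real] bounded_linear_compose[OF bounded_linear_mult_right]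
         bounded_linear_inner_left)
    show "C_k k (\<lambda>x. complex_of_real (bump' m r (x - a) v))"
      unfolding eq by (intro C_k_mult C_k_add C_k_const Suc.IH C_k_bounded_linear[OF lin])
  qed
qed

lemma bump_test_function:
  assumes r: "r > 0" and sub: "cball a r \<subseteq> \<Omega>"
  shows "(\<lambda>x. complex_of_real (bump m r (x - a))) \<in> test_functions \<Omega>"
proof -
  have "{x. complex_of_real (bump m r (x - a)) \<noteq> 0} \<subseteq> cball a r"
  proof
    fix x assume "x \<in> {x. complex_of_real (bump m r (x - a)) \<noteq> 0}"
    then have "\<not> r \<le> norm (x - a)" using bump_outside[of r "x - a" m] r by auto
    then show "x \<in> cball a r" by (simp add: dist_norm norm_minus_commute)
  qed
  then have cl: "closure {x. complex_of_real (bump m r (x - a)) \<noteq> 0} \<subseteq> cball a r"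
    by (rule closure_minimal) simp
  then have "compact (closure {x. complex_of_real (bump m r (x - a)) \<noteq> 0})"
    using bounded_subset[OF bounded_cball cl] by (simp add: compact_eq_bounded_closed)
  with cl sub show ?thesis unfolding test_functions_def using C_k_bump by blast
qed

section \<open>Integration by parts\<close>

text \<open>Translation invariance makes the integral of every difference quotient vanish.\<close>

lemma integral_directional_derivative_zero:
  fixes u :: "'a::euclidean_space \<Rightarrow> complex"
  assumes der: "\<And>x. (u has_derivative u' x) (at x)" and bd: "\<And>x. norm (u' x v) \<le> B"
    and supp: "\<And>x. norm x > R \<Longrightarrow> u x = 0"
  shows "(\<lambda>x. u' x v) \<in> borel_measurable borel" "integrable lborel (\<lambda>x. u' x v)" "integral\<^sup>L lborel (\<lambda>x. u' x v) = 0"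
proof -
  define q where "q = (\<lambda>n x. (u (x + (1 / real (Suc n)) *\<^sub>R v) - u x) * of_real (real (Suc n)))"
  have cont: "continuous_on UNIV u"
    using der has_derivative_continuous by (blast intro: continuous_at_imp_continuous_on)
  have um[measurable]: "u \<in> borel_measurable borel" by (rule borel_measurable_continuous_onI[OF cont])
  have qm[measurable]: "q n \<in> borel_measurable borel" for n unfolding q_def by measurable
  have line: "((\<lambda>t. u (x + t *\<^sub>R v)) has_vector_derivative u' (x + t *\<^sub>R v) v) (at t)" for x and t :: real
  proof -
    have "((\<lambda>t. x + t *\<^sub>R v) has_derivative (\<lambda>s. s *\<^sub>R v)) (at t)" by (auto intro!: derivative_eq_intros)
    from has_derivative_compose[OF this der]
    have "((\<lambda>t. u (x + t *\<^sub>R v)) has_derivative (\<lambda>s. u' (x + t *\<^sub>R v) (s *\<^sub>R v))) (at t)" .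
    moreover have "linear (u' (x + t *\<^sub>R v))" using der has_derivative_linear by blast
    ultimately show ?thesis by (simp add: has_vector_derivative_def linear_cmul)
  qed
  have q_lim: "(\<lambda>n. q n x) \<longlonglongrightarrow> u' x v" for x
  proof (cases "v = 0")
    case True
    have "u' x 0 = 0" using der has_derivative_linear linear_0 by blast
    then show ?thesis using True by (simp add: q_def)
  next
    case False
    define h where "h = (\<lambda>n. (1 / real (Suc n)) *\<^sub>R v)"
    have lin: "linear (u' x)" using der has_derivative_linear by blast
    have "(\<lambda>n. 1 / real (Suc n)) \<longlonglongrightarrow> 0"
      using LIMSEQ_inverse_real_of_nat by (simp add: divide_inverse)
    from tendsto_scaleR[OF this tendsto_const, of v] have "h \<longlonglongrightarrow> 0" by (simp add: h_def)
    then have "filterlim h (at 0) sequentially"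
      using False by (auto simp: filterlim_at h_def)
    moreover have "((\<lambda>h. norm (u (x + h) - u x - u' x h) / norm h) \<longlongrightarrow> 0) (at 0)"
      using der[of x] by (simp add: has_derivative_at)
    ultimately have "(\<lambda>n. norm (u (x + h n) - u x - u' x (h n)) / norm (h n)) \<longlonglongrightarrow> 0"
      by (rule filterlim_compose[rotated])
    from tendsto_mult_left[OF this, of "norm v"]
    have "(\<lambda>n. norm v * (norm (u (x + h n) - u x - u' x (h n)) / norm (h n))) \<longlonglongrightarrow> 0" by simp
    moreover have "norm v * (norm (u (x + h n) - u x - u' x (h n)) / norm (h n)) = norm (q n x - u' x v)" for n
    proof -
      have "q n x - u' x v = (u (x + h n) - u x - u' x (h n)) * of_real (real (Suc n))"
        by (simp add: q_def h_def linear_cmul[OF lin] left_diff_distrib scaleR_conv_of_real del: of_nat_Suc)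
      then have "norm (q n x - u' x v) = norm (u (x + h n) - u x - u' x (h n)) * real (Suc n)"
        by (simp only: norm_mult norm_of_real abs_of_nat)
      then show ?thesis using False by (simp add: h_def del: of_nat_Suc)
    qed
    ultimately have "(\<lambda>n. norm (q n x - u' x v)) \<longlonglongrightarrow> 0" by simp
    then show ?thesis by (simp add: LIM_zero_iff tendsto_norm_zero_iff)
  qed
  show meas: "(\<lambda>x. u' x v) \<in> borel_measurable borel"
    by (rule borel_measurable_LIMSEQ_metric[OF qm q_lim])
  have q_bd: "norm (q n x) \<le> B" for n x
  proof -
    have "norm (u (x + (1 / real (Suc n)) *\<^sub>R v) - u (x + 0 *\<^sub>R v)) \<le> B * norm (1 / real (Suc n) - 0 :: real)"
    proof (rule differentiable_bound[of UNIV "\<lambda>t. u (x + t *\<^sub>R v)" "\<lambda>t s. s *\<^sub>R u' (x + t *\<^sub>R v) v"])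
      show "onorm (\<lambda>s::real. s *\<^sub>R u' (x + t *\<^sub>R v) v) \<le> B" for t
      proof (rule onorm_bound)
        show "B \<ge> 0" using bd[of x] norm_ge_zero order_trans by blast
        show "norm (s *\<^sub>R u' (x + t *\<^sub>R v) v) \<le> B * norm s" for s :: real
          using mult_right_mono[OF bd[of "x + t *\<^sub>R v"], of "\<bar>s\<bar>"] by (simp add: mult.commute)
      qed
    qed (use line in \<open>auto simp: has_vector_derivative_def intro: has_derivative_at_withinI\<close>)
    then have "norm (u (x + (1 / real (Suc n)) *\<^sub>R v) - u x) * real (Suc n) \<le> B"
      by (simp add: pos_le_divide_eq)
    then show ?thesis unfolding q_def by (simp only: norm_mult norm_of_real abs_of_nat)
  qed
  have q_supp: "q n x = 0" if "norm x > R + norm v" for n x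
  proof -
    have "norm x \<le> norm (x + (1 / real (Suc n)) *\<^sub>R v) + norm ((1 / real (Suc n)) *\<^sub>R v)"
      using norm_triangle_ineq4[of "x + (1 / real (Suc n)) *\<^sub>R v" "(1 / real (Suc n)) *\<^sub>R v"] by simp
    moreover have "norm ((1 / real (Suc n)) *\<^sub>R v) \<le> norm v"
      by (simp add: divide_le_eq mult_le_cancel_left1)
    ultimately have "norm (x + (1 / real (Suc n)) *\<^sub>R v) > R" "norm x > R" using that norm_ge_zero[of v] by linarith+
    then show ?thesis by (simp add: q_def supp)
  qed
  have dom: "integrable lborel (\<lambda>x. indicator (cball 0 (R + norm v)) x * B)"
    by (intro integrable_mult_left integrable_real_indicator) (use emeasure_bounded_finite[OF bounded_cball] in auto)
  have dom_q: "AE x in lborel. norm (q n x) \<le> indicator (cball 0 (R + norm v)) x * B" for n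
    using q_bd q_supp by (auto simp: indicator_def not_le)
  have meas': "(\<lambda>x. u' x v) \<in> borel_measurable lborel" "\<And>n. q n \<in> borel_measurable lborel"
    using meas qm by simp_all
  have ae_lim: "AE x in lborel. (\<lambda>n. q n x) \<longlonglongrightarrow> u' x v" using q_lim by simp
  show "integrable lborel (\<lambda>x. u' x v)"
    by (rule integrable_dominated_convergence[OF meas' dom ae_lim dom_q])
  have lim: "(\<lambda>n. integral\<^sup>L lborel (q n)) \<longlonglongrightarrow> integral\<^sup>L lborel (\<lambda>x. u' x v)"
    by (rule integral_dominated_convergence[OF meas' dom ae_lim dom_q])
  have "integral\<^sup>L lborel (q n) = 0" for n
  proof -
    define c where "c = (1 / real (Suc n)) *\<^sub>R v"
    have "integrable lborel (\<lambda>x. indicator (cball 0 R) x *\<^sub>R u x)"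
      by (rule borel_integrable_compact) (auto intro: continuous_on_subset[OF cont])
    moreover have "indicator (cball 0 R) x *\<^sub>R u x = u x" for x
      using supp[of x] by (auto simp: indicator_def)
    ultimately have iu: "integrable lborel u" by simp
    then have "integrable (distr lborel borel ((+) c)) u" by (simp add: lborel_distr_plus)
    then have iuc: "integrable lborel (\<lambda>x. u (c + x))" by (subst (asm) integrable_distr_eq) auto
    have "integral\<^sup>L lborel (\<lambda>x. u (c + x)) = integral\<^sup>L (distr lborel borel ((+) c)) u"
      by (rule integral_distr[symmetric]) auto
    then have "integral\<^sup>L lborel (\<lambda>x. u (c + x)) = integral\<^sup>L lborel u" by (simp add: lborel_distr_plus)
    then show ?thesis unfolding q_def c_def[symmetric]
      using iu iuc by (simp add: add.commute)
  qed
  then show "integral\<^sup>L lborel (\<lambda>x. u' x v) = 0" using lim by (simp add: LIMSEQ_const_iff)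
qed

lemma axis_smult: "axis j c = c *s axis j (1::complex)"
  by (simp add: vec_eq_iff axis_def)

lemma bounded_image_compact:
  fixes f :: "'a::topological_space \<Rightarrow> 'b::real_normed_vector"
  assumes "compact K" "continuous_on K f"
  shows "\<exists>B. \<forall>x\<in>K. norm (f x) \<le> B"
  using compact_imp_bounded[OF compact_continuous_image[OF assms(2,1)]] by (auto simp: bounded_iff)

text \<open>The product \<open>H \<phi>\<close>, extended by zero, is differentiable on the whole space, and its derivative
  with respect to the conjugate of the \<open>j\<close>-th coordinate is \<open>H\<close> times that of \<open>\<phi>\<close>.\<close>

theorem integral_holo_wirtinger_bar:
  fixes \<Omega> :: "(complex^'n::finite) set"
  assumes \<Omega>: "open \<Omega>" and H: "holo_on \<Omega> H" and \<phi>: "\<phi> \<in> test_functions \<Omega>"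
  shows "integral\<^sup>L (lebesgue_on \<Omega>) (\<lambda>z. H z * wirtinger_bar j \<phi> z) = 0"
proof -
  define K where "K = closure {z. \<phi> z \<noteq> 0}"
  have K: "compact K" "K \<subseteq> \<Omega>" and smooth: "C_k k \<phi>" for k
    using \<phi> by (auto simp: test_functions_def K_def)
  have out: "\<phi> z = 0" if "z \<notin> K" for z using that closure_subset[of "{z. \<phi> z \<noteq> 0}"] by (auto simp: K_def)
  define d\<phi> where "d\<phi> = (\<lambda>z. frechet_derivative \<phi> (at z))"
  define dH where "dH = (\<lambda>z. frechet_derivative H (at z))"
  have d\<phi>: "(\<phi> has_derivative d\<phi> z) (at z)" for z
    unfolding d\<phi>_def by (rule C_k_SucD[OF smooth[of "Suc 0"]])
  have dH: "complex_deriv H z (dH z)" if "z \<in> \<Omega>" for z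
    unfolding dH_def by (rule complex_deriv_frechet[OF H that])
  have oK: "open (- K)" using compact_imp_closed[OF K(1)] by (simp add: open_Compl)
  have d\<phi>_out: "d\<phi> z v = 0" if "z \<notin> K" for z v
  proof -
    have "((\<lambda>z. 0) has_derivative (\<lambda>v. 0)) (at z)" by (rule has_derivative_const)
    then have "(\<phi> has_derivative (\<lambda>v. 0)) (at z)"
      by (rule has_derivative_transform_within_open[OF _ oK]) (use that out in auto)
    then have "d\<phi> z = (\<lambda>v. 0)" using has_derivative_unique[OF d\<phi>] by blast
    then show ?thesis by simp
  qed
  define u where "u = (\<lambda>z. if z \<in> \<Omega> then H z * \<phi> z else 0)"
  define u' where "u' = (\<lambda>z v. if z \<in> \<Omega> then H z * d\<phi> z v + dH z v * \<phi> z else 0)"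
  have der: "(u has_derivative u' z) (at z)" for z
  proof (cases "z \<in> \<Omega>")
    case True
    have "((\<lambda>z. H z * \<phi> z) has_derivative (\<lambda>v. H z * d\<phi> z v + dH z v * \<phi> z)) (at z)"
      by (rule has_derivative_mult[OF complex_derivD(1)[OF dH[OF True]] d\<phi>])
    then have "(u has_derivative (\<lambda>v. H z * d\<phi> z v + dH z v * \<phi> z)) (at z)"
      by (rule has_derivative_transform_within_open[OF _ \<Omega> True]) (simp add: u_def)
    moreover have "u' z = (\<lambda>v. H z * d\<phi> z v + dH z v * \<phi> z)" using True by (auto simp: u'_def)
    ultimately show ?thesis by simp
  next
    case False
    have "((\<lambda>z. 0) has_derivative (\<lambda>v. 0)) (at z)" by (rule has_derivative_const)
    then have "(u has_derivative (\<lambda>v. 0)) (at z)"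
      by (rule has_derivative_transform_within_open[OF _ oK]) (use False K out in \<open>auto simp: u_def\<close>)
    moreover have "u' z = (\<lambda>v. 0)" using False by (auto simp: u'_def)
    ultimately show ?thesis by simp
  qed
  \<comment> \<open>A uniform distance from the support to the boundary bounds the derivative of \<open>H\<close> by Cauchy's estimate.\<close>
  obtain e where e: "e > 0" "(\<Union>x\<in>K. cball x e) \<subseteq> \<Omega>"
    by (rule compact_subset_open_imp_cball_epsilon_subset[OF K(1) \<Omega> K(2)])
  have contH: "continuous_on \<Omega> H" by (rule holo_on_imp_continuous_on[OF H])
  obtain M where M: "\<And>x. x \<in> (\<Union>x\<in>K. cball x e) \<Longrightarrow> norm (H x) \<le> M"
    using bounded_image_compact[OF compact_minkowski_sum_cball[OF K(1)] continuous_on_subset[OF contH e(2)]] by blast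
  obtain M\<phi> where M\<phi>: "\<And>x. x \<in> K \<Longrightarrow> norm (\<phi> x) \<le> M\<phi>"
    using bounded_image_compact[OF K(1) continuous_on_subset[OF C_k_imp_continuous[OF smooth[of 0]] subset_UNIV]] by blast
  have bd: "\<exists>B. \<forall>z. norm (u' z v) \<le> B" for v
  proof -
    have "C_k 0 (\<lambda>z. d\<phi> z v)" using smooth[of "Suc 0"] by (simp add: d\<phi>_def)
    then have "continuous_on K (\<lambda>z. d\<phi> z v)" by (auto intro: continuous_on_subset)
    then obtain M' where M': "\<And>x. x \<in> K \<Longrightarrow> norm (d\<phi> x v) \<le> M'"
      using bounded_image_compact[OF K(1)] by blast
    have "norm (u' z v) \<le> \<bar>M * M' + 2 * M / e * norm v * M\<phi>\<bar>" for z
    proof (cases "z \<in> K")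
      case True
      then have zO: "z \<in> \<Omega>" using K by blast
      have H_M: "norm (H z) \<le> M" using M True e(1) by force
      have "norm (dH z v) \<le> 2 * M / e * norm v"
      proof (rule several_Cauchy_estimate[OF _ _ e(1) dH[OF zO]])
        have "ball z e \<subseteq> (\<Union>x\<in>K. cball x e)" using True ball_subset_cball by blast
        then show "holo_on (ball z e) H" "\<And>w. w \<in> ball z e \<Longrightarrow> norm (H w) \<le> M"
          using e(2) M by (blast intro: holo_on_subset[OF H])+
      qed
      then have "norm (dH z v) * norm (\<phi> z) \<le> 2 * M / e * norm v * M\<phi>"
        using M\<phi>[OF True] by (intro mult_mono) (auto intro: order_trans[OF norm_ge_zero])
      moreover have "norm (H z) * norm (d\<phi> z v) \<le> M * M'"
        using M'[OF True] H_M by (intro mult_mono) (auto intro: order_trans[OF norm_ge_zero])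
      moreover have "norm (u' z v) \<le> norm (H z) * norm (d\<phi> z v) + norm (dH z v) * norm (\<phi> z)"
        using zO norm_triangle_ineq[of "H z * d\<phi> z v" "dH z v * \<phi> z"] by (simp add: u'_def norm_mult)
      ultimately show ?thesis by linarith
    next
      case False
      then show ?thesis using out d\<phi>_out by (simp add: u'_def)
    qed
    then show ?thesis by blast
  qed
  obtain R where R: "\<And>x. x \<in> K \<Longrightarrow> norm x \<le> R"
    using compact_imp_bounded[OF K(1)] by (auto simp: bounded_iff)
  have supp: "u x = 0" if "norm x > R" for x using out R that by (force simp: u_def)
  have I: "(\<lambda>x. u' x v) \<in> borel_measurable borel" "integrable lborel (\<lambda>x. u' x v)" "integral\<^sup>L lborel (\<lambda>x. u' x v) = 0" for v
  proof -
    obtain B where B: "\<And>z. norm (u' z v) \<le> B" using bd by blast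
    show "(\<lambda>x. u' x v) \<in> borel_measurable borel" "integrable lborel (\<lambda>x. u' x v)" "integral\<^sup>L lborel (\<lambda>x. u' x v) = 0"
      using integral_directional_derivative_zero[OF der B supp] by auto
  qed
  have pt: "indicator \<Omega> z *\<^sub>R (H z * wirtinger_bar j \<phi> z) = (1/2) * (u' z (axis j 1) + \<i> * u' z (axis j \<i>))" for z
  proof (cases "z \<in> \<Omega>")
    case True
    have "dH z (axis j \<i>) = \<i> * dH z (axis j 1)"
      using complex_derivD(2)[OF dH[OF True], of \<i> "axis j 1"] by (simp add: axis_smult[of j \<i>])
    then have "\<i> * (dH z (axis j \<i>) * \<phi> z) = - (dH z (axis j 1) * \<phi> z)" by (simp flip: mult.assoc)
    moreover have "wirtinger_bar j \<phi> z = (d\<phi> z (axis j 1) + \<i> * d\<phi> z (axis j \<i>)) / 2"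
      by (simp add: wirtinger_bar_def d\<phi>_def)
    ultimately show ?thesis using True by (simp add: u'_def field_simps)
  qed (simp add: u'_def)
  have "integral\<^sup>L (lebesgue_on \<Omega>) (\<lambda>z. H z * wirtinger_bar j \<phi> z)
      = integral\<^sup>L lebesgue (\<lambda>z. indicator \<Omega> z *\<^sub>R (H z * wirtinger_bar j \<phi> z))"
    using \<Omega> by (intro integral_restrict_space) simp
  also have "\<dots> = integral\<^sup>L lborel (\<lambda>z. (1/2) * (u' z (axis j 1) + \<i> * u' z (axis j \<i>)))"
    unfolding pt by (intro integral_completion borel_measurable_times borel_measurable_add
      borel_measurable_const borel_measurable_integrable[OF I(2)])
  also have "\<dots> = 0" using I(2,3) by simp
  finally show ?thesis .
qed

section \<open>Weyl's lemma for the Cauchy-Riemann operator\<close>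

subsection \<open>Mollification\<close>

lemma bump_bounded: "\<exists>M\<ge>0. \<forall>x. bump m r x \<le> M"
proof -
  obtain M where M: "\<And>t. t \<in> {0..r\<^sup>2} \<Longrightarrow> norm (flat m t) \<le> M"
    using bounded_image_compact[OF compact_Icc continuous_flat] by metis
  have "bump m r x \<le> \<bar>M\<bar>" for x
    using M[of "r\<^sup>2 - x \<bullet> x"] flat_eq_0[of "r\<^sup>2 - x \<bullet> x" m] by (cases "r\<^sup>2 - x \<bullet> x \<ge> 0") (auto simp: bump_def)
  then show ?thesis by (intro exI[of _ "\<bar>M\<bar>"]) auto
qed

lemma bump_commute: "bump m r (x - y) = bump m r (y - x)"
  by (simp add: bump_def inner_diff_left inner_diff_right algebra_simps)

lemma bump'_bounded:
  assumes r: "r > 0" shows "\<exists>B. \<forall>x v. norm (bump' 0 r x v) \<le> B * norm v"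
proof -
  obtain M where M: "M \<ge> 0" "\<And>x::'a. bump 2 r x \<le> M" using bump_bounded by blast
  have "norm (bump' 0 r x v) \<le> (2 * M * r) * norm v" for x v :: 'a
  proof (cases "norm x \<ge> r")
    case True
    then show ?thesis using bump_outside[of r x 2] r M by (simp add: bump'_def numeral_2_eq_2)
  next
    case False
    have "\<bar>x \<bullet> v\<bar> \<le> norm x * norm v" by (rule Cauchy_Schwarz_ineq2)
    also have "\<dots> \<le> r * norm v" using False by (intro mult_right_mono) auto
    finally have "bump 2 r x * (2 * \<bar>x \<bullet> v\<bar>) \<le> M * (2 * (r * norm v))"
      using M by (intro mult_mono) auto
    then show ?thesis using bump_nonneg[of 2 r x] by (simp add: bump'_def abs_mult numeral_2_eq_2 mult_ac)
  qed
  then show ?thesis by blast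
qed

lemma continuous_bump': "continuous_on S (\<lambda>x. bump' m r x v)"
  unfolding bump'_def by (intro continuous_intros continuous_bump)

lemma borel_measurable_bump [measurable]: "bump m r \<in> borel_measurable borel"
  by (rule borel_measurable_continuous_onI[OF continuous_bump])

text \<open>The difference quotients of the kernel are bounded by its Lipschitz constant \<open>B\<close>, so dominated
  convergence applies along every sequence of increments.\<close>

lemma convolution_has_derivative:
  fixes h :: "'a::euclidean_space \<Rightarrow> complex" and k :: "'a \<Rightarrow> real"
  assumes h: "integrable lborel h" and der: "\<And>x. (k has_derivative k' x) (at x)"
    and bd': "\<And>x v. norm (k' x v) \<le> B * norm v" and bd: "\<And>x. norm (k x) \<le> B0"
    and cont': "\<And>v. continuous_on UNIV (\<lambda>x. k' x v)"
  shows "((\<lambda>z. \<integral>w. h w * of_real (k (z - w)) \<partial>lborel) has_derivative (\<lambda>v. \<integral>w. h w * of_real (k' (z - w) v) \<partial>lborel)) (at z)"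
proof -
  have hm[measurable]: "h \<in> borel_measurable borel" using h by auto
  have km[measurable]: "k \<in> borel_measurable borel"
    using der has_derivative_continuous by (blast intro: borel_measurable_continuous_onI continuous_at_imp_continuous_on)
  have k'm[measurable]: "(\<lambda>x. k' x v) \<in> borel_measurable borel" for v
    by (rule borel_measurable_continuous_onI[OF cont'])
  have lin: "linear (k' x)" for x using der has_derivative_linear by blast
  have mk[measurable]: "(\<lambda>w. k (y - w)) \<in> borel_measurable borel" "(\<lambda>w. k' (y - w) v) \<in> borel_measurable borel" for y v
    by (rule measurable_compose[OF _ km], simp) (rule measurable_compose[OF _ k'm], simp)
  have int_bd: "integrable lborel (\<lambda>w. h w * of_real (g w))"
    if [measurable]: "g \<in> borel_measurable borel" and g: "\<And>w. norm (g w) \<le> C" for g :: "'a \<Rightarrow> real" and C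
  proof (rule Bochner_Integration.integrable_bound)
    show "integrable lborel (\<lambda>w. h w * of_real C)" using h by simp
    have "norm (h w * of_real (g w)) \<le> norm (h w * of_real C)" for w
      using g[of w] by (auto simp: norm_mult intro!: mult_left_mono)
    then show "AE w in lborel. norm (h w * of_real (g w)) \<le> norm (h w * of_real C)" by simp
  qed measurable
  have i1: "integrable lborel (\<lambda>w. h w * of_real (k (y - w)))" for y
    by (rule int_bd[of _ B0]) (use bd in auto)
  have i2: "integrable lborel (\<lambda>w. h w * of_real (k' (y - w) v))" for y v
    by (rule int_bd[of _ "B * norm v"]) (use bd' in auto)
  define D where "D = (\<lambda>v. \<integral>w. h w * of_real (k' (z - w) v) \<partial>lborel)"
  define K where "K = (\<lambda>z. \<integral>w. h w * of_real (k (z - w)) \<partial>lborel)"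
  have linD: "linear D"
  proof (rule linearI)
    show "D (v + w) = D v + D w" for v w
      unfolding D_def using i2 by (simp add: linear_add[OF lin] distrib_left)
    show "D (r *\<^sub>R v) = r *\<^sub>R D v" for r v
    proof -
      have "D (r *\<^sub>R v) = (\<integral>w. r *\<^sub>R (h w * of_real (k' (z - w) v)) \<partial>lborel)"
        unfolding D_def by (rule Bochner_Integration.integral_cong) (simp_all add: linear_cmul[OF lin] scaleR_conv_of_real)
      then show ?thesis by (simp add: D_def)
    qed
  qed
  have Lip: "norm (k (x + v) - k x) \<le> B * norm v" for x v
  proof -
    have "norm (k (x + v) - k x) \<le> B * norm ((x + v) - x)"
    proof (rule differentiable_bound[of UNIV k k'])
      show "onorm (k' x) \<le> B" for x
      proof (rule onorm_bound[OF _ bd'])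
        obtain b :: 'a where "b \<in> Basis" using nonempty_Basis by blast
        then show "B \<ge> 0" using order_trans[OF norm_ge_zero bd'[of x b]] by simp
      qed
    qed (use der in \<open>auto intro: has_derivative_at_withinI\<close>)
    then show ?thesis by simp
  qed
  have "((\<lambda>v. norm (K (z + v) - K z - D v) / norm v) \<longlongrightarrow> 0) (at 0)"
    unfolding tendsto_at_iff_sequentially
  proof (intro allI impI)
    fix X :: "nat \<Rightarrow> 'a" assume X0: "\<forall>i. X i \<in> UNIV - {0}" and X: "X \<longlonglongrightarrow> 0"
    define R where "R = (\<lambda>n w. (k (z - w + X n) - k (z - w) - k' (z - w) (X n)) / norm (X n))"
    have Rm[measurable]: "R n \<in> borel_measurable borel" for n
    proof -
      have "(\<lambda>w. k (z - w + X n)) \<in> borel_measurable borel" by (rule measurable_compose[OF _ km]) simp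
      then show ?thesis unfolding R_def by measurable
    qed
    have R_lim: "(\<lambda>n. R n w) \<longlonglongrightarrow> 0" for w
    proof -
      have "((\<lambda>v. norm (k (z - w + v) - k (z - w) - k' (z - w) v) / norm v) \<longlongrightarrow> 0) (at 0)"
        using der[of "z - w"] by (simp add: has_derivative_at)
      then have "(\<lambda>n. norm (k (z - w + X n) - k (z - w) - k' (z - w) (X n)) / norm (X n)) \<longlonglongrightarrow> 0"
        using X0 X unfolding tendsto_at_iff_sequentially by (auto simp: o_def)
      then have "(\<lambda>n. norm (R n w)) \<longlonglongrightarrow> 0" by (simp add: R_def)
      then show ?thesis by (simp only: tendsto_norm_zero_iff)
    qed
    have R_bd: "norm (R n w) \<le> 2 * B" for n w
    proof -
      have "norm (k (z - w + X n) - k (z - w) - k' (z - w) (X n)) \<le> B * norm (X n) + B * norm (X n)"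
        by (rule order_trans[OF norm_triangle_ineq4 add_mono[OF Lip bd']])
      then show ?thesis using X0 by (simp add: R_def divide_le_eq)
    qed
    have "(\<lambda>n. \<integral>w. h w * of_real (R n w) \<partial>lborel) \<longlonglongrightarrow> integral\<^sup>L (lborel :: 'a measure) (\<lambda>w. 0)"
    proof (rule integral_dominated_convergence)
      show "integrable lborel (\<lambda>w. norm (h w) * (2 * B))" using h by simp
      show "AE w in lborel. (\<lambda>n. h w * of_real (R n w)) \<longlonglongrightarrow> 0"
        using R_lim by (intro AE_I2 tendsto_mult_right_zero) (simp add: tendsto_of_real_iff[where c=0, simplified])
      show "AE w in lborel. norm (h w * of_real (R n w)) \<le> norm (h w) * (2 * B)" for n
        using R_bd[of n] by (auto simp: norm_mult intro!: mult_left_mono)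
    qed auto
    then have lim: "(\<lambda>n. norm (\<integral>w. h w * of_real (R n w) \<partial>lborel)) \<longlonglongrightarrow> 0" by (simp add: tendsto_norm_zero)
    have "norm (K (z + X n) - K z - D (X n)) / norm (X n) = norm (\<integral>w. h w * of_real (R n w) \<partial>lborel)" for n
    proof -
      have "(\<integral>w. h w * of_real (R n w) \<partial>lborel)
         = (\<integral>w. (h w * of_real (k (z + X n - w)) - h w * of_real (k (z - w)) - h w * of_real (k' (z - w) (X n))) / of_real (norm (X n)) \<partial>lborel)"
        by (rule Bochner_Integration.integral_cong) (simp_all add: R_def algebra_simps diff_divide_distrib)
      also have "\<dots> = (K (z + X n) - K z - D (X n)) / of_real (norm (X n))"
        using i1 i2 by (simp add: K_def D_def)
      finally show ?thesis by (simp add: norm_divide)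
    qed
    then show "((\<lambda>v. norm (K (z + v) - K z - D v) / norm v) \<circ> X) \<longlonglongrightarrow> 0"
      using lim by (simp add: o_def)
  qed
  then have "(K has_derivative D) (at z)"
    using linD by (simp add: has_derivative_at linear_conv_bounded_linear)
  then show ?thesis unfolding K_def D_def .
qed

text \<open>The mass depends on the dimension, which the type argument provides.\<close>

definition bump_mass :: "real \<Rightarrow> 'a::euclidean_space itself \<Rightarrow> real" where
  "bump_mass \<epsilon> _ = integral\<^sup>L lborel (bump 0 \<epsilon> :: 'a \<Rightarrow> real)"

lemma integrable_bump:
  assumes "\<epsilon> \<ge> 0" shows "integrable lborel (bump 0 \<epsilon> :: 'a::euclidean_space \<Rightarrow> real)"
proof -
  have "integrable lborel (\<lambda>x::'a. indicator (cball 0 \<epsilon>) x *\<^sub>R bump 0 \<epsilon> x)"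
    by (rule borel_integrable_compact[OF compact_cball continuous_bump])
  also have "(\<lambda>x::'a. indicator (cball 0 \<epsilon>) x *\<^sub>R bump 0 \<epsilon> x) = bump 0 \<epsilon>"
  proof
    fix x :: 'a show "indicator (cball 0 \<epsilon>) x *\<^sub>R bump 0 \<epsilon> x = bump 0 \<epsilon> x"
      using bump_outside[OF assms, of x 0] by (cases "norm x \<le> \<epsilon>") auto
  qed
  finally show ?thesis .
qed

lemma bump_mass_pos:
  assumes e: "\<epsilon> > 0" shows "bump_mass \<epsilon> TYPE('a::euclidean_space) > 0"
proof -
  have "bump_mass \<epsilon> TYPE('a) \<noteq> 0"
  proof
    assume "bump_mass \<epsilon> TYPE('a) = 0"
    then have "AE x in lborel. bump 0 \<epsilon> (x::'a) = 0"
      using integral_nonneg_eq_0_iff_AE[OF integrable_bump[of \<epsilon>]] e bump_nonneg by (auto simp: bump_mass_def)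
    then have "AE x in lborel. x \<notin> ball (0::'a) \<epsilon>"
      by (rule eventually_mono) (use bump_pos[of _ \<epsilon> 0] in force)
    then have "ball (0::'a) \<epsilon> \<in> null_sets lborel" by (subst AE_iff_null_sets) auto
    then have "measure lborel (ball (0::'a) \<epsilon>) = 0" by (simp add: null_sets_def measure_def)
    then show False using content_ball_pos[OF e, of "0::'a"] by simp
  qed
  moreover have "bump_mass \<epsilon> TYPE('a) \<ge> 0"
    unfolding bump_mass_def by (rule Bochner_Integration.integral_nonneg) (rule bump_nonneg)
  ultimately show ?thesis by simp
qed

lemma bump_translate:
  fixes z :: "'a::euclidean_space"
  assumes "\<epsilon> \<ge> 0"
  shows "integrable lborel (\<lambda>w. bump 0 \<epsilon> (w - z))"
    "integral\<^sup>L lborel (\<lambda>w. bump 0 \<epsilon> (w - z)) = bump_mass \<epsilon> TYPE('a)"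
proof -
  have eq: "(\<lambda>w. bump 0 \<epsilon> (w - z)) = (\<lambda>w. bump 0 \<epsilon> (- z + w))" by simp
  have "integrable (distr lborel borel ((+) (- z))) (bump 0 \<epsilon>)"
    using integrable_bump[OF assms] by (simp add: lborel_distr_plus)
  then show "integrable lborel (\<lambda>w. bump 0 \<epsilon> (w - z))"
    unfolding eq by (subst (asm) integrable_distr_eq) simp_all
  have "integral\<^sup>L lborel (\<lambda>w. bump 0 \<epsilon> (- z + w)) = integral\<^sup>L (distr lborel borel ((+) (- z))) (bump 0 \<epsilon>)"
    by (rule integral_distr[symmetric]) simp_all
  then show "integral\<^sup>L lborel (\<lambda>w. bump 0 \<epsilon> (w - z)) = bump_mass \<epsilon> TYPE('a)"
    unfolding eq by (simp add: lborel_distr_plus bump_mass_def)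
qed

definition mollify :: "real \<Rightarrow> ('a::euclidean_space \<Rightarrow> complex) \<Rightarrow> 'a \<Rightarrow> complex" where
  "mollify \<epsilon> h z = (\<integral>w. h w * of_real (bump 0 \<epsilon> (w - z)) \<partial>lborel) / of_real (bump_mass \<epsilon> TYPE('a))"

lemma integrable_mult_bump:
  fixes h :: "'a::euclidean_space \<Rightarrow> complex"
  assumes h: "integrable lborel h"
  shows "integrable lborel (\<lambda>w. h w * of_real (bump 0 \<epsilon> (w - z)))"
proof -
  obtain M where M: "M \<ge> 0" "\<And>x::'a. bump 0 \<epsilon> x \<le> M" using bump_bounded by blast
  have [measurable]: "h \<in> borel_measurable borel" using h by auto
  show ?thesis
  proof (rule Bochner_Integration.integrable_bound)
    show "integrable lborel (\<lambda>w. norm (h w) * M)" using h by simp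
    show "AE w in lborel. norm (h w * of_real (bump 0 \<epsilon> (w - z))) \<le> norm (norm (h w) * M)"
      using M by (intro AE_I2) (auto simp: norm_mult bump_nonneg intro!: mult_left_mono)
  qed measurable
qed

lemma mollify_has_derivative:
  fixes h :: "'a::euclidean_space \<Rightarrow> complex"
  assumes h: "integrable lborel h" and e: "\<epsilon> > 0"
  shows "(mollify \<epsilon> h has_derivative (\<lambda>v. (\<integral>w. h w * of_real (bump' 0 \<epsilon> (z - w) v) \<partial>lborel) / of_real (bump_mass \<epsilon> TYPE('a)))) (at z)"
proof -
  obtain B where B: "\<And>x v::'a. norm (bump' 0 \<epsilon> x v) \<le> B * norm v" using bump'_bounded[OF e] by blast
  obtain B0 where "\<And>x::'a. bump 0 \<epsilon> x \<le> B0" using bump_bounded by blast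
  then have B0: "norm (bump 0 \<epsilon> x) \<le> B0" for x :: 'a using bump_nonneg[of 0 \<epsilon> x] by simp
  have "((\<lambda>z. \<integral>w. h w * of_real (bump 0 \<epsilon> (z - w)) \<partial>lborel) has_derivative
      (\<lambda>v. \<integral>w. h w * of_real (bump' 0 \<epsilon> (z - w) v) \<partial>lborel)) (at z)"
    by (rule convolution_has_derivative[OF h bump_has_derivative B B0 continuous_bump'])
  from bounded_linear.has_derivative[OF bounded_linear_divide this, of "of_real (bump_mass \<epsilon> TYPE('a))"]
  have der: "((\<lambda>z. (\<integral>w. h w * of_real (bump 0 \<epsilon> (z - w)) \<partial>lborel) / of_real (bump_mass \<epsilon> TYPE('a))) has_derivative
      (\<lambda>v. (\<integral>w. h w * of_real (bump' 0 \<epsilon> (z - w) v) \<partial>lborel) / of_real (bump_mass \<epsilon> TYPE('a)))) (at z)" .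
  have "mollify \<epsilon> h = (\<lambda>z. (\<integral>w. h w * of_real (bump 0 \<epsilon> (z - w)) \<partial>lborel) / of_real (bump_mass \<epsilon> TYPE('a)))"
  proof
    fix z show "mollify \<epsilon> h z = (\<integral>w. h w * of_real (bump 0 \<epsilon> (z - w)) \<partial>lborel) / of_real (bump_mass \<epsilon> TYPE('a))"
      unfolding mollify_def by (simp only: bump_commute[of 0 \<epsilon> _ z])
  qed
  with der show ?thesis by simp
qed

lemma mollify_measurable:
  assumes h: "integrable lborel h" and e: "\<epsilon> > 0"
  shows "mollify \<epsilon> h \<in> borel_measurable borel"
  using mollify_has_derivative[OF assms] has_derivative_continuous
  by (blast intro: borel_measurable_continuous_onI continuous_at_imp_continuous_on)

text \<open>Young's inequality for the convolution with a probability density.\<close>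

lemma mollify_L1_le:
  fixes h :: "'a::euclidean_space \<Rightarrow> complex"
  assumes h: "integrable lborel h" and e: "\<epsilon> > 0"
  shows "(\<integral>\<^sup>+z. ennreal (norm (mollify \<epsilon> h z)) \<partial>lborel) \<le> (\<integral>\<^sup>+z. ennreal (norm (h z)) \<partial>lborel)"
proof -
  define c where "c = bump_mass \<epsilon> TYPE('a)"
  have c: "c > 0" unfolding c_def by (rule bump_mass_pos[OF e])
  have hm[measurable]: "h \<in> borel_measurable borel" using h by auto
  have pw: "ennreal (norm (mollify \<epsilon> h z)) \<le> (\<integral>\<^sup>+w. ennreal (norm (h w)) * ennreal (bump 0 \<epsilon> (w - z) / c) \<partial>lborel)" for z
  proof -
    have "mollify \<epsilon> h z = (\<integral>w. h w * of_real (bump 0 \<epsilon> (w - z)) / of_real c \<partial>lborel)"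
      by (simp add: mollify_def c_def)
    moreover have "integrable lborel (\<lambda>w. h w * of_real (bump 0 \<epsilon> (w - z)) / of_real c)"
      using integrable_mult_bump[OF h] by simp
    ultimately have "ennreal (norm (mollify \<epsilon> h z)) \<le> (\<integral>\<^sup>+w. ennreal (norm (h w * of_real (bump 0 \<epsilon> (w - z)) / of_real c)) \<partial>lborel)"
      using integral_norm_bound_ennreal by metis
    also have "\<dots> = (\<integral>\<^sup>+w. ennreal (norm (h w)) * ennreal (bump 0 \<epsilon> (w - z) / c) \<partial>lborel)"
      using c by (intro nn_integral_cong) (simp add: norm_mult norm_divide bump_nonneg ennreal_mult[symmetric])
    finally show ?thesis .
  qed
  have pair[measurable]: "(\<lambda>x. bump 0 \<epsilon> (snd x - fst x)) \<in> borel_measurable (lborel \<Otimes>\<^sub>M lborel :: ('a \<times> 'a) measure)"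
    by (rule measurable_compose[OF _ borel_measurable_bump]) measurable
  have "(\<integral>\<^sup>+z. ennreal (norm (mollify \<epsilon> h z)) \<partial>lborel)
      \<le> (\<integral>\<^sup>+z. (\<integral>\<^sup>+w. ennreal (norm (h w)) * ennreal (bump 0 \<epsilon> (w - z) / c) \<partial>lborel) \<partial>lborel)"
    by (rule nn_integral_mono) (rule pw)
  also have "\<dots> = (\<integral>\<^sup>+w. (\<integral>\<^sup>+z. ennreal (norm (h w)) * ennreal (bump 0 \<epsilon> (w - z) / c) \<partial>lborel) \<partial>lborel)"
    by (rule lborel_pair.Fubini'[symmetric]) (simp add: case_prod_unfold)
  also have "\<dots> = (\<integral>\<^sup>+w. ennreal (norm (h w)) \<partial>lborel)"
  proof (rule nn_integral_cong)
    fix w :: 'a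
    have [measurable]: "(\<lambda>z. bump 0 \<epsilon> (z - w)) \<in> borel_measurable borel"
      by (rule measurable_compose[OF _ borel_measurable_bump]) simp
    have "(\<integral>\<^sup>+z. ennreal (norm (h w)) * ennreal (bump 0 \<epsilon> (w - z) / c) \<partial>lborel)
        = ennreal (norm (h w)) * (\<integral>\<^sup>+z. ennreal (bump 0 \<epsilon> (z - w) / c) \<partial>lborel)"
      unfolding bump_commute[of 0 \<epsilon> w] by (rule nn_integral_cmult) measurable
    also have "(\<integral>\<^sup>+z. ennreal (bump 0 \<epsilon> (z - w) / c) \<partial>lborel) = ennreal (\<integral>z. bump 0 \<epsilon> (z - w) / c \<partial>lborel)"
      using bump_translate(1)[of \<epsilon> w] e c by (intro nn_integral_eq_integral) (auto simp: bump_nonneg)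
    also have "(\<integral>z. bump 0 \<epsilon> (z - w) / c \<partial>lborel) = 1"
      using bump_translate(2)[of \<epsilon> w] e c by (simp add: c_def)
    finally show "(\<integral>\<^sup>+z. ennreal (norm (h w)) * ennreal (bump 0 \<epsilon> (w - z) / c) \<partial>lborel) = ennreal (norm (h w))" by simp
  qed
  finally show ?thesis .
qed

lemma mollify_close:
  fixes g :: "'a::euclidean_space \<Rightarrow> complex"
  assumes g: "integrable lborel g" and e: "\<epsilon> > 0" and close: "\<And>w. dist w z < \<epsilon> \<Longrightarrow> norm (g w - a) \<le> \<eta>"
  shows "norm (mollify \<epsilon> g z - a) \<le> \<eta>"
proof -
  define c where "c = bump_mass \<epsilon> TYPE('a)"
  have c: "c > 0" unfolding c_def by (rule bump_mass_pos[OF e])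
  note b = bump_translate(1)[OF less_imp_le[OF e], of z] bump_translate(2)[OF less_imp_le[OF e], of z, folded c_def]
  have i1: "integrable lborel (\<lambda>w. a * complex_of_real (bump 0 \<epsilon> (w - z)))"
    using b(1) by (intro integrable_mult_right) (simp add: integrable_of_real)
  have i2: "integrable lborel (\<lambda>w. (g w - a) * of_real (bump 0 \<epsilon> (w - z)))"
    using Bochner_Integration.integrable_diff[OF integrable_mult_bump[OF g, of \<epsilon> z] i1] by (simp add: left_diff_distrib)
  have "(\<integral>w. (g w - a) * of_real (bump 0 \<epsilon> (w - z)) \<partial>lborel)
     = (\<integral>w. g w * of_real (bump 0 \<epsilon> (w - z)) \<partial>lborel) - (\<integral>w. a * of_real (bump 0 \<epsilon> (w - z)) \<partial>lborel)"
    using Bochner_Integration.integral_diff[OF integrable_mult_bump[OF g, of \<epsilon> z] i1] by (simp add: left_diff_distrib)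
  also have "(\<integral>w. a * of_real (bump 0 \<epsilon> (w - z)) \<partial>lborel) = a * of_real c"
    using b by (simp add: integral_of_real)
  finally have "mollify \<epsilon> g z - a = (\<integral>w. (g w - a) * of_real (bump 0 \<epsilon> (w - z)) \<partial>lborel) / of_real c"
    using c by (simp add: mollify_def c_def[symmetric] field_simps)
  then have "norm (mollify \<epsilon> g z - a) = norm (\<integral>w. (g w - a) * of_real (bump 0 \<epsilon> (w - z)) \<partial>lborel) / c"
    using c by (simp add: norm_divide)
  also have "norm (\<integral>w. (g w - a) * of_real (bump 0 \<epsilon> (w - z)) \<partial>lborel) \<le> (\<integral>w. \<eta> * bump 0 \<epsilon> (w - z) \<partial>lborel)"
  proof (rule Bochner_Integration.integral_norm_bound_integral[OF i2])
    show "integrable lborel (\<lambda>w. \<eta> * bump 0 \<epsilon> (w - z))" using b(1) by simp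
    fix w :: 'a
    show "norm ((g w - a) * of_real (bump 0 \<epsilon> (w - z))) \<le> \<eta> * bump 0 \<epsilon> (w - z)"
      using close[of w] bump_outside[of \<epsilon> "w - z" 0] e bump_nonneg[of 0 \<epsilon> "w - z"]
      by (cases "dist w z < \<epsilon>") (auto simp: norm_mult dist_norm intro!: mult_right_mono)
  qed
  also have "(\<integral>w. \<eta> * bump 0 \<epsilon> (w - z) \<partial>lborel) / c = \<eta>" using b c by simp
  finally show ?thesis using c by (simp add: divide_right_mono)
qed

lemma mollify_add:
  assumes "integrable lborel f" "integrable lborel g"
  shows "mollify \<epsilon> (\<lambda>w. f w + g w) z = mollify \<epsilon> f z + mollify \<epsilon> g z"
  using integrable_mult_bump[OF assms(1)] integrable_mult_bump[OF assms(2)]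
  by (simp add: mollify_def distrib_right add_divide_distrib)

subsection \<open>Approximation by continuous functions\<close>

text \<open>Truncation to a ball makes the function bounded; a Lebesgue measurable function is an almost
  everywhere limit of continuous functions, and dominated convergence applies.\<close>

lemma L1_continuous_approximation:
  fixes h :: "'a::euclidean_space \<Rightarrow> complex"
  assumes h: "integrable lborel h" and \<eta>: "\<eta> > 0"
  shows "\<exists>g. continuous_on UNIV g \<and>
    integral\<^sup>L lborel (\<lambda>x. indicator (cball 0 R) x * norm (h x - g x)) < \<eta>"
proof -
  define T where "T = (\<lambda>n::nat. closest_point (cball (0::complex) (real n)))"
  have T_cont: "continuous_on UNIV (T n)" for n
    unfolding T_def by (rule continuous_on_closest_point) auto
  have T_bd: "norm (T n y) \<le> real n" for n y
    using closest_point_in_set[of "cball (0::complex) (real n)" y] unfolding T_def by simp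
  have T_id: "T n y = y" if "norm y \<le> real n" for n y
    unfolding T_def by (rule closest_point_self) (use that in simp)
  have T_le: "norm (T n y) \<le> norm y" for n y
    using T_bd[of n y] T_id[of y n] by (cases "norm y \<le> real n") auto
  have hm[measurable]: "h \<in> borel_measurable borel" using h by auto
  have Tm[measurable]: "T n \<in> borel_measurable borel" for n by (rule borel_measurable_continuous_onI[OF T_cont])
  have "(\<lambda>n. integral\<^sup>L lborel (\<lambda>x. norm (h x - T n (h x)))) \<longlonglongrightarrow> integral\<^sup>L lborel (\<lambda>x::'a. 0)"
  proof (rule integral_dominated_convergence)
    show "integrable lborel (\<lambda>x. 2 * norm (h x))" using h by simp
    show "AE x in lborel. norm (norm (h x - T n (h x))) \<le> 2 * norm (h x)" for n
    proof (rule AE_I2)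
      fix x show "norm (norm (h x - T n (h x))) \<le> 2 * norm (h x)"
        using norm_triangle_ineq4[of "h x" "T n (h x)"] T_le[of n "h x"] by simp
    qed
    show "AE x in lborel. (\<lambda>n. norm (h x - T n (h x))) \<longlonglongrightarrow> 0"
    proof (rule AE_I2)
      fix x
      obtain N :: nat where "norm (h x) \<le> real N" using real_arch_simple by blast
      then have "\<forall>\<^sub>F n in sequentially. norm (h x - T n (h x)) = 0"
        unfolding eventually_sequentially by (intro exI[of _ N]) (auto intro!: T_id[symmetric])
      then show "(\<lambda>n. norm (h x - T n (h x))) \<longlonglongrightarrow> 0" by (rule tendsto_eventually)
    qed
  qed auto
  then have "\<forall>\<^sub>F n in sequentially. integral\<^sup>L lborel (\<lambda>x. norm (h x - T n (h x))) < \<eta> / 2"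
    using \<eta> by (intro order_tendstoD(2)[where y=0]) auto
  then obtain n where n: "integral\<^sup>L lborel (\<lambda>x. norm (h x - T n (h x))) < \<eta> / 2"
    by (auto simp: eventually_sequentially)
  define h' where "h' = (\<lambda>x. T n (h x))"
  have h'm[measurable]: "h' \<in> borel_measurable borel" unfolding h'_def by measurable
  have "h' \<in> borel_measurable lebesgue" by (rule measurable_completion) simp
  then have "h' measurable_on UNIV" by (rule lebesgue_measurable_imp_measurable_on) simp
  then obtain N g where N: "negligible N" and g: "\<And>m. continuous_on UNIV (g m)"
    and lim: "\<And>x. x \<notin> N \<Longrightarrow> (\<lambda>m. g m x) \<longlonglongrightarrow> h' x"
    unfolding measurable_on_def by auto
  define G where "G = (\<lambda>m x. T n (g m x))"
  have G_cont: "continuous_on UNIV (G m)" for m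
    unfolding G_def by (rule continuous_on_compose2[OF T_cont g]) simp
  have Gm[measurable]: "G m \<in> borel_measurable borel" for m by (rule borel_measurable_continuous_onI[OF G_cont])
  have G_lim: "(\<lambda>m. G m x) \<longlonglongrightarrow> h' x" if "x \<notin> N" for x
  proof -
    have "isCont (T n) (h' x)" using T_cont by (simp add: continuous_on_eq_continuous_at)
    from isCont_tendsto_compose[OF this lim[OF that]] have "(\<lambda>m. G m x) \<longlonglongrightarrow> T n (h' x)" by (simp add: G_def)
    moreover have "T n (h' x) = h' x" by (rule T_id) (simp add: h'_def T_bd)
    ultimately show ?thesis by simp
  qed
  have aeN: "AE x in lborel. x \<notin> N"
  proof -
    have "N \<in> null_sets lebesgue" using N by (simp add: negligible_iff_null_sets)
    then have "AE x in lebesgue. x \<notin> N" by (rule AE_not_in)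
    then show ?thesis by (simp add: AE_completion_iff)
  qed
  have fin: "integrable lborel (\<lambda>x::'a. indicator (cball 0 R) x * (2 * real n))"
    by (intro integrable_mult_left integrable_real_indicator) (use emeasure_bounded_finite[OF bounded_cball] in auto)
  have diff_meas: "(\<lambda>x. indicator (cball 0 R) x * norm (h' x - G m x)) \<in> borel_measurable lborel" for m
    by (intro borel_measurable_times borel_measurable_indicator borel_measurable_norm borel_measurable_diff)
      (use h'm Gm in simp_all)
  have dif_le: "norm (a - b) \<le> 2 * real n" if "norm a \<le> real n" "norm b \<le> real n" for a b :: complex
    using norm_triangle_ineq4[of a b] that by simp
  have "(\<lambda>m. integral\<^sup>L lborel (\<lambda>x. indicator (cball 0 R) x * norm (h' x - G m x))) \<longlonglongrightarrow> integral\<^sup>L lborel (\<lambda>x::'a. 0)"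
  proof (rule integral_dominated_convergence[OF _ _ fin])
    show "AE x in lborel. norm (indicator (cball 0 R) x * norm (h' x - G m x)) \<le> indicator (cball 0 R) x * (2 * real n)" for m
      using dif_le[OF T_bd T_bd] by (intro AE_I2) (auto simp: h'_def G_def indicator_def)
    show "AE x in lborel. (\<lambda>m. indicator (cball 0 R) x * norm (h' x - G m x)) \<longlonglongrightarrow> 0"
      using aeN
    proof eventually_elim
      case (elim x)
      have "(\<lambda>m. h' x - G m x) \<longlonglongrightarrow> h' x - h' x" by (intro tendsto_diff tendsto_const G_lim elim)
      then have "(\<lambda>m. norm (h' x - G m x)) \<longlonglongrightarrow> 0" by (simp add: tendsto_norm_zero)
      then show ?case by (rule tendsto_mult_right_zero)
    qed
  qed (simp, rule diff_meas)
  then have "\<forall>\<^sub>F m in sequentially. integral\<^sup>L lborel (\<lambda>x. indicator (cball 0 R) x * norm (h' x - G m x)) < \<eta> / 2"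
    using \<eta> by (intro order_tendstoD(2)[where y=0]) auto
  then obtain m where m: "integral\<^sup>L lborel (\<lambda>x. indicator (cball 0 R) x * norm (h' x - G m x)) < \<eta> / 2"
    by (auto simp: eventually_sequentially)
  have i2: "integrable lborel (\<lambda>x. indicator (cball 0 R) x * norm (h' x - G m x))"
    by (rule Bochner_Integration.integrable_bound[OF fin diff_meas])
      (use dif_le[OF T_bd T_bd] in \<open>auto simp: h'_def G_def indicator_def intro!: AE_I2\<close>)
  have i1: "integrable lborel (\<lambda>x. norm (h x - h' x))"
  proof (rule Bochner_Integration.integrable_bound)
    show "integrable lborel (\<lambda>x. 2 * norm (h x))" using h by simp
    show "AE x in lborel. norm (norm (h x - h' x)) \<le> norm (2 * norm (h x))"
    proof (rule AE_I2)
      fix x show "norm (norm (h x - h' x)) \<le> norm (2 * norm (h x))"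
        using norm_triangle_ineq4[of "h x" "h' x"] T_le[of n "h x"] by (simp add: h'_def)
    qed
  qed measurable
  have "integral\<^sup>L lborel (\<lambda>x. indicator (cball 0 R) x * norm (h x - G m x))
      \<le> integral\<^sup>L lborel (\<lambda>x. norm (h x - h' x) + indicator (cball 0 R) x * norm (h' x - G m x))"
  proof (rule integral_mono')
    show "integrable lborel (\<lambda>x. norm (h x - h' x) + indicator (cball 0 R) x * norm (h' x - G m x))"
      using i1 i2 by (rule Bochner_Integration.integrable_add)
    fix x
    show "indicator (cball 0 R) x * norm (h x - G m x) \<le> norm (h x - h' x) + indicator (cball 0 R) x * norm (h' x - G m x)"
      using norm_triangle_ineq[of "h x - h' x" "h' x - G m x"] by (auto simp: indicator_def)
  qed auto
  also have "\<dots> < \<eta>"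
  proof -
    have "integral\<^sup>L lborel (\<lambda>x. norm (h x - h' x)) < \<eta> / 2" using n by (simp add: h'_def)
    then show ?thesis using m i1 i2 by simp
  qed
  finally show ?thesis using G_cont by blast
qed

subsection \<open>Regularity of weakly holomorphic functions\<close>

lemma bump'_uminus: "bump' m r (y - x) v = - bump' m r (x - y) v"
  by (simp add: bump'_def bump_commute[of _ r y x] inner_diff_left algebra_simps)

text \<open>The Cauchy-Riemann equations in the coordinate directions suffice, because the vectors
  \<open>axis j 1\<close> and \<open>axis j \<i>\<close> span the space over the reals.\<close>

lemma complex_linear_of_axes:
  fixes D :: "complex^'n::finite \<Rightarrow> complex"
  assumes lin: "linear D" and cr: "\<And>j. D (axis j 1) + \<i> * D (axis j \<i>) = 0"
  shows "D (c *s v) = c * D v"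
proof -
  have ax: "D (axis j a) = a * D (axis j 1)" for j a
  proof -
    have "\<i> * (D (axis j 1) + \<i> * D (axis j \<i>)) = 0" using cr[of j] by simp
    then have i: "D (axis j \<i>) = \<i> * D (axis j 1)" by (simp add: distrib_left mult.assoc[symmetric])
    have "axis j a = Re a *\<^sub>R axis j 1 + Im a *\<^sub>R axis j \<i>"
      by (simp add: vec_eq_iff axis_def complex_eq_iff)
    then have "D (axis j a) = Re a *\<^sub>R D (axis j 1) + Im a *\<^sub>R D (axis j \<i>)"
      by (simp add: linear_add[OF lin] linear_cmul[OF lin])
    also have "\<dots> = (of_real (Re a) + \<i> * of_real (Im a)) * D (axis j 1)"
      by (simp add: i scaleR_conv_of_real algebra_simps)
    finally show ?thesis by (simp add: complex_eq[symmetric])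
  qed
  have D: "D w = (\<Sum>j\<in>UNIV. w $ j * D (axis j 1))" for w
  proof -
    have "D w = D (\<Sum>j\<in>UNIV. axis j (w $ j))"
      using basis_expansion[of w] by (simp add: axis_smult[symmetric])
    also have "\<dots> = (\<Sum>j\<in>UNIV. D (axis j (w $ j)))" by (rule linear_sum[OF lin])
    also have "\<dots> = (\<Sum>j\<in>UNIV. w $ j * D (axis j 1))" by (rule sum.cong[OF refl ax])
    finally show ?thesis .
  qed
  show ?thesis unfolding D[of v] D[of "c *s v"] by (simp add: sum_distrib_left mult_ac)
qed

lemma test_function_wirtinger_bar:
  fixes \<phi> :: "complex^'n::finite \<Rightarrow> complex"
  assumes \<phi>: "\<phi> \<in> test_functions \<Omega>"
  shows "continuous_on UNIV (wirtinger_bar j \<phi>)" "\<exists>B. \<forall>z. norm (wirtinger_bar j \<phi> z) \<le> B"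
proof -
  define K where "K = closure {z. \<phi> z \<noteq> 0}"
  have K: "compact K" and smooth: "C_k (Suc 0) \<phi>"
    using \<phi> unfolding test_functions_def K_def by (simp, blast)
  have "continuous_on UNIV (\<lambda>z. frechet_derivative \<phi> (at z) v)" for v using smooth by simp
  then show cont: "continuous_on UNIV (wirtinger_bar j \<phi>)"
    unfolding wirtinger_bar_def[abs_def] by (intro continuous_intros) auto
  obtain B where B: "\<And>z. z \<in> K \<Longrightarrow> norm (wirtinger_bar j \<phi> z) \<le> B"
    using bounded_image_compact[OF K continuous_on_subset[OF cont subset_UNIV]] by blast
  have "wirtinger_bar j \<phi> z = 0" if "z \<notin> K" for z
  proof -
    have "open (- K)" using compact_imp_closed[OF K] by (simp add: open_Compl)
    then have "(\<phi> has_derivative (\<lambda>v. 0)) (at z)"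
      using that closure_subset[of "{z. \<phi> z \<noteq> 0}"]
      by (intro has_derivative_transform_within_open[OF has_derivative_const[of 0], of "- K"]) (auto simp: K_def)
    then have "frechet_derivative \<phi> (at z) = (\<lambda>v. 0)" by (simp add: frechet_derivative_at[symmetric])
    then show ?thesis by (simp add: wirtinger_bar_def)
  qed
  then have "norm (wirtinger_bar j \<phi> z) \<le> \<bar>B\<bar>" for z using B[of z] by (cases "z \<in> K") auto
  then show "\<exists>B. \<forall>z. norm (wirtinger_bar j \<phi> z) \<le> B" by blast
qed

context bounded_open_set
begin

lemma integrable_mult_wirtinger_bar:
  assumes f: "integrable (lebesgue_on \<Omega>) f" and \<phi>: "\<phi> \<in> test_functions \<Omega>"
  shows "integrable (lebesgue_on \<Omega>) (\<lambda>z. f z * wirtinger_bar j \<phi> z)"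
proof -
  obtain B where B: "\<And>z. norm (wirtinger_bar j \<phi> z) \<le> B" using test_function_wirtinger_bar(2)[OF \<phi>] by blast
  have [measurable]: "wirtinger_bar j \<phi> \<in> borel_measurable (lebesgue_on \<Omega>)"
    by (intro continuous_imp_measurable_on_sets_lebesgue continuous_on_subset[OF test_function_wirtinger_bar(1)[OF \<phi>]]) auto
  have [measurable]: "f \<in> borel_measurable (lebesgue_on \<Omega>)" using f by (rule borel_measurable_integrable)
  show ?thesis
  proof (rule Bochner_Integration.integrable_bound)
    show "integrable (lebesgue_on \<Omega>) (\<lambda>z. norm (f z) * B)" using f by simp
    have "norm (f z * wirtinger_bar j \<phi> z) \<le> norm (norm (f z) * B)" for z
      using mult_left_mono[OF B[of z] norm_ge_zero[of "f z"]] abs_ge_self[of "norm (f z) * B"]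
      unfolding norm_mult real_norm_def by linarith
    then show "AE z in lebesgue_on \<Omega>. norm (f z * wirtinger_bar j \<phi> z) \<le> norm (norm (f z) * B)" by simp
  qed measurable
qed

text \<open>Convolution integrals over the product space require Borel functions.\<close>

lemma borel_representative:
  fixes f :: "complex^'n \<Rightarrow> complex"
  assumes f: "integrable (lebesgue_on \<Omega>) f"
  obtains h where "integrable lborel h" "\<forall>z. z \<notin> \<Omega> \<longrightarrow> h z = 0" "AE z in lebesgue_on \<Omega>. h z = f z"
proof -
  define F where "F = (\<lambda>z. indicator \<Omega> z *\<^sub>R f z)"
  have F: "integrable lebesgue F"
    using f unfolding F_def by (subst (asm) integrable_restrict_space) simp_all
  have ReIm: "(\<lambda>z. Re (F z)) \<in> borel_measurable lebesgue" "(\<lambda>z. Im (F z)) \<in> borel_measurable lebesgue"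
    using borel_measurable_integrable[OF F] by simp_all
  obtain a where a[measurable]: "a \<in> borel_measurable lborel" and ab: "AE z in lborel. Re (F z) = a z"
    using completion_ex_borel_measurable_real[OF ReIm(1)] by blast
  obtain b where b[measurable]: "b \<in> borel_measurable lborel" and ab2: "AE z in lborel. Im (F z) = b z"
    using completion_ex_borel_measurable_real[OF ReIm(2)] by blast
  define h where "h = (\<lambda>z. indicator \<Omega> z *\<^sub>R (complex_of_real (a z) + \<i> * complex_of_real (b z)))"
  have [measurable]: "\<Omega> \<in> sets borel" using open_\<Omega> by simp
  have hm: "h \<in> borel_measurable lborel" unfolding h_def by measurable
  have ae: "AE z in lborel. F z = h z"
    using ab ab2 by eventually_elim (auto simp: h_def F_def indicator_def complex_eq_iff)
  then have ae': "AE z in lebesgue. F z = h z" by (rule AE_completion)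
  have "integrable lebesgue h"
    by (rule integrable_cong_AE_imp[OF F]) (use hm ae' in \<open>auto intro: measurable_completion elim: eventually_mono\<close>)
  then have "integrable lborel h" by (simp add: integrable_completion[OF hm])
  moreover have "\<forall>z. z \<notin> \<Omega> \<longrightarrow> h z = 0" by (simp add: h_def)
  moreover have "AE z in lebesgue_on \<Omega>. h z = f z"
    using ae' by (subst AE_restrict_space_iff) (auto elim!: eventually_mono simp: F_def)
  ultimately show ?thesis by (rule that)
qed

lemma integrable_lborel_imp_\<Omega>:
  fixes F :: "complex^'n \<Rightarrow> 'b::{banach,second_countable_topology}"
  assumes F: "integrable lborel F"
  shows "integrable (lebesgue_on \<Omega>) F"
    "integral\<^sup>L (lebesgue_on \<Omega>) (\<lambda>z. norm (F z)) \<le> integral\<^sup>L lborel (\<lambda>z. norm (F z))"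
proof -
  have [measurable]: "\<Omega> \<in> sets borel" using open_\<Omega> by simp
  have "integrable lebesgue F" using F by (simp add: integrable_completion borel_measurable_integrable)
  then show "integrable (lebesgue_on \<Omega>) F"
    by (subst integrable_restrict_space) (auto intro: integrable_mult_indicator)
  have Fm: "F \<in> borel_measurable borel" using F by auto
  have "integral\<^sup>L (lebesgue_on \<Omega>) (\<lambda>z. norm (F z)) = integral\<^sup>L lebesgue (\<lambda>z. indicator \<Omega> z *\<^sub>R norm (F z))"
    by (rule integral_restrict_space) simp
  also have "\<dots> = integral\<^sup>L lborel (\<lambda>z. indicator \<Omega> z *\<^sub>R norm (F z))"
    using Fm by (intro integral_completion) simp
  also have "\<dots> \<le> integral\<^sup>L lborel (\<lambda>z. norm (F z))"
    by (rule integral_mono') (use F in \<open>auto simp: indicator_def\<close>)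
  finally show "integral\<^sup>L (lebesgue_on \<Omega>) (\<lambda>z. norm (F z)) \<le> integral\<^sup>L lborel (\<lambda>z. norm (F z))" .
qed

lemma integrable_mollify:
  fixes h :: "complex^'n \<Rightarrow> complex"
  assumes h: "integrable lborel h" and e: "\<epsilon> > 0"
  shows "integrable lborel (mollify \<epsilon> h)"
    "integral\<^sup>L lborel (\<lambda>z. norm (mollify \<epsilon> h z)) \<le> integral\<^sup>L lborel (\<lambda>z. norm (h z))"
proof -
  have eq: "(\<integral>\<^sup>+z. ennreal (norm (h z)) \<partial>lborel) = ennreal (integral\<^sup>L lborel (\<lambda>z. norm (h z)))"
    using h by (intro nn_integral_eq_integral) auto
  note le = mollify_L1_le[OF h e, unfolded eq]
  show i: "integrable lborel (mollify \<epsilon> h)"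
    by (rule integrableI_bounded) (use mollify_measurable[OF h e] le in \<open>auto intro: le_less_trans\<close>)
  have "(\<integral>\<^sup>+z. ennreal (norm (mollify \<epsilon> h z)) \<partial>lborel) = ennreal (integral\<^sup>L lborel (\<lambda>z. norm (mollify \<epsilon> h z)))"
    using i by (intro nn_integral_eq_integral) auto
  with le show "integral\<^sup>L lborel (\<lambda>z. norm (mollify \<epsilon> h z)) \<le> integral\<^sup>L lborel (\<lambda>z. norm (h z))"
    by (simp add: ennreal_le_iff)
qed

text \<open>The kernel of the mollification at \<open>z\<close> is a test function as soon as the closed ball of radius
  \<open>\<epsilon>\<close> around \<open>z\<close> lies in \<open>\<Omega>\<close>.\<close>

lemma mollify_complex_deriv:
  fixes h :: "complex^'n \<Rightarrow> complex"
  assumes h: "integrable lborel h" and h0: "\<And>z. z \<notin> \<Omega> \<Longrightarrow> h z = 0"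
    and weak: "\<And>j \<phi>. \<phi> \<in> test_functions \<Omega> \<Longrightarrow> integral\<^sup>L (lebesgue_on \<Omega>) (\<lambda>z. h z * wirtinger_bar j \<phi> z) = 0"
    and e: "\<epsilon> > 0" and sub: "cball z \<epsilon> \<subseteq> \<Omega>"
  shows "\<exists>D. complex_deriv (mollify \<epsilon> h) z D"
proof -
  define c where "c = complex_of_real (bump_mass \<epsilon> TYPE(complex^'n))"
  define D where "D = (\<lambda>v. (\<integral>w. h w * of_real (bump' 0 \<epsilon> (z - w) v) \<partial>lborel) / c)"
  have der: "(mollify \<epsilon> h has_derivative D) (at z)"
    unfolding D_def c_def by (rule mollify_has_derivative[OF h e])
  define \<phi> where "\<phi> = (\<lambda>w. complex_of_real (bump 0 \<epsilon> (w - z)))"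
  have \<phi>: "\<phi> \<in> test_functions \<Omega>" unfolding \<phi>_def by (rule bump_test_function[OF e sub])
  have d\<phi>: "frechet_derivative \<phi> (at w) v = - of_real (bump' 0 \<epsilon> (z - w) v)" for w v
  proof -
    have "((\<lambda>x. x - z) has_derivative (\<lambda>v. v)) (at w)" by (auto intro!: derivative_eq_intros)
    from has_derivative_compose[OF this bump_has_derivative]
    have "((\<lambda>x. bump 0 \<epsilon> (x - z)) has_derivative bump' 0 \<epsilon> (w - z)) (at w)" by simp
    from has_derivative_of_real[OF this]
    have "(\<phi> has_derivative (\<lambda>v. complex_of_real (bump' 0 \<epsilon> (w - z) v))) (at w)" by (simp add: \<phi>_def)
    then have "frechet_derivative \<phi> (at w) = (\<lambda>v. complex_of_real (bump' 0 \<epsilon> (w - z) v))"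
      by (simp add: frechet_derivative_at[symmetric])
    then show ?thesis using bump'_uminus[of 0 \<epsilon> w z v] by simp
  qed
  have int: "integrable lborel (\<lambda>w. h w * of_real (bump' 0 \<epsilon> (z - w) v))" for v
  proof -
    obtain B where B: "\<And>x v::complex^'n. norm (bump' 0 \<epsilon> x v) \<le> B * norm v" using bump'_bounded[OF e] by blast
    have [measurable]: "h \<in> borel_measurable borel" using h by auto
    have [measurable]: "(\<lambda>w. bump' 0 \<epsilon> (z - w) v) \<in> borel_measurable borel"
      by (rule measurable_compose[OF _ borel_measurable_continuous_onI[OF continuous_bump'[of _ 0 \<epsilon> v]]]) simp
    show ?thesis
    proof (rule Bochner_Integration.integrable_bound)
      show "integrable lborel (\<lambda>w. norm (h w) * (B * norm v))" using h by simp
      have "norm (h w * of_real (bump' 0 \<epsilon> (z - w) v)) \<le> norm (norm (h w) * (B * norm v))" for w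
        using mult_left_mono[OF B[of "z - w" v] norm_ge_zero[of "h w"]] abs_ge_self[of "norm (h w) * (B * norm v)"]
        unfolding norm_mult norm_of_real real_norm_def by linarith
      then show "AE w in lborel. norm (h w * of_real (bump' 0 \<epsilon> (z - w) v)) \<le> norm (norm (h w) * (B * norm v))" by simp
    qed measurable
  qed
  have cr: "D (axis j 1) + \<i> * D (axis j \<i>) = 0" for j
  proof -
    let ?b = "\<lambda>v w. complex_of_real (bump' 0 \<epsilon> (z - w) v)"
    have wirt: "h w * wirtinger_bar j \<phi> w = (- 1/2) * (h w * ?b (axis j 1) w + \<i> * (h w * ?b (axis j \<i>) w))" for w
      by (simp add: wirtinger_bar_def d\<phi> field_simps)
    have i: "integrable lborel (\<lambda>w. h w * wirtinger_bar j \<phi> w)"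
      unfolding wirt using int by simp
    have "(\<integral>w. h w * ?b (axis j 1) w \<partial>lborel) + \<i> * (\<integral>w. h w * ?b (axis j \<i>) w \<partial>lborel)
        = - 2 * (\<integral>w. h w * wirtinger_bar j \<phi> w \<partial>lborel)"
      unfolding wirt using int by simp (simp add: diff_divide_distrib add_divide_distrib)
    also have "(\<integral>w. h w * wirtinger_bar j \<phi> w \<partial>lborel) = integral\<^sup>L lebesgue (\<lambda>w. h w * wirtinger_bar j \<phi> w)"
      by (rule integral_completion[OF borel_measurable_integrable[OF i], symmetric])
    also have "(\<lambda>w. h w * wirtinger_bar j \<phi> w) = (\<lambda>w. indicator \<Omega> w *\<^sub>R (h w * wirtinger_bar j \<phi> w))"
      using h0 by (auto simp: indicator_def)
    also have "integral\<^sup>L lebesgue (\<lambda>w. indicator \<Omega> w *\<^sub>R (h w * wirtinger_bar j \<phi> w))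
        = integral\<^sup>L (lebesgue_on \<Omega>) (\<lambda>w. h w * wirtinger_bar j \<phi> w)"
      by (rule integral_restrict_space[symmetric]) simp
    also have "\<dots> = 0" by (rule weak[OF \<phi>])
    finally have "((\<integral>w. h w * ?b (axis j 1) w \<partial>lborel) + \<i> * (\<integral>w. h w * ?b (axis j \<i>) w \<partial>lborel)) / c = 0" by simp
    then show ?thesis unfolding D_def by (simp only: add_divide_distrib times_divide_eq_right)
  qed
  have "linear D" using der has_derivative_linear by blast
  from complex_linear_of_axes[OF this cr] der show ?thesis by (auto simp: complex_deriv_def)
qed

text \<open>Up to an error which is small in \<open>L^1\<close>, and which mollification does not enlarge, \<open>h\<close> is
  continuous on a large ball; for continuous functions the convergence is uniform.\<close>

lemma mollify_L1_convergence:
  fixes h :: "complex^'n \<Rightarrow> complex"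
  assumes h: "integrable lborel h" and h0: "\<And>z. z \<notin> \<Omega> \<Longrightarrow> h z = 0"
  shows "(\<lambda>k. Lp_norm \<Omega> 1 (\<lambda>z. mollify (1 / real (Suc k)) h z - h z)) \<longlonglongrightarrow> 0"
proof (rule LIMSEQ_I)
  fix e :: real assume e: "e > 0"
  define \<eta> where "\<eta> = e / (vol + 3)"
  have \<eta>: "\<eta> > 0" using e vol_pos by (simp add: \<eta>_def)
  obtain R where R: "\<And>z. z \<in> \<Omega> \<Longrightarrow> norm z \<le> R" using bounded_\<Omega> by (auto simp: bounded_iff)
  \<comment> \<open>The kernels have radius at most 1, so at points of \<open>\<Omega>\<close> only values on \<open>S\<close> enter.\<close>
  define S where "S = cball (0::complex^'n) (R + 1)"
  obtain g where g: "continuous_on UNIV g"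
    and gh: "integral\<^sup>L lborel (\<lambda>x. indicator S x * norm (h x - g x)) < \<eta>"
    using L1_continuous_approximation[OF h \<eta>, of "R + 1"] by (auto simp: S_def)
  have "uniformly_continuous_on S g"
    unfolding S_def by (rule compact_uniformly_continuous[OF continuous_on_subset[OF g subset_UNIV] compact_cball])
  then obtain \<delta> where \<delta>: "\<delta> > 0" "\<And>z w. z \<in> S \<Longrightarrow> w \<in> S \<Longrightarrow> dist w z < \<delta> \<Longrightarrow> dist (g w) (g z) < \<eta>"
    using \<eta> unfolding uniformly_continuous_on_def by metis
  define g' where "g' = (\<lambda>x. indicator S x *\<^sub>R g x)"
  define d where "d = (\<lambda>x. h x - g' x)"
  have \<Omega>S: "z \<in> S" if "z \<in> \<Omega>" for z using R[OF that] by (simp add: S_def)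
  have g': "integrable lborel g'"
    unfolding g'_def S_def by (rule borel_integrable_compact[OF compact_cball continuous_on_subset[OF g subset_UNIV]])
  have d: "integrable lborel d" unfolding d_def using h g' by simp
  have "norm (d x) = indicator S x * norm (h x - g x)" for x
    using h0[of x] \<Omega>S[of x] by (auto simp: d_def g'_def indicator_def)
  then have d_small: "integral\<^sup>L lborel (\<lambda>x. norm (d x)) < \<eta>" using gh by simp
  obtain k0 where k0: "1 / real (Suc k0) < \<delta>" using \<delta>(1) nat_approx_posE by blast
  have "Lp_norm \<Omega> 1 (\<lambda>z. mollify (1 / real (Suc k)) h z - h z) < e" if k: "k \<ge> k0" for k
  proof -
    define \<epsilon> where "\<epsilon> = 1 / real (Suc k)"
    have \<epsilon>: "\<epsilon> > 0" "\<epsilon> \<le> 1" "\<epsilon> < \<delta>"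
    proof -
      show "\<epsilon> > 0" "\<epsilon> \<le> 1" by (simp_all add: \<epsilon>_def)
      have "\<epsilon> \<le> 1 / real (Suc k0)" unfolding \<epsilon>_def using k by (simp add: frac_le)
      with k0 show "\<epsilon> < \<delta>" by simp
    qed
    have pt: "norm (mollify \<epsilon> h z - h z) \<le> norm (mollify \<epsilon> d z) + \<eta> + norm (d z)" if z: "z \<in> \<Omega>" for z
    proof -
      have "norm (mollify \<epsilon> g' z - g z) \<le> \<eta>"
      proof (rule mollify_close[OF g' \<epsilon>(1)])
        fix w assume w: "dist w z < \<epsilon>"
        have "norm w \<le> norm z + dist w z" using norm_triangle_sub[of w z] by (simp add: dist_norm)
        then have wS: "w \<in> S" using R[OF z] w \<epsilon>(2) by (simp add: S_def)
        have "dist (g w) (g z) < \<eta>" using \<delta>(2)[OF \<Omega>S[OF z] wS] w \<epsilon>(3) by simp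
        then show "norm (g' w - g z) \<le> \<eta>" using wS by (simp add: g'_def dist_norm)
      qed
      moreover have "mollify \<epsilon> h z = mollify \<epsilon> d z + mollify \<epsilon> g' z"
        using mollify_add[OF d g', of \<epsilon> z] by (simp add: d_def)
      moreover have "g z - h z = - d z" using \<Omega>S[OF z] by (simp add: d_def g'_def)
      moreover have "norm (mollify \<epsilon> d z + (mollify \<epsilon> g' z - g z) + (- d z))
          \<le> norm (mollify \<epsilon> d z) + norm (mollify \<epsilon> g' z - g z) + norm (d z)"
        using norm_triangle_ineq[of "mollify \<epsilon> d z + (mollify \<epsilon> g' z - g z)" "- d z"]
          norm_triangle_ineq[of "mollify \<epsilon> d z" "mollify \<epsilon> g' z - g z"] by simp
      ultimately show ?thesis by (simp add: algebra_simps)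
    qed
    have i1: "integrable (lebesgue_on \<Omega>) (\<lambda>z. norm (mollify \<epsilon> d z))" "integrable (lebesgue_on \<Omega>) (\<lambda>z. norm (d z))"
      using integrable_lborel_imp_\<Omega>(1)[OF integrable_mollify(1)[OF d \<epsilon>(1)]] integrable_lborel_imp_\<Omega>(1)[OF d] by auto
    have "integral\<^sup>L (lebesgue_on \<Omega>) (\<lambda>z. norm (mollify \<epsilon> h z - h z))
        \<le> integral\<^sup>L (lebesgue_on \<Omega>) (\<lambda>z. norm (mollify \<epsilon> d z) + \<eta> + norm (d z))"
    proof (rule integral_mono)
      show "integrable (lebesgue_on \<Omega>) (\<lambda>z. norm (mollify \<epsilon> h z - h z))"
        using integrable_lborel_imp_\<Omega>(1)[OF integrable_mollify(1)[OF h \<epsilon>(1)]] integrable_lborel_imp_\<Omega>(1)[OF h] by simp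
    qed (use i1 pt in auto)
    also have "\<dots> = integral\<^sup>L (lebesgue_on \<Omega>) (\<lambda>z. norm (mollify \<epsilon> d z)) + \<eta> * vol + integral\<^sup>L (lebesgue_on \<Omega>) (\<lambda>z. norm (d z))"
      using i1 integral_const_\<Omega>[of \<eta>] by simp
    also have "\<dots> \<le> \<eta> + \<eta> * vol + \<eta>"
      using integrable_lborel_imp_\<Omega>(2)[OF integrable_mollify(1)[OF d \<epsilon>(1)]] integrable_mollify(2)[OF d \<epsilon>(1)]
        integrable_lborel_imp_\<Omega>(2)[OF d] d_small by simp
    also have "\<dots> < \<eta> * (vol + 3)" using \<eta> by (simp add: algebra_simps)
    also have "\<dots> = e" using vol_pos by (simp add: \<eta>_def)
    finally show ?thesis by (simp add: Lp_norm_def \<epsilon>_def)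
  qed
  then show "\<exists>n0. \<forall>n\<ge>n0. norm (Lp_norm \<Omega> 1 (\<lambda>z. mollify (1 / real (Suc n)) h z - h z) - 0) < e" by auto
qed

text \<open>The mollifications are holomorphic away from the boundary and bounded in \<open>L^1\<close>, so a
  subsequence converges locally uniformly; its limit agrees with \<open>f\<close> because the mollifications also
  converge to \<open>f\<close> in \<open>L^1\<close>.\<close>

theorem Weyl_dbar:
  fixes f :: "complex^'n \<Rightarrow> complex"
  assumes f: "integrable (lebesgue_on \<Omega>) f"
    and weak: "\<And>j \<phi>. \<phi> \<in> test_functions \<Omega> \<Longrightarrow> integral\<^sup>L (lebesgue_on \<Omega>) (\<lambda>z. f z * wirtinger_bar j \<phi> z) = 0"
  shows "\<exists>H. holo_on \<Omega> H \<and> (AE z in lebesgue_on \<Omega>. f z = H z)"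
proof -
  obtain h where h: "integrable lborel h" and h_out: "\<forall>z. z \<notin> \<Omega> \<longrightarrow> h z = 0"
    and ae: "AE z in lebesgue_on \<Omega>. h z = f z" by (rule borel_representative[OF f])
  note h0 = h_out[rule_format]
  have h\<Omega>: "integrable (lebesgue_on \<Omega>) h" by (rule integrable_lborel_imp_\<Omega>(1)[OF h])
  have weak_h: "integral\<^sup>L (lebesgue_on \<Omega>) (\<lambda>z. h z * wirtinger_bar j \<phi> z) = 0" if \<phi>: "\<phi> \<in> test_functions \<Omega>" for j \<phi>
  proof -
    have "integral\<^sup>L (lebesgue_on \<Omega>) (\<lambda>z. h z * wirtinger_bar j \<phi> z) = integral\<^sup>L (lebesgue_on \<Omega>) (\<lambda>z. f z * wirtinger_bar j \<phi> z)"
      by (rule integral_cong_AE[OF borel_measurable_integrable[OF integrable_mult_wirtinger_bar[OF h\<Omega> \<phi>]]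
          borel_measurable_integrable[OF integrable_mult_wirtinger_bar[OF f \<phi>]]])
        (use ae in \<open>auto elim: eventually_mono\<close>)
    with weak[OF \<phi>] show ?thesis by simp
  qed
  define \<epsilon> where "\<epsilon> = (\<lambda>k. 1 / real (Suc k))"
  have \<epsilon>: "\<epsilon> k > 0" for k by (simp add: \<epsilon>_def)
  define u where "u = (\<lambda>k. mollify (\<epsilon> k) h)"
  define I where "I = integral\<^sup>L lborel (\<lambda>z. norm (h z))"
  have uI: "integrable lborel (u k)" "integral\<^sup>L lborel (\<lambda>z. norm (u k z)) \<le> I" for k
    unfolding u_def I_def using integrable_mollify[OF h \<epsilon>] by auto
  obtain s H where s: "strict_mono (s :: nat \<Rightarrow> nat)" and H: "holo_on \<Omega> H"
    and lim: "locally_uniform_limit \<Omega> (\<lambda>k. u (s k)) H"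
  proof (rule Montel_several[of \<Omega> u])
    fix z assume "z \<in> \<Omega>"
    then obtain r where r: "r > 0" "cball z r \<subseteq> \<Omega>" using open_\<Omega> open_contains_cball by blast
    \<comment> \<open>For \<open>\<epsilon> \<le> r/3\<close> the mollifications are holomorphic on \<open>B\<close>, and balls of radius \<open>r/3\<close> around points
      of the smaller ball of radius \<open>r/3\<close> lie in \<open>B\<close>.\<close>
    define B where "B = ball z (2 * r / 3)"
    have BB: "B \<subseteq> \<Omega>" unfolding B_def using r by (auto simp: subset_iff)
    interpret B: bounded_open_set B
      by unfold_locales (use r in \<open>auto simp: B_def\<close>)
    define m where "m = measure lborel (ball (0::complex^'n) (r/3))"
    have m: "m > 0" unfolding m_def using content_ball_pos[of "r/3" 0] r by simp
    obtain N where N: "1 / real (Suc N) < r / 3" using nat_approx_posE[of "r/3"] r(1) by auto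
    have hol: "holo_on B (u k)" if k: "k \<ge> N" for k
      unfolding holo_on_iff
    proof
      fix w assume w: "w \<in> B"
      have "\<epsilon> k \<le> 1 / real (Suc N)" unfolding \<epsilon>_def using k by (simp add: frac_le)
      then have ek: "\<epsilon> k \<le> r / 3" using N by simp
      have "cball w (\<epsilon> k) \<subseteq> cball z r"
      proof
        fix y assume "y \<in> cball w (\<epsilon> k)"
        then have "dist w y \<le> r / 3" using ek by simp
        moreover have "dist z w < 2 * r / 3" using w by (simp add: B_def)
        ultimately show "y \<in> cball z r" using dist_triangle[of z y w] by simp
      qed
      then show "\<exists>D. complex_deriv (u k) w D"
        unfolding u_def using r(2) by (intro mollify_complex_deriv[OF h h0 weak_h \<epsilon>]) auto
    qed
    have bd: "norm (u k w) \<le> I / m" if k: "k \<ge> N" and w: "w \<in> ball z (r/3)" for k w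
    proof -
      have sub: "ball w (r/3) \<subseteq> B"
      proof
        fix y assume "y \<in> ball w (r/3)"
        then show "y \<in> B" using w dist_triangle[of z y w] by (simp add: B_def)
      qed
      have "norm (u k w) \<le> integral\<^sup>L (lebesgue_on B) (\<lambda>z. norm (u k z)) / m"
        unfolding m_def using B.integrable_lborel_imp_\<Omega>(1)[OF uI(1)[of k]] r(1)
        by (intro holo_bound_by_L1[OF B.open_\<Omega> hol[OF k] _ sub]) auto
      also have "\<dots> \<le> I / m"
        using B.integrable_lborel_imp_\<Omega>(2)[OF uI(1)[of k]] uI(2)[of k] m by (intro divide_right_mono) auto
      finally show ?thesis .
    qed
    have sub3: "ball z (r/3) \<subseteq> B" unfolding B_def using r(1) by (intro subset_ball) simp
    have "holo_on (ball z (r/3)) (u k)" if "k \<ge> N" for k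
      by (rule holo_on_subset[OF hol[OF that] sub3])
    moreover have "ball z (r/3) \<subseteq> \<Omega>" "r/3 > 0" using sub3 BB r(1) by auto
    ultimately show "\<exists>r>0. \<exists>M N. ball z r \<subseteq> \<Omega> \<and> (\<forall>k\<ge>N. holo_on (ball z r) (u k) \<and> (\<forall>w\<in>ball z r. norm (u k w) \<le> M))"
      using bd by blast
  qed
  have diff_in: "(\<lambda>z. u (s k) z - h z) \<in> Lp \<Omega> 1" for k
    using integrable_lborel_imp_\<Omega>(1)[OF uI(1)[of "s k"]] h\<Omega> by (auto simp: Lp_def borel_measurable_integrable)
  have ptw: "(\<lambda>k. u (s k) z - h z) \<longlonglongrightarrow> H z - h z" if "z \<in> \<Omega>" for z
    by (intro tendsto_diff tendsto_const locally_uniform_limit_pointwise[OF lim that])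
  have conv: "(\<lambda>k. Lp_norm \<Omega> 1 (\<lambda>z. u (s k) z - h z)) \<longlonglongrightarrow> 0"
    using LIMSEQ_subseq_LIMSEQ[OF mollify_L1_convergence[OF h h0] s] by (simp add: o_def u_def \<epsilon>_def)
  note fat = Lp_Fatou[where u="\<lambda>k z. u (s k) z - h z", OF zero_less_one diff_in ptw order_refl conv]
  have "Lp_norm \<Omega> 1 (\<lambda>z. H z - h z) = 0" using fat(2) Lp_norm_nonneg[of \<Omega> 1 "\<lambda>z. H z - h z"] by linarith
  from Lp_norm_eq_0_AE[OF fat(1) this] have "AE z in lebesgue_on \<Omega>. H z - h z = 0" .
  with ae have "AE z in lebesgue_on \<Omega>. f z = H z" by eventually_elim simp
  with H show ?thesis by blast
qed

section \<open>Minimal solutions\<close>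

text \<open>Integration by parts and Weyl's lemma identify the competitors as the functions \<open>f - h\<close> with
  \<open>h\<close> in \<open>A^p\<close>.\<close>

theorem bergman_proj_minimal_solution:
  assumes p: "p > 1" and f: "f \<in> Lp \<Omega> p"
  shows "Lp_minimal_solution \<Omega> p f (\<lambda>z. f z - bergman_proj \<Omega> p f z)"
proof -
  have p0: "p > 0" and p1: "p \<ge> 1" using p by auto
  note P = bergman_proj[OF p f]
  have u: "(\<lambda>z. f z - bergman_proj \<Omega> p f z) \<in> Lp \<Omega> p" by (rule Lp_diff[OF p0 f Ap_Lp[OF P(1)]])
  have dbar: "dbar_eq \<Omega> (\<lambda>z. f z - bergman_proj \<Omega> p f z) f"
    unfolding dbar_eq_def
  proof (intro allI ballI)
    fix j \<phi> assume \<phi>: "\<phi> \<in> test_functions \<Omega>"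
    have "integral\<^sup>L (lebesgue_on \<Omega>) (\<lambda>z. (f z - bergman_proj \<Omega> p f z) * wirtinger_bar j \<phi> z)
      = integral\<^sup>L (lebesgue_on \<Omega>) (\<lambda>z. f z * wirtinger_bar j \<phi> z)
        - integral\<^sup>L (lebesgue_on \<Omega>) (\<lambda>z. bergman_proj \<Omega> p f z * wirtinger_bar j \<phi> z)"
      using Bochner_Integration.integral_diff[OF integrable_mult_wirtinger_bar[OF Lp_L1(2)[OF p1 f] \<phi>]
          integrable_mult_wirtinger_bar[OF Lp_L1(2)[OF p1 Ap_Lp[OF P(1)]] \<phi>], of j j]
      by (simp add: left_diff_distrib)
    also have "integral\<^sup>L (lebesgue_on \<Omega>) (\<lambda>z. bergman_proj \<Omega> p f z * wirtinger_bar j \<phi> z) = 0"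
      by (rule integral_holo_wirtinger_bar[OF open_\<Omega> Ap_holo[OF P(1)] \<phi>])
    finally show "dbar \<Omega> (\<lambda>z. f z - bergman_proj \<Omega> p f z) j \<phi> = dbar \<Omega> f j \<phi>"
      by (simp add: dbar_def)
  qed
  have min: "Lp_norm \<Omega> p (\<lambda>z. f z - bergman_proj \<Omega> p f z) \<le> Lp_norm \<Omega> p v \<and>
        (Lp_norm \<Omega> p v = Lp_norm \<Omega> p (\<lambda>z. f z - bergman_proj \<Omega> p f z) \<longrightarrow>
          (AE z in lebesgue_on \<Omega>. v z = f z - bergman_proj \<Omega> p f z))"
    if v: "v \<in> Lp \<Omega> p" and eq: "dbar_eq \<Omega> v f" for v
  proof -
    have "integrable (lebesgue_on \<Omega>) (\<lambda>z. f z - v z)"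
      by (rule Lp_L1(2)[OF p1 Lp_diff[OF p0 f v]])
    moreover have "integral\<^sup>L (lebesgue_on \<Omega>) (\<lambda>z. (f z - v z) * wirtinger_bar j \<phi> z) = 0"
      if \<phi>: "\<phi> \<in> test_functions \<Omega>" for j \<phi>
      using Bochner_Integration.integral_diff[OF integrable_mult_wirtinger_bar[OF Lp_L1(2)[OF p1 f] \<phi>]
          integrable_mult_wirtinger_bar[OF Lp_L1(2)[OF p1 v] \<phi>], of j j] eq \<phi>
      by (simp add: left_diff_distrib dbar_eq_def dbar_def)
    ultimately obtain h where h: "holo_on \<Omega> h" and ae: "AE z in lebesgue_on \<Omega>. f z - v z = h z"
      using Weyl_dbar by blast
    have "h \<in> Lp \<Omega> p"
      by (rule Lp_cong_AE[OF Lp_diff[OF p0 f v] holo_on_imp_lebesgue_measurable[OF open_\<Omega> h] ae])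
    with h have hA: "h \<in> Ap \<Omega> p" by (simp add: Ap_def)
    have "AE z in lebesgue_on \<Omega>. v z = f z - h z" using ae by eventually_elim (simp add: algebra_simps)
    then have vn: "Lp_norm \<Omega> p v = Lp_norm \<Omega> p (\<lambda>z. f z - h z)"
      by (intro Lp_norm_cong_AE) (use v Lp_diff[OF p0 f Ap_Lp[OF hA]] in auto)
    have "AE z in lebesgue_on \<Omega>. v z = f z - bergman_proj \<Omega> p f z"
      if equal: "Lp_norm \<Omega> p v = Lp_norm \<Omega> p (\<lambda>z. f z - bergman_proj \<Omega> p f z)"
    proof -
      have Ph: "bergman_proj \<Omega> p f z = h z" if "z \<in> \<Omega>" for z
        by (rule bergman_proj_eqI[OF p f hA _ that]) (use vn equal P(2) in simp)
      show ?thesis using ae AE_space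
      proof eventually_elim
        case (elim z)
        then show ?case using Ph[of z] by (simp add: algebra_simps)
      qed
    qed
    moreover have "Lp_norm \<Omega> p (\<lambda>z. f z - bergman_proj \<Omega> p f z) \<le> Lp_norm \<Omega> p v"
      unfolding P(2) vn by (rule Ap_dist_le[OF hA])
    ultimately show ?thesis by blast
  qed
  show ?thesis unfolding Lp_minimal_solution_def using u dbar min by blast
qed

end

theorem proposition8p2:
  fixes \<Omega> :: "(complex^'n::finite) set"
  assumes "open \<Omega>" and "connected \<Omega>" and "\<Omega> \<noteq> {}" and "bounded \<Omega>"
  shows
    "(\<forall>p>1. \<forall>f\<in>Lp \<Omega> p. dbar_well_defined \<Omega> f \<longrightarrow>
        Lp_minimal_solution \<Omega> p f (\<lambda>z. f z - bergman_proj \<Omega> p f z))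
     \<and>
     (simply_connected \<Omega> \<longrightarrow>
       (\<forall>p>1. \<forall>F\<in>Aut \<Omega>. \<forall>G. holo_power_branch \<Omega> (jac F) (2 / p) G \<longrightarrow>
          (\<forall>f\<in>Lp \<Omega> p. (\<lambda>z. f (F z) * G z) \<in> Lp \<Omega> p \<and>
             (\<forall>z\<in>\<Omega>. bergman_proj \<Omega> p f (F z) * G z
                      = bergman_proj \<Omega> p (\<lambda>w. f (F w) * G w) z)) \<and>
          (\<forall>f\<in>bergman_null \<Omega> p. (\<lambda>z. f (F z) * G z) \<in> bergman_null \<Omega> p)))
     \<and>
     (\<forall>p>1. \<exists>C>0. \<forall>f\<in>Lp \<Omega> p. \<forall>g\<in>Lp \<Omega> p.
        Lp_norm \<Omega> p (\<lambda>z. bergman_proj \<Omega> p f z - bergman_proj \<Omega> p g z) \<le>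
          (if 2 < p
           then C * (Lp_norm \<Omega> p f + Lp_norm \<Omega> p (\<lambda>z. f z - g z)) powr (1 - 1 / p)
                  * Lp_norm \<Omega> p (\<lambda>z. f z - g z) powr (1 / p)
           else C * (Lp_norm \<Omega> p f + Lp_norm \<Omega> p (\<lambda>z. f z - g z)) powr (1 / 2)
                  * Lp_norm \<Omega> p (\<lambda>z. f z - g z) powr (1 / 2)))
     \<and>
     (\<forall>f\<in>Linf \<Omega>. \<exists>(q :: nat \<Rightarrow> real) h.
        (\<forall>j. 1 < q j) \<and> strict_mono q \<and> filterlim q at_top sequentially \<and>
        h \<in> Ainf \<Omega> \<and>
        locally_uniform_limit \<Omega> (\<lambda>j. bergman_proj \<Omega> (q j) f) h \<and>
        Linf_norm \<Omega> (\<lambda>z. f z - h z) = Ainf_dist \<Omega> f)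
     \<and>
     (\<forall>f\<in>Linf \<Omega>. ((\<lambda>p. Ap_dist \<Omega> p f) \<longlongrightarrow> Ainf_dist \<Omega> f) at_top)"
proof -
  interpret bounded_open_set \<Omega>
    by unfold_locales (use assms in auto)
  have pullback: "(\<forall>f\<in>Lp \<Omega> p. (\<lambda>z. f (F z) * G z) \<in> Lp \<Omega> p \<and>
             (\<forall>z\<in>\<Omega>. bergman_proj \<Omega> p f (F z) * G z
                      = bergman_proj \<Omega> p (\<lambda>w. f (F w) * G w) z)) \<and>
          (\<forall>f\<in>bergman_null \<Omega> p. (\<lambda>z. f (F z) * G z) \<in> bergman_null \<Omega> p)"
    if "p > 1" "F \<in> Aut \<Omega>" "holo_power_branch \<Omega> (jac F) (2 / p) G" for p F G
  proof -
    interpret automorphism_weight \<Omega> F p G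
      by unfold_locales (use that in auto)
    show ?thesis
      using pull_Lp(1) bergman_proj_pull pull_null unfolding pull_def by auto
  qed
  show ?thesis
  proof (intro conjI)
    show "\<forall>p>1. \<forall>f\<in>Lp \<Omega> p. dbar_well_defined \<Omega> f \<longrightarrow>
        Lp_minimal_solution \<Omega> p f (\<lambda>z. f z - bergman_proj \<Omega> p f z)"
      using bergman_proj_minimal_solution by blast
    show "simply_connected \<Omega> \<longrightarrow>
       (\<forall>p>1. \<forall>F\<in>Aut \<Omega>. \<forall>G. holo_power_branch \<Omega> (jac F) (2 / p) G \<longrightarrow>
          (\<forall>f\<in>Lp \<Omega> p. (\<lambda>z. f (F z) * G z) \<in> Lp \<Omega> p \<and>
             (\<forall>z\<in>\<Omega>. bergman_proj \<Omega> p f (F z) * G z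
                      = bergman_proj \<Omega> p (\<lambda>w. f (F w) * G w) z)) \<and>
          (\<forall>f\<in>bergman_null \<Omega> p. (\<lambda>z. f (F z) * G z) \<in> bergman_null \<Omega> p))"
      using pullback by blast
  next
    show "\<forall>f\<in>Linf \<Omega>. \<exists>(q :: nat \<Rightarrow> real) h.
        (\<forall>j. 1 < q j) \<and> strict_mono q \<and> filterlim q at_top sequentially \<and>
        h \<in> Ainf \<Omega> \<and>
        locally_uniform_limit \<Omega> (\<lambda>j. bergman_proj \<Omega> (q j) f) h \<and>
        Linf_norm \<Omega> (\<lambda>z. f z - h z) = Ainf_dist \<Omega> f"
      using bergman_proj_large_exponents by blast
  qed (intro allI impI ballI bergman_proj_Hoelder Ap_dist_tendsto_Ainf_dist; assumption)+
qed

end
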